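(* For positive real numbers $a,b,c,d$, consider a positive random variable $\mathbf{X}_{a,b,c,d}$ satisfying $$\mathbb{E}(\mathbf{X}_{a,b,c,d}^s) = \frac{\Gamma(c)}{\Gamma(a)\Gamma(b)}\,\frac{\Gamma(a+s)\Gamma(b-s)}{\Gamma(c+ds)}, \qquad -a<s<b. $$ (I) $\mathbf{X}_{a,b,c,d}$ does not exist if any of the following conditions holds: (1) $d>2$; (2) $c<ad$; (3) $3a+b>c$ and $d=2$; (4) $1<d\leq 2$, $a+b\geq 1$ and $c<ad-d+f(d)$. (II) $\mathbf{X}_{a,b,c,d}$ exists if any of the following conditions holds: (1) $d\leq 1$ and $c\geq ad$; (2) $1<d\leq 2$, $a+b\leq 1$ and $c\geq ad-d+f(d)$; (3) $1<d\leq 2$, $\frac{2c}{d}\geq 3a+b$ and $2\left(\frac{c}{d}-a\right)\left(\frac{c}{d}+\frac12-a\right)\geq a+b$. Here $f$ is the threshold function on $[1,2]$ for non-negativity of the two-parametric Mittag-Leffler function on the negative half-line, as defined in the context.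
   Context: Existence: the random variable $\mathbf{X}_{a,b,c,d}$ is said to exist if there is a non-negative function $g$ on $(0,\infty)$ (its density) such that $\int_0^\infty x^s g(x)\,dx = \frac{\Gamma(c)}{\Gamma(a)\Gamma(b)}\frac{\Gamma(a+s)\Gamma(b-s)}{\Gamma(c+ds)}$ for all $-a<s<b$ (with the convention $1/\Gamma=0$ at the poles of $\Gamma$). Two-parametric Mittag-Leffler function: for $\rho,\mu>0$ and $z\in\mathbb{C}$, $E_{\rho,\mu}(z)=\sum_{n\geq 0}\frac{z^n}{\Gamma(\mu+\rho n)}$. The function $f$: it is a known fact (Popov and Sedletskii) that there is an increasing function $f:[1,2]\to\mathbb{R}$ with $f(1)=1$, $f(2)=3$, such that the set $\mathcal{D}=\{(\rho,\mu): \rho,\mu>0,\ E_{\rho,\mu}(-t)\geq 0 \text{ for all } t>0\}$ equals $\{0<\rho\leq 1,\ \mu\geq\rho\}\cup\{1<\rho\leq 2,\ \mu\geq f(\rho)\}$. Thus, for $1<\rho\leq 2$ and $\mu>0$, one has $E_{\rho,\mu}(-t)\ge 0$ for all $t>0$ if and only if $\mu\geq f(\rho)$, which determines $f$ on $(1,2]$. It is also known that $\rho<L(\rho)<f(\rho)<U(\rho)<3\rho/2$ for $1<\rho<2$, where $L(\rho)=\rho+\exp(-\pi\cot(\pi(1-1/\rho)))$ for $1<\rho<3/2$, $L(\rho)=3(\rho-1)+0.7(2-\rho)^2$ for $3/2\leq\rho<2$, $U(\rho)=4\rho/3$ for $1<\rho<3/2$, and $U(\rho)=2\rho-1$ for $3/2\leq\rho<2$.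 *)

theory Defs
  imports "HOL-Analysis.Analysis"
begin

text \<open>
  The moments of \<open>X\<^sub>a\<^sub>,\<^sub>b\<^sub>,\<^sub>c\<^sub>,\<^sub>d\<close>.  The argument \<open>c + d * s\<close> may be a pole of the Gamma
  function; \<open>rGamma\<close> is the entire function \<open>1 / Gamma\<close>, which is \<open>0\<close> there.
\<close>

definition X_moment :: "real \<Rightarrow> real \<Rightarrow> real \<Rightarrow> real \<Rightarrow> real \<Rightarrow> real" where
  "X_moment a b c d s =
     Gamma c / (Gamma a * Gamma b) * (Gamma (a + s) * Gamma (b - s) * rGamma (c + d * s))"

text \<open>
  Integrability is required separately because the Lebesgue integral of a non-integrable
  function is \<open>0\<close> by convention.  The case \<open>s = 0\<close> makes \<open>g\<close> measurable on \<open>(0, \<infinity>)\<close> with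
  total mass \<open>1\<close>, so \<open>g\<close> is a probability density there; its values on \<open>(-\<infinity>, 0]\<close> play no role.
\<close>

definition X_exists :: "real \<Rightarrow> real \<Rightarrow> real \<Rightarrow> real \<Rightarrow> bool" where
  "X_exists a b c d \<longleftrightarrow>
     (\<exists>g :: real \<Rightarrow> real.
        (\<forall>x>0. g x \<ge> 0) \<and>
        (\<forall>s. - a < s \<and> s < b \<longrightarrow>
           set_integrable lborel {0<..} (\<lambda>x. x powr s * g x) \<and>
           (LBINT x:{0<..}. x powr s * g x) = X_moment a b c d s))"

definition mittag_leffler :: "real \<Rightarrow> real \<Rightarrow> 'a :: {real_normed_field, banach} \<Rightarrow> 'a" where
  "mittag_leffler \<rho> \<mu> z = (\<Sum>n. z ^ n / of_real (Gamma (\<mu> + \<rho> * real n)))"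

definition nonneg_set_mittag_leffler :: "(real \<times> real) set" where
  "nonneg_set_mittag_leffler =
     {(\<rho>, \<mu>). \<rho> > 0 \<and> \<mu> > 0 \<and> (\<forall>t>0. mittag_leffler \<rho> \<mu> (- t :: real) \<ge> 0)}"

text \<open>
  By a theorem of Popov and Sedletskii there is an increasing \<open>f\<close> on \<open>[1, 2]\<close> with \<open>f 1 = 1\<close> and
  \<open>f 2 = 3\<close> such that the set above is
  \<open>{0 < \<rho> \<le> 1, \<mu> \<ge> \<rho>} \<union> {1 < \<rho> \<le> 2, \<mu> \<ge> f \<rho>}\<close>.
  Only the part that determines \<open>f\<close> on \<open>(1, 2]\<close> is taken as its defining property; the rest
  is a consequence of that theorem and not assumed.
\<close>

definition threshold_mittag_leffler :: "(real \<Rightarrow> real) \<Rightarrow> bool" where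
  "threshold_mittag_leffler f \<longleftrightarrow>
     (\<forall>\<rho> \<mu>. 1 < \<rho> \<and> \<rho> \<le> 2 \<and> 0 < \<mu> \<longrightarrow> ((\<rho>, \<mu>) \<in> nonneg_set_mittag_leffler \<longleftrightarrow> f \<rho> \<le> \<mu>))"

end

theory Submission
  imports Defs "HOL-Probability.Probability" "HOL-Complex_Analysis.Complex_Analysis"
begin

text \<open>
  Put \<open>\<gamma> = a + b\<close>, \<open>\<lambda> = c - a d\<close>, \<open>\<mu> = \<lambda> + d \<gamma>\<close> and \<open>H z = z\<^bsup>-\<lambda>\<^esup> (1 + z\<^sup>d)\<^bsup>-\<gamma>\<^esup>\<close>
  (\<open>prabhakar_transform\<close>).  The whole argument replaces the random variable \<open>X\<close> by the function
  \<open>H\<close>.  If \<open>G\<close> is Gamma distributed with parameter \<open>c\<close> and independent of \<open>X\<close>, then the denominator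
  \<open>\<Gamma>(c + d s)\<close> cancels in the moments of \<open>X G\<^sup>d\<close>, which becomes a quotient of two independent Gamma
  variables.  In terms of densities this says that \<open>H\<close> is, up to a constant, the Laplace transform of
  the law of \<open>X\<^bsup>-1/d\<^esup>\<close> weighted by a power.  Expanding \<open>H\<close> in powers of \<open>z\<^bsup>-d\<^esup>\<close> and inverting term by term
  gives the kernel \<open>t\<^bsup>\<mu>-1\<^esup> E(-t\<^sup>d)\<close>, where \<open>E\<close> is the three-parameter Mittag-Leffler (Prabhakar)
  function with coefficients \<open>(\<gamma>)\<^sub>n / (n! \<Gamma>(\<mu> + d n))\<close>.  So existence of \<open>X\<close> becomes nonnegativity of
  an explicit function that depends on \<open>\<lambda>\<close>, \<open>\<gamma>\<close> and \<open>d\<close> only.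

  Three theorems connect these points of view.
  \<open>laplace_represents_of_X_exists\<close> derives the Laplace representation of \<open>H\<close> from \<open>X\<close>: the two sides
  have the same Mellin transform on an interval, and such a transform determines its function.
  \<open>prabhakar_kernel_nonneg_of_represents\<close> derives nonnegativity of the kernel from a representation of
  \<open>H\<close>: as in the Post-Widder formula, the kernel is a limit of rescaled Taylor coefficients of
  \<open>w \<mapsto> H (K (1 - w))\<close>, which are nonnegative for the Laplace transform of a measure.
  \<open>X_exists_of_prabhakar_kernel_nonneg\<close> returns to \<open>X\<close> for \<open>d \<le> 2\<close> and \<open>\<lambda> \<ge> 0\<close>: a Laplace transform of a
  nonnegative function converges up to the first singularity of its analytic continuation on the
  real axis, so it equals \<open>H\<close> on all of \<open>(0, \<infinity>)\<close>, and the moments of \<open>X\<close> are read off from the Mellin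
  transform of \<open>H\<close>.

  Nonexistence.  If \<open>c < a d\<close>, some moment is negative.  If \<open>d \<ge> 2\<close>, then \<open>H\<close> continues analytically to
  the points \<open>e\<^bsup>i\<theta>\<^esup>\<close> with \<open>\<theta> < \<pi> / d\<close> and has a singularity at \<open>\<theta> = \<pi> / d\<close>, whereas the Laplace transform of
  a measure is bounded by its value at the real part.  For \<open>d > 2\<close> this is a contradiction at once;
  for \<open>d = 2\<close> comparing the orders of growth at \<open>\<plusminus>\<i>\<close> and at \<open>0\<close> gives \<open>\<gamma> \<le> \<lambda>\<close>.  If \<open>a + b \<ge> 1\<close>, nonnegativity
  descends from the index \<open>\<gamma>\<close> to the index \<open>1\<close>, where the kernel is built from the two-parametric
  Mittag-Leffler function.

  Existence.  For \<open>d \<le> 1\<close> the Taylor coefficients in question are visibly nonnegative, because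
  \<open>1 - (1 - w)\<^sup>d\<close> has nonnegative coefficients.  For \<open>a + b \<le> 1\<close> nonnegativity descends from the index
  \<open>1\<close>.  In the last case the order \<open>2\<close> is treated first (\<open>prabhakar_2_nonneg\<close>): the kernel is then a
  hypergeometric function \<open>\<^sub>1F\<^sub>2\<close>, and an expansion in the style of Gasper writes it as a combination of
  squares of Bessel functions.  The Bessel parameter is chosen such that the coefficients are
  balanced \<open>\<^sub>4F\<^sub>3\<close> sums, and the Whipple transformation shows that they are nonnegative in the
  stated region.  The orders \<open>1 < d \<le> 2\<close> follow by the substitution \<open>z \<mapsto> z\<^bsup>d/2\<^esup>\<close>
  (\<open>laplace_represents_subordinate\<close>).
\<close>

section \<open>Absolutely convergent double series\<close>

lemma abs_summable_double_series:
  fixes D :: "nat \<Rightarrow> nat \<Rightarrow> real"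
  assumes row: "\<And>n. summable (\<lambda>k. \<bar>D n k\<bar>)" and tot: "summable (\<lambda>n. \<Sum>k. \<bar>D n k\<bar>)"
  shows abs_summable_double_series_column: "summable (\<lambda>n. \<bar>D n k\<bar>)"
    and abs_summable_double_series_swap: "(\<lambda>k. \<Sum>n. D n k) sums (\<Sum>n. \<Sum>k. D n k)"
    and abs_summable_double_series_diagonal: "(\<lambda>N. \<Sum>n\<le>N. D n (N - n)) sums (\<Sum>n. \<Sum>k. D n k)"
proof -
  have col: "summable (\<lambda>n. \<bar>D n k\<bar>)" for k
  proof (rule summable_comparison_test'[OF tot, of 0])
    fix n
    have "(\<Sum>i\<in>{k}. \<bar>D n i\<bar>) \<le> (\<Sum>k. \<bar>D n k\<bar>)"
      by (rule sum_le_suminf[OF row]) auto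
    then show "norm \<bar>D n k\<bar> \<le> (\<Sum>k. \<bar>D n k\<bar>)" by simp
  qed
  then show "summable (\<lambda>n. \<bar>D n k\<bar>)" .
  have hrow: "(D n has_sum (\<Sum>k. D n k)) UNIV" for n
    using norm_summable_imp_has_sum[OF _ summable_sums[OF summable_rabs_cancel[OF row]], of n] row[of n] by simp
  have hcol: "((\<lambda>n. D n k) has_sum (\<Sum>n. D n k)) UNIV" for k
    using norm_summable_imp_has_sum[OF _ summable_sums[OF summable_rabs_cancel[OF col]], of k] col[of k] by simp
  have "(\<lambda>p. norm (case_prod D p)) summable_on Sigma UNIV (\<lambda>_. UNIV)"
    unfolding Infinite_Sum.abs_summable_on_Sigma_iff
  proof (intro conjI ballI)
    fix n
    show "(\<lambda>k. norm (case_prod D (n, k))) summable_on UNIV"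
      using row[of n] by (simp add: summable_on_UNIV_nonneg_real_iff)
  next
    have "infsum (\<lambda>k. norm (case_prod D (n, k))) UNIV = (\<Sum>k. \<bar>D n k\<bar>)" for n
      using sums_nonneg_imp_has_sum[OF summable_sums[OF row[of n]]] by (simp add: infsumI)
    moreover have "(\<Sum>k. \<bar>D n k\<bar>) \<ge> 0" for n using row[of n] by (intro suminf_nonneg) auto
    ultimately show "(\<lambda>n. norm (infsum (\<lambda>k. norm (case_prod D (n, k))) UNIV)) summable_on UNIV"
      using tot by (simp add: summable_on_UNIV_nonneg_real_iff)
  qed
  then have "(\<lambda>p. case_prod D p) summable_on (UNIV \<times> UNIV)" by (rule Infinite_Sum.abs_summable_summable)
  then obtain S where S: "(case_prod D has_sum S) (UNIV \<times> UNIV)" by (auto simp: summable_on_def)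
  have "((\<lambda>n. \<Sum>k. D n k) has_sum S) UNIV"
    by (rule has_sum_SigmaD[OF S]) (use hrow in simp)
  then have "(\<lambda>n. \<Sum>k. D n k) sums S" by (rule has_sum_imp_sums)
  then have SS: "S = (\<Sum>n. \<Sum>k. D n k)" by (simp add: sums_iff)
  have "((\<lambda>(k, n). D n k) has_sum S) (UNIV \<times> UNIV)"
    using S by (subst has_sum_swap) simp
  then have "((\<lambda>k. \<Sum>n. D n k) has_sum S) UNIV"
    by (rule has_sum_SigmaD) (use hcol in simp)
  then show "(\<lambda>k. \<Sum>n. D n k) sums (\<Sum>n. \<Sum>k. D n k)"
    unfolding SS by (rule has_sum_imp_sums)
  have "((\<lambda>(N, n). D n (N - n)) has_sum S) (Sigma UNIV (\<lambda>N. {..N})) = (case_prod D has_sum S) (UNIV \<times> UNIV)"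
    by (rule has_sum_reindex_bij_witness[of _ "\<lambda>(n, k). (n + k, n)" "\<lambda>(N, n). (n, N - n)"]) auto
  with S have "((\<lambda>(N, n). D n (N - n)) has_sum S) (Sigma UNIV (\<lambda>N. {..N}))" by simp
  then have "((\<lambda>N. \<Sum>n\<le>N. D n (N - n)) has_sum S) UNIV"
    by (rule has_sum_SigmaD) (auto intro: has_sum_finiteI)
  then show "(\<lambda>N. \<Sum>n\<le>N. D n (N - n)) sums (\<Sum>n. \<Sum>k. D n k)"
    unfolding SS by (rule has_sum_imp_sums)
qed

section \<open>The Prabhakar function and its kernel\<close>

text \<open>
  The three-parameter Mittag-Leffler (Prabhakar) function at \<open>-t\<close>.  The entire function \<open>rGamma\<close> avoids
  division by \<open>Gamma\<close> at poles.
\<close>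

definition prabhakar :: "real \<Rightarrow> real \<Rightarrow> real \<Rightarrow> real \<Rightarrow> real" where
  "prabhakar g r \<mu> t = (\<Sum>n. (- 1) ^ n * (pochhammer g n / fact n) * rGamma (\<mu> + r * real n) * t ^ n)"

lemma add_one_power_divide_ge:
  fixes x n :: real
  assumes "x \<ge> 0" "n > 0"
  shows "1 + x / (n + 1) \<le> ((n + 1) / n) powr x"
proof -
  have "ln (n / (n + 1)) \<le> n / (n + 1) - 1" using assms by (intro ln_le_minus_one) auto
  also have "\<dots> = - (1 / (n + 1))" using assms by (simp add: field_simps)
  finally have "1 / (n + 1) \<le> ln ((n + 1) / n)" using assms by (simp add: ln_div)
  then have "x * (1 / (n + 1)) \<le> x * ln ((n + 1) / n)" using assms by (intro mult_left_mono) auto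
  moreover have "1 + x * ln ((n + 1) / n) \<le> exp (x * ln ((n + 1) / n))" by (rule exp_ge_add_one_self)
  moreover have "exp (x * ln ((n + 1) / n)) = ((n + 1) / n) powr x" using assms by (simp add: powr_def)
  ultimately show ?thesis by simp
qed

text \<open>
  Passing from \<open>n\<close> to \<open>n + 1\<close> multiplies the left-hand side by \<open>(1 + x / (n + 1)) (1 + 1 / n)\<^bsup>-x\<^esup> \<le> 1\<close>.
  Hence its value at any fixed \<open>j\<close> bounds it for all larger \<open>n\<close>, uniformly in \<open>n\<close>.
\<close>

lemma pochhammer_quotient_decreasing:
  fixes x :: real
  assumes x: "x \<ge> 0" and j: "1 \<le> j" "j \<le> n"
  shows "real n powr (- x) * (pochhammer (x + 1) n / fact n) \<le> real j powr (- x) * (x + 1) ^ j"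
  using j(2)
proof (induction n rule: dec_induct)
  case base
  have "pochhammer (x + 1) i / fact i \<le> (x + 1) ^ i" for i
  proof (induction i)
    case (Suc i)
    have "(x + 1 + real i) / real (Suc i) \<le> x + 1" using x by (simp add: field_simps)
    then have "(pochhammer (x + 1) i / fact i) * ((x + 1 + real i) / real (Suc i)) \<le> (x + 1) ^ i * (x + 1)"
      using Suc x by (intro mult_mono) auto
    then show ?case by (simp add: pochhammer_Suc mult_ac)
  qed simp
  then show ?case by (intro mult_left_mono) auto
next
  case (step n)
  have n: "real n > 0" using j step by simp
  have P: "pochhammer (x + 1) n \<ge> 0" using x by (intro pochhammer_nonneg) auto
  have "real (Suc n) powr (- x) * (pochhammer (x + 1) (Suc n) / fact (Suc n))
     = real n powr (- x) * (pochhammer (x + 1) n / fact n) * ((1 + x / (real n + 1)) * ((real n + 1) / real n) powr (- x))"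
  proof -
    have "real (Suc n) powr (- x) = real n powr (- x) * ((real n + 1) / real n) powr (- x)"
      using n by (subst powr_mult[symmetric]) (auto simp: add.commute)
    moreover have "(x + 1 + real n) / real (Suc n) = 1 + x / (real n + 1)" by (simp add: field_simps)
    then have "pochhammer (x + 1) (Suc n) / fact (Suc n) = pochhammer (x + 1) n / fact n * (1 + x / (real n + 1))"
      by (metis (no_types, lifting) fact_Suc pochhammer_Suc times_divide_times_eq mult.commute)
    ultimately show ?thesis by (simp add: mult_ac)
  qed
  also have "\<dots> \<le> real n powr (- x) * (pochhammer (x + 1) n / fact n) * 1"
  proof (intro mult_left_mono)
    have "1 + x / (real n + 1) \<le> ((real n + 1) / real n) powr x" by (rule add_one_power_divide_ge[OF x n])
    moreover have "((real n + 1) / real n) powr x > 0" using n by simp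
    ultimately show "(1 + x / (real n + 1)) * ((real n + 1) / real n) powr (- x) \<le> 1"
      by (simp only: powr_minus divide_inverse[symmetric] pos_divide_le_eq mult_1)
  qed (use P in auto)
  also have "\<dots> \<le> real j powr (- x) * (x + 1) ^ j" using step.IH by simp
  finally show ?case .
qed

lemma pochhammer_quotient_le:
  fixes x :: real
  assumes x: "x > 0" and j: "1 \<le> j" "j \<le> n"
  shows "real n powr (1 - x) * (pochhammer x n / fact n) \<le> x * (real j powr (- x) * (x + 1) ^ j)"
proof -
  have n: "real n > 0" using j by simp
  have P: "pochhammer (x + 1) n > 0" using x by (intro pochhammer_pos) auto
  have "pochhammer x n * (x + real n) = x * pochhammer (x + 1) n"
    using pochhammer_Suc[of x n] pochhammer_rec[of x n] by simp
  then have "pochhammer x n = x * pochhammer (x + 1) n / (x + real n)" using x n by (simp add: field_simps)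
  then have "real n powr (1 - x) * (pochhammer x n / fact n)
      = x * (real n powr (- x) * (pochhammer (x + 1) n / fact n)) * (real n / (x + real n))"
    using n by (simp add: powr_diff powr_minus field_simps)
  also have "\<dots> \<le> x * (real n powr (- x) * (pochhammer (x + 1) n / fact n)) * 1"
    using x n P by (intro mult_left_mono mult_nonneg_nonneg) auto
  also have "\<dots> \<le> x * (real j powr (- x) * (x + 1) ^ j)"
    using pochhammer_quotient_decreasing[of x j n] x j by (simp only: mult_1_right) (intro mult_left_mono, auto)
  finally show ?thesis .
qed

lemma pochhammer_quotient_tendsto_rGamma:
  fixes x :: real
  assumes x: "x > 0"
  shows "(\<lambda>n. real n powr (1 - x) * (pochhammer x n / fact n)) \<longlonglongrightarrow> rGamma x"
proof -
  have "(\<lambda>n. rGamma_series x n * (real n / (x + real n))) \<longlonglongrightarrow> rGamma x * 1"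
  proof (intro tendsto_mult rGamma_series_LIMSEQ)
    show "(\<lambda>n. real n / (x + real n)) \<longlonglongrightarrow> 1" by real_asymp
  qed
  moreover have "eventually (\<lambda>n. rGamma_series x n * (real n / (x + real n)) = real n powr (1 - x) * (pochhammer x n / fact n)) sequentially"
    using eventually_gt_at_top[of 0]
  proof eventually_elim
    case (elim n)
    have "exp (x * ln (real n)) = real n powr x" using elim by (simp add: powr_def)
    then have 1: "rGamma_series x n = pochhammer x n * (x + real n) / (fact n * real n powr x)"
      by (simp add: rGamma_series_def pochhammer_Suc)
    have 2: "real n powr (1 - x) = real n / real n powr x" using elim by (simp add: powr_diff)
    have "x + real n \<noteq> 0" using x by (metis add_pos_nonneg less_irrefl of_nat_0_le_iff)
    moreover have "P * y / (F * R) * (N / y) = N / R * (P / F)" if "y \<noteq> 0" for P y F R N :: real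
      using that by (simp add: mult_ac)
    ultimately show ?case unfolding 1 2 by metis
  qed
  ultimately show ?thesis by (simp only: mult_1_right) (rule Lim_transform_eventually)
qed

lemma pochhammer_div_fact_le:
  fixes g :: real
  assumes "g > 0"
  shows "pochhammer g k / fact k \<le> (1 + g) ^ k" "0 \<le> pochhammer g k / fact k"
proof -
  show "0 \<le> pochhammer g k / fact k" using assms by (simp add: pochhammer_nonneg)
  show "pochhammer g k / fact k \<le> (1 + g) ^ k"
  proof (induction k)
    case (Suc k)
    have "(g + real k) / real (Suc k) \<le> 1 + g" using assms by (simp add: field_simps)
    then have "(pochhammer g k / fact k) * ((g + real k) / real (Suc k)) \<le> (1 + g) ^ k * (1 + g)"
      using Suc assms by (intro mult_mono) auto
    then show ?case by (simp add: pochhammer_Suc mult_ac)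
  qed simp
qed

text \<open>
  The dominating series for Tannery's theorem.  The bound at a fixed \<open>j\<close> is of the order of
  \<open>(1 + g)\<^sup>k (e t / j)\<^bsup>d k\<^esup>\<close>, so it decays geometrically in \<open>k\<close> once \<open>j\<close> is large.
\<close>

lemma prabhakar_domination:
  fixes g d \<mu> t :: real
  assumes g: "g > 0" and d: "d > 0" and mu: "\<mu> > 0" and t: "t > 0"
  obtains j :: nat and C :: real where "j \<ge> 1"
    "\<And>n k. j \<le> n \<Longrightarrow> (pochhammer g k / fact k) * t powr (\<mu> + d * real k - 1)
       * (real n powr (1 - (\<mu> + d * real k)) * (pochhammer (\<mu> + d * real k) n / fact n)) \<le> C * (1 / 2) ^ k"
proof -
  have "((\<lambda>j::nat. (1 + g) * (exp 1 * t / real j) powr d) \<longlongrightarrow> 0) at_top"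
    using g d t by real_asymp
  then have "eventually (\<lambda>j::nat. (1 + g) * (exp 1 * t / real j) powr d < 1 / 2) at_top"
    by (rule order_tendstoD) simp
  then have "eventually (\<lambda>j::nat. (1 + g) * (exp 1 * t / real j) powr d < 1 / 2 \<and> j \<ge> 1) at_top"
    using eventually_ge_at_top[of 1] by eventually_elim auto
  then obtain j :: nat where j: "(1 + g) * (exp 1 * t / real j) powr d < 1 / 2" "j \<ge> 1"
    by (metis (mono_tags, lifting) eventually_happens trivial_limit_sequentially)
  \<comment> \<open>With \<open>x = \<mu> + d k\<close>, the polynomial \<open>x (x + 1)\<^sup>j\<close> is bounded by \<open>(j + 1)! exp (x + 1)\<close>; the factors
    that do not depend on \<open>k\<close> are collected in \<open>C\<close>.\<close>
  define C where "C = fact (Suc j) * exp 1 * exp \<mu> * t powr (\<mu> - 1) * real j powr (- \<mu>)"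
  show thesis
  proof (rule that[OF j(2)])
    fix n k :: nat assume n: "j \<le> n"
    define x where "x = \<mu> + d * real k"
    have x: "x > 0" using mu d by (simp add: x_def add_pos_nonneg)
    have xj: "x * (x + 1) ^ j \<le> fact (Suc j) * exp (x + 1)"
    proof -
      have "x * (x + 1) ^ j \<le> (x + 1) ^ Suc j" using x by (simp add: mult_right_mono)
      also have "\<dots> \<le> fact (Suc j) * exp (x + 1)"
      proof -
        have "(x + 1) ^ Suc j / fact (Suc j) = (\<Sum>i\<in>{Suc j}. (x + 1) ^ i /\<^sub>R fact i)"
          by (simp add: field_simps)
        also have "\<dots> \<le> (\<Sum>i. (x + 1) ^ i /\<^sub>R fact i)"
          using x by (intro sum_le_suminf summable_exp_generic) auto
        also have "\<dots> = exp (x + 1)" by (simp add: exp_def)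
        finally have "(x + 1) ^ Suc j / fact (Suc j) \<le> exp (x + 1)" .
        then show ?thesis by (simp only: pos_divide_le_eq fact_gt_zero mult.commute)
      qed
      finally show ?thesis .
    qed
    have "(pochhammer g k / fact k) * t powr (x - 1) * (real n powr (1 - x) * (pochhammer x n / fact n))
       \<le> (1 + g) ^ k * t powr (x - 1) * (x * (real j powr (- x) * (x + 1) ^ j))"
      using pochhammer_div_fact_le[OF g, of k] pochhammer_quotient_le[OF x j(2) n] x g
      by (intro mult_mono[OF mult_mono[OF _ order_refl]])
         (auto intro!: mult_nonneg_nonneg divide_nonneg_nonneg pochhammer_nonneg simp del: times_divide_eq_right)
    also have "\<dots> = (1 + g) ^ k * t powr (x - 1) * real j powr (- x) * (x * (x + 1) ^ j)" by (simp add: mult_ac)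
    also have "\<dots> \<le> (1 + g) ^ k * t powr (x - 1) * real j powr (- x) * (fact (Suc j) * exp (x + 1))"
      using xj g by (intro mult_left_mono mult_nonneg_nonneg) auto
    also have "\<dots> = C * ((1 + g) * (exp 1 * t / real j) powr d) ^ k"
    proof -
      have e1: "t powr (x - 1) = t powr (\<mu> - 1) * (t powr d) ^ k"
        using t by (simp add: x_def powr_add[symmetric] powr_powr powr_realpow[symmetric] algebra_simps)
      have e2: "real j powr (- x) = real j powr (- \<mu>) * ((1 / real j) powr d) ^ k"
        using j(2) by (simp add: x_def powr_add[symmetric] powr_powr powr_realpow[symmetric] powr_divide powr_minus field_simps)
      have e3: "exp (x + 1) = exp 1 * exp \<mu> * (exp 1 powr d) ^ k"
        by (simp add: x_def powr_def exp_add exp_of_nat_mult[symmetric] mult_ac)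
      have e4: "(exp 1 * t / real j) powr d = exp 1 powr d * t powr d * (1 / real j) powr d"
        using t j(2) by (simp add: powr_mult powr_divide)
      show ?thesis unfolding e1 e2 e3 e4 C_def by (simp add: power_mult_distrib mult_ac)
    qed
    also have "\<dots> \<le> C * (1 / 2) ^ k"
      using j g t by (intro mult_left_mono power_mono) (auto simp: C_def)
    finally show "(pochhammer g k / fact k) * t powr (\<mu> + d * real k - 1)
       * (real n powr (1 - (\<mu> + d * real k)) * (pochhammer (\<mu> + d * real k) n / fact n)) \<le> C * (1 / 2) ^ k"
      by (simp add: x_def)
  qed
qed

text \<open>
  Both statements come from one application of Tannery's theorem, based on Euler's limit
  \<open>n\<^bsup>1-x\<^esup> (x)\<^sub>n / n! \<longlonglongrightarrow> 1 / \<Gamma> x\<close>.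
\<close>

lemma
  fixes g d \<mu> t :: real
  assumes g: "g > 0" and d: "d > 0" and mu: "\<mu> > 0" and t: "t > 0"
  shows abs_summable_prabhakar_powr:
      "summable (\<lambda>k. (pochhammer g k / fact k) * t powr (\<mu> + d * real k - 1) * rGamma (\<mu> + d * real k))"
    and prabhakar_limit:
      "(\<lambda>n. \<Sum>k. (-1) ^ k * (pochhammer g k / fact k) * t powr (\<mu> + d * real k - 1)
           * (real n powr (1 - (\<mu> + d * real k)) * (pochhammer (\<mu> + d * real k) n / fact n)))
         \<longlonglongrightarrow> (\<Sum>k. (-1) ^ k * (pochhammer g k / fact k) * t powr (\<mu> + d * real k - 1) * rGamma (\<mu> + d * real k))"
proof -
  define a where "a = (\<lambda>k n. (-1) ^ k * (pochhammer g k / fact k) * t powr (\<mu> + d * real k - 1)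
           * (real n powr (1 - (\<mu> + d * real k)) * (pochhammer (\<mu> + d * real k) n / fact n)))"
  define b where "b = (\<lambda>k. (-1) ^ k * (pochhammer g k / fact k) * t powr (\<mu> + d * real k - 1) * rGamma (\<mu> + d * real k))"
  have x: "\<mu> + d * real k > 0" for k using mu d by (simp add: add_pos_nonneg)
  obtain j :: nat and C :: real where j: "j \<ge> 1" and
    le: "\<And>n k. j \<le> n \<Longrightarrow> (pochhammer g k / fact k) * t powr (\<mu> + d * real k - 1)
       * (real n powr (1 - (\<mu> + d * real k)) * (pochhammer (\<mu> + d * real k) n / fact n)) \<le> C * (1 / 2) ^ k"
    using prabhakar_domination[OF g d mu t] by metis
  have "eventually (\<lambda>n. summable (\<lambda>k. norm (a k n))) sequentially \<and> summable (\<lambda>k. norm (b k)) \<and>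
     ((\<lambda>n. \<Sum>k. a k n) \<longlongrightarrow> suminf b) sequentially"
  proof (rule tannerys_theorem)
    show "(a k \<longlongrightarrow> b k) sequentially" for k
      unfolding a_def b_def by (intro tendsto_mult tendsto_const pochhammer_quotient_tendsto_rGamma x)
    show "summable (\<lambda>k. C * (1 / 2) ^ k)" by (intro summable_mult summable_geometric) simp
    have nonneg: "norm (a k n) = (pochhammer g k / fact k) * t powr (\<mu> + d * real k - 1)
       * (real n powr (1 - (\<mu> + d * real k)) * (pochhammer (\<mu> + d * real k) n / fact n))" for k n
      using g pochhammer_pos[OF g, of k] pochhammer_pos[OF x[of k], of n]
      by (simp add: a_def abs_mult)
    have "eventually (\<lambda>kn. norm (a (fst kn) (snd kn)) \<le> C * (1 / 2) ^ fst kn) (at_top \<times>\<^sub>F sequentially)"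
      using eventually_compose_filterlim[OF eventually_ge_at_top[of j] filterlim_snd]
    proof eventually_elim
      case (elim kn)
      then show ?case unfolding nonneg by (rule le)
    qed
    then show "eventually (\<lambda>(k, n). norm (a k n) \<le> C * (1 / 2) ^ k) (at_top \<times>\<^sub>F sequentially)"
      unfolding case_prod_unfold .
  qed simp
  moreover have "norm (b k) = (pochhammer g k / fact k) * t powr (\<mu> + d * real k - 1) * rGamma (\<mu> + d * real k)" for k
    using pochhammer_pos[OF g, of k] Gamma_real_pos[OF x[of k]]
    by (simp add: b_def abs_mult rGamma_inverse_Gamma)
  ultimately show "summable (\<lambda>k. (pochhammer g k / fact k) * t powr (\<mu> + d * real k - 1) * rGamma (\<mu> + d * real k))"
    and "(\<lambda>n. \<Sum>k. (-1) ^ k * (pochhammer g k / fact k) * t powr (\<mu> + d * real k - 1)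
           * (real n powr (1 - (\<mu> + d * real k)) * (pochhammer (\<mu> + d * real k) n / fact n)))
         \<longlonglongrightarrow> (\<Sum>k. (-1) ^ k * (pochhammer g k / fact k) * t powr (\<mu> + d * real k - 1) * rGamma (\<mu> + d * real k))"
    by (simp_all add: a_def b_def)
qed

text \<open>
  The formal inverse Laplace transform of \<open>z\<^bsup>-\<lambda>\<^esup> (1 + z\<^sup>d)\<^bsup>-g\<^esup>\<close>, where \<open>\<mu> = \<lambda> + d g\<close>.
\<close>

definition prabhakar_kernel :: "real \<Rightarrow> real \<Rightarrow> real \<Rightarrow> real \<Rightarrow> real" where
  "prabhakar_kernel g d \<mu> t = t powr (\<mu> - 1) * prabhakar g d \<mu> (t powr d)"

lemma prabhakar_kernel_eq:
  assumes g: "g > 0" and d: "d > 0" and mu: "\<mu> > 0" and t: "t > 0"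
  shows "prabhakar_kernel g d \<mu> t
     = (\<Sum>k. (-1) ^ k * (pochhammer g k / fact k) * t powr (\<mu> + d * real k - 1) * rGamma (\<mu> + d * real k))"
proof -
  have p: "t powr (\<mu> + d * real k - 1) = t powr (\<mu> - 1) * (t powr d) ^ k" for k
    using t by (simp add: powr_add[symmetric] powr_powr powr_realpow[symmetric] algebra_simps)
  have e: "(-1) ^ k * (pochhammer g k / fact k) * t powr (\<mu> + d * real k - 1) * rGamma (\<mu> + d * real k)
     = t powr (\<mu> - 1) * ((-1) ^ k * (pochhammer g k / fact k) * rGamma (\<mu> + d * real k) * (t powr d) ^ k)" for k
    unfolding p by (simp add: mult_ac)
  have "summable (\<lambda>k. (-1) ^ k * (pochhammer g k / fact k) * t powr (\<mu> + d * real k - 1) * rGamma (\<mu> + d * real k))"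
  proof (rule summable_comparison_test'[OF abs_summable_prabhakar_powr[OF assms], of 0])
    fix k
    have "\<mu> + d * real k > 0" using mu d by (simp add: add_pos_nonneg)
    then show "norm ((-1) ^ k * (pochhammer g k / fact k) * t powr (\<mu> + d * real k - 1) * rGamma (\<mu> + d * real k))
       \<le> (pochhammer g k / fact k) * t powr (\<mu> + d * real k - 1) * rGamma (\<mu> + d * real k)"
      using pochhammer_pos[OF g, of k] Gamma_real_pos[of "\<mu> + d * real k"]
      by (simp add: abs_mult rGamma_inverse_Gamma)
  qed
  then have "summable (\<lambda>k. t powr (\<mu> - 1) * ((-1) ^ k * (pochhammer g k / fact k) * rGamma (\<mu> + d * real k) * (t powr d) ^ k))"
    unfolding e .
  then have "summable (\<lambda>k. (-1) ^ k * (pochhammer g k / fact k) * rGamma (\<mu> + d * real k) * (t powr d) ^ k)"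
    using t by (subst (asm) summable_cmult_iff) auto
  then show ?thesis
    unfolding e prabhakar_kernel_def prabhakar_def by (subst suminf_mult) auto
qed

lemma prabhakar_kernel_nonneg_iff:
  assumes "d > 0"
  shows "(\<forall>t>0. prabhakar_kernel g d \<mu> t \<ge> 0) \<longleftrightarrow> (\<forall>t>0. prabhakar g d \<mu> t \<ge> 0)"
proof (intro iffI allI impI)
  fix t :: real assume *: "\<forall>t>0. prabhakar_kernel g d \<mu> t \<ge> 0" "t > 0"
  then have "prabhakar_kernel g d \<mu> (t powr (1 / d)) \<ge> 0" by simp
  moreover have "(t powr (1 / d)) powr d = t" using assms * by (simp add: powr_powr)
  ultimately show "prabhakar g d \<mu> t \<ge> 0" using *
    by (simp add: prabhakar_kernel_def zero_le_mult_iff)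
qed (simp add: prabhakar_kernel_def)

section \<open>Power series with nonnegative coefficients\<close>

lemma binomial_series_pochhammer:
  fixes p x :: real
  assumes "\<bar>x\<bar> < 1"
  shows "(\<lambda>n. (pochhammer p n / fact n) * x ^ n) sums (1 - x) powr (- p)"
proof -
  have "(\<lambda>n. ((- p) gchoose n) * (- x) ^ n) sums (1 + (- x)) powr (- p)"
    using assms by (intro gen_binomial_real) simp
  moreover have "((- p) gchoose n) * (- x) ^ n = (pochhammer p n / fact n) * x ^ n" for n
  proof -
    have "((- p) gchoose n) * (- x) ^ n = ((-1) ^ n * (-1) ^ n) * ((pochhammer p n / fact n) * x ^ n)"
      unfolding gbinomial_pochhammer power_minus[of x n] by simp
    then show ?thesis by (simp only: minus_one_mult_self mult_1)
  qed
  ultimately show ?thesis by simp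
qed

text \<open>
  The discrete counterpart of complete monotonicity: \<open>f\<close> is completely monotone on \<open>(0, \<infinity>)\<close> iff
  \<open>w \<mapsto> f (K (1 - w))\<close> has this property for every \<open>K > 0\<close>.  Closure under products and
  compositions is elementary in this form.
\<close>

definition nonneg_power_series :: "(real \<Rightarrow> real) \<Rightarrow> bool" where
  "nonneg_power_series f \<longleftrightarrow> (\<exists>C. (\<forall>n. 0 \<le> C n) \<and> (\<forall>w. 0 \<le> w \<and> w < 1 \<longrightarrow> (\<lambda>n. C n * w ^ n) sums f w))"

lemma nonneg_power_series_mult:
  assumes "nonneg_power_series f" "nonneg_power_series g"
  shows "nonneg_power_series (\<lambda>w. f w * g w)"
proof -
  obtain A B where A: "\<And>n. 0 \<le> A n" "\<And>w. 0 \<le> w \<Longrightarrow> w < 1 \<Longrightarrow> (\<lambda>n. A n * w ^ n) sums f w"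
    and B: "\<And>n. 0 \<le> B n" "\<And>w. 0 \<le> w \<Longrightarrow> w < 1 \<Longrightarrow> (\<lambda>n. B n * w ^ n) sums g w"
    using assms unfolding nonneg_power_series_def by metis
  show ?thesis unfolding nonneg_power_series_def
  proof (intro exI[of _ "\<lambda>n. \<Sum>i\<le>n. A i * B (n - i)"] conjI allI impI)
    show "0 \<le> (\<Sum>i\<le>n. A i * B (n - i))" for n using A B by (intro sum_nonneg mult_nonneg_nonneg) auto
    fix w :: real assume w: "0 \<le> w \<and> w < 1"
    have "(\<lambda>n. \<Sum>i\<le>n. (A i * w ^ i) * (B (n - i) * w ^ (n - i))) sums ((\<Sum>n. A n * w ^ n) * (\<Sum>n. B n * w ^ n))"
    proof (rule Cauchy_product_sums)
      have "norm (A n * w ^ n) = A n * w ^ n" "norm (B n * w ^ n) = B n * w ^ n" for n using A B w by auto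
      then show "summable (\<lambda>n. norm (A n * w ^ n))" "summable (\<lambda>n. norm (B n * w ^ n))"
        using A(2)[of w] B(2)[of w] w by (auto simp: sums_iff)
    qed
    moreover have "(\<Sum>i\<le>n. (A i * w ^ i) * (B (n - i) * w ^ (n - i))) = (\<Sum>i\<le>n. A i * B (n - i)) * w ^ n" for n
      unfolding sum_distrib_right
    proof (intro sum.cong refl)
      fix i assume "i \<in> {..n}"
      then have "w ^ n = w ^ i * w ^ (n - i)" by (simp add: power_add[symmetric])
      then show "A i * w ^ i * (B (n - i) * w ^ (n - i)) = A i * B (n - i) * w ^ n" by simp
    qed
    ultimately show "(\<lambda>n. (\<Sum>i\<le>n. A i * B (n - i)) * w ^ n) sums (f w * g w)"
      using A(2)[of w] B(2)[of w] w by (simp add: sums_iff)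
  qed
qed

lemma nonneg_power_series_const:
  assumes "c \<ge> 0"
  shows "nonneg_power_series (\<lambda>w. c)"
proof -
  have "(\<lambda>n. (if n = 0 then c else 0) * w ^ n) sums c" for w :: real
  proof -
    have "(\<lambda>n. (if n = 0 then c else 0) * w ^ n) = (\<lambda>n. if n = 0 then c else 0)" by auto
    then show ?thesis using sums_single[of 0 "\<lambda>_. c"] by simp
  qed
  then show ?thesis using assms unfolding nonneg_power_series_def
    by (intro exI[of _ "\<lambda>n. if n = 0 then c else 0"]) simp
qed

lemma nonneg_power_series_power:
  "nonneg_power_series f \<Longrightarrow> nonneg_power_series (\<lambda>w. f w ^ j)"
  by (induction j) (auto intro: nonneg_power_series_const nonneg_power_series_mult)

lemma nonneg_power_series_compose:
  assumes B: "nonneg_power_series B" and c: "\<And>j. c j \<ge> 0"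
    and s: "\<And>w. 0 \<le> w \<Longrightarrow> w < 1 \<Longrightarrow> (\<lambda>j. c j * B w ^ j) sums f w"
  shows "nonneg_power_series f"
proof -
  have "\<forall>j. \<exists>C. (\<forall>n. 0 \<le> C n) \<and> (\<forall>w. 0 \<le> w \<and> w < 1 \<longrightarrow> (\<lambda>n. C n * w ^ n) sums (B w ^ j))"
    using nonneg_power_series_power[OF B] unfolding nonneg_power_series_def by (intro allI)
  from choice[OF this] obtain b where b': "\<forall>j. (\<forall>n. 0 \<le> b j n) \<and> (\<forall>w. 0 \<le> w \<and> w < 1 \<longrightarrow> (\<lambda>n. b j n * w ^ n) sums (B w ^ j))" ..
  have b: "0 \<le> b j n" "0 \<le> w \<Longrightarrow> w < 1 \<Longrightarrow> (\<lambda>n. b j n * w ^ n) sums (B w ^ j)" for j n w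
    using b' by simp_all
  have dbl: "summable (\<lambda>j. \<bar>c j * b j n * w ^ n\<bar>)"
      "(\<lambda>n. \<Sum>j. c j * b j n * w ^ n) sums f w" if w: "0 \<le> w" "w < 1" for w n
  proof -
    have nn: "c j * b j n * w ^ n \<ge> 0" for j n using c b w by simp
    have row: "(\<lambda>n. c j * b j n * w ^ n) sums (c j * B w ^ j)" for j
      using sums_mult[OF b(2)[OF w], of "c j"] by (simp add: mult_ac)
    have 1: "summable (\<lambda>n. \<bar>c j * b j n * w ^ n\<bar>)" for j
      using row[of j] nn by (simp add: sums_iff)
    have 2: "summable (\<lambda>j. \<Sum>n. \<bar>c j * b j n * w ^ n\<bar>)"
      using s[OF w] row nn by (simp add: sums_iff)
    show "summable (\<lambda>j. \<bar>c j * b j n * w ^ n\<bar>)" by (rule abs_summable_double_series_column[OF 1 2])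
    have "(\<lambda>n. \<Sum>j. c j * b j n * w ^ n) sums (\<Sum>j. \<Sum>n. c j * b j n * w ^ n)"
      by (rule abs_summable_double_series_swap[OF 1 2])
    also have "(\<Sum>j. \<Sum>n. c j * b j n * w ^ n) = f w"
      using row s[OF w] by (simp add: sums_iff)
    finally show "(\<lambda>n. \<Sum>j. c j * b j n * w ^ n) sums f w" .
  qed
  have sm: "summable (\<lambda>j. c j * b j n)" for n
  proof -
    have "summable (\<lambda>j. c j * b j n * (1 / 2) ^ n)"
      by (rule summable_rabs_cancel[OF dbl(1)]) simp_all
    then have "summable (\<lambda>j. (1 / 2) ^ n * (c j * b j n))" by (simp add: mult.commute)
    then show ?thesis by (subst (asm) summable_cmult_iff) simp
  qed
  show ?thesis unfolding nonneg_power_series_def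
  proof (intro exI[of _ "\<lambda>n. \<Sum>j. c j * b j n"] conjI allI impI)
    show "0 \<le> (\<Sum>j. c j * b j n)" for n using sm c b by (intro suminf_nonneg) auto
    fix w :: real assume w: "0 \<le> w \<and> w < 1"
    then show "(\<lambda>n. (\<Sum>j. c j * b j n) * w ^ n) sums f w"
      using dbl(2)[of w] by (simp add: suminf_mult2[OF sm])
  qed
qed

text \<open>
  Agreement on a right neighbourhood of \<open>0\<close> suffices, because the zeros of a nonzero power series
  are isolated.
\<close>

lemma power_series_unique_right:
  fixes a b :: "nat \<Rightarrow> real"
  assumes "\<delta> > 0"
    and a: "\<And>w. 0 \<le> w \<Longrightarrow> w < \<delta> \<Longrightarrow> (\<lambda>n. a n * w ^ n) sums f w"
    and b: "\<And>w. 0 \<le> w \<Longrightarrow> w < \<delta> \<Longrightarrow> (\<lambda>n. b n * w ^ n) sums f w"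
  shows "a = b"
proof (rule ccontr)
  assume "a \<noteq> b"
  then obtain m where m: "a m \<noteq> b m" by auto
  define c where "c = (\<lambda>n. a n - b n)"
  have c0: "(\<lambda>n. c n * w ^ n) sums 0" if "0 \<le> w" "w < \<delta>" for w
    using sums_diff[OF a[OF that] b[OF that]] by (simp add: c_def algebra_simps)
  define F where "F = (\<lambda>x. \<Sum>n. c n * x ^ n)"
  have F: "(\<lambda>n. c n * (x - 0) ^ n) sums F x" if "norm (x - 0) < \<delta>" for x
  proof -
    have "summable (\<lambda>n. c n * ((\<bar>x\<bar> + \<delta>) / 2) ^ n)"
      using c0[of "(\<bar>x\<bar> + \<delta>) / 2"] that \<open>\<delta> > 0\<close> by (auto simp: sums_iff)
    then have "summable (\<lambda>n. c n * x ^ n)"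
      by (rule powser_inside) (use that \<open>\<delta> > 0\<close> in \<open>auto simp: abs_if\<close>)
    then show ?thesis by (simp add: F_def summable_sums)
  qed
  have F0: "F x = 0" if "0 \<le> x" "x < \<delta>" for x using c0[OF that] by (simp add: F_def sums_iff)
  have "c m \<noteq> 0" using m by (simp add: c_def)
  moreover from this have "m > 0" using c0[of 0] \<open>\<delta> > 0\<close> by (cases m) (auto simp: powser_sums_zero_iff)
  ultimately obtain s where s: "s > 0" "\<And>z. z \<in> cball 0 s - {0} \<Longrightarrow> F z \<noteq> 0"
    using powser_0_nonzero[OF \<open>\<delta> > 0\<close> F F0[OF order_refl \<open>\<delta> > 0\<close>], of m] by auto
  have "F (min s (\<delta> / 2)) \<noteq> 0" using s \<open>\<delta> > 0\<close> by (intro s(2)) auto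
  moreover have "F (min s (\<delta> / 2)) = 0" using s \<open>\<delta> > 0\<close> by (intro F0) auto
  ultimately show False by simp
qed

section \<open>Nonnegativity of the kernel from Taylor coefficients of its transform\<close>

lemma powr_binomial_split:
  fixes y g d lam :: real
  assumes "y > 0"
  shows "y powr (- (lam + d * g)) * (1 + y powr (- d)) powr (- g) = y powr (- lam) * (1 + y powr d) powr (- g)"
proof -
  have "1 + y powr (- d) = (1 + y powr d) * y powr (- d)"
    using assms by (simp add: distrib_right powr_add[symmetric])
  then have "(1 + y powr (- d)) powr (- g) = (1 + y powr d) powr (- g) * y powr (d * g)"
    by (simp add: powr_mult powr_powr)
  then show ?thesis using assms by (simp add: powr_add[symmetric] mult.assoc)
qed

text \<open>
  The \<open>n\<close>-th Taylor coefficient of \<open>w \<mapsto> H (K (1 - w))\<close>.  For \<open>K (1 - w) > 1\<close> the function \<open>H\<close> is a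
  binomial series in \<open>(K (1 - w))\<^bsup>-d\<^esup>\<close>, and each power of \<open>1 - w\<close> is again a binomial series; the double
  series converges absolutely, so the coefficients of \<open>w\<^sup>n\<close> can be collected.
\<close>

lemma
  fixes g d lam \<mu> K :: real
  assumes g: "g > 0" and d: "d > 0" and mu: "\<mu> = lam + d * g" "\<mu> > 0" and K: "K > 1"
    and ps: "nonneg_power_series (\<lambda>w. (K * (1 - w)) powr (- lam) * (1 + (K * (1 - w)) powr d) powr (- g))"
  shows shifted_kernel_coefficients_summable:
      "summable (\<lambda>k. (-1) ^ k * (pochhammer g k / fact k) * K powr (- (\<mu> + d * real k)) * (pochhammer (\<mu> + d * real k) n / fact n))"
    and shifted_kernel_coefficients_nonneg:
      "(\<Sum>k. (-1) ^ k * (pochhammer g k / fact k) * K powr (- (\<mu> + d * real k)) * (pochhammer (\<mu> + d * real k) n / fact n)) \<ge> 0"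
proof -
  define pg where "pg = (\<lambda>k. pochhammer g k / fact k)"
  define x where "x = (\<lambda>k. \<mu> + d * real k)"
  define c where "c = (\<lambda>n k. (-1) ^ k * pg k * K powr (- x k) * (pochhammer (x k) n / fact n))"
  have x: "x k > 0" for k using mu d by (simp add: x_def add_pos_nonneg)
  have pg: "pg k > 0" for k using g by (simp add: pg_def pochhammer_pos)
  \<comment> \<open>For \<open>w < \<delta>\<close> one has \<open>K (1 - w) > 1\<close>, the range of convergence of the binomial series.\<close>
  define \<delta> where "\<delta> = 1 - 1 / K"
  have \<delta>: "0 < \<delta>" "\<delta> < 1" using K by (auto simp: \<delta>_def field_simps)
  have col: "summable (\<lambda>k. \<bar>c n k * w ^ n\<bar>)"
    and swap: "(\<lambda>n. \<Sum>k. c n k * w ^ n) sums ((K * (1 - w)) powr (- lam) * (1 + (K * (1 - w)) powr d) powr (- g))"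
    if w: "0 \<le> w" "w < \<delta>" for w n
  proof -
    define y where "y = K * (1 - w)"
    have y: "y > 1" using w K by (simp add: y_def \<delta>_def field_simps)
    have r: "\<bar>y powr (- d)\<bar> < 1" "\<bar>- (y powr (- d))\<bar> < 1" using y d by (auto simp: powr_less_one)
    have absc: "\<bar>c n k * w ^ n\<bar> = pg k * K powr (- x k) * ((pochhammer (x k) n / fact n) * w ^ n)" for n k
      using pg[of k] pochhammer_pos[OF x[of k], of n] w by (simp add: c_def abs_mult)
    have yk: "K powr (- x k) * (1 - w) powr (- x k) = y powr (- \<mu>) * (y powr (- d)) ^ k" for k
    proof -
      have "K powr (- x k) * (1 - w) powr (- x k) = y powr (- x k)" using K w \<delta> by (simp add: y_def powr_mult)
      also have "\<dots> = y powr (- \<mu>) * (y powr (- d)) ^ k"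
        using y by (simp add: x_def powr_powr powr_add[symmetric] powr_realpow[symmetric] algebra_simps)
      finally show ?thesis .
    qed
    have bin: "(\<lambda>n. (pochhammer (x k) n / fact n) * w ^ n) sums (1 - w) powr (- x k)" for k
      using w \<delta> by (intro binomial_series_pochhammer) auto
    have rowabs: "(\<lambda>n. \<bar>c n k * w ^ n\<bar>) sums (y powr (- \<mu>) * (pg k * (y powr (- d)) ^ k))" for k
      unfolding absc using sums_mult[OF bin[of k], of "pg k * K powr (- x k)"]
      by (simp only: mult.assoc yk mult.left_commute[of "pg k"])
    have row: "(\<lambda>n. c n k * w ^ n) sums (y powr (- \<mu>) * (pg k * (- (y powr (- d))) ^ k))" for k
    proof -
      have "(\<lambda>n. (-1) ^ k * \<bar>c n k * w ^ n\<bar>) sums ((-1) ^ k * (y powr (- \<mu>) * (pg k * (y powr (- d)) ^ k)))"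
        by (rule sums_mult[OF rowabs])
      moreover have "(-1) ^ k * \<bar>c n k * w ^ n\<bar> = c n k * w ^ n" for n unfolding absc by (simp add: c_def)
      moreover have "(-1) ^ k * (y powr (- \<mu>) * (pg k * (y powr (- d)) ^ k)) = y powr (- \<mu>) * (pg k * (- (y powr (- d))) ^ k)"
        by (simp add: power_minus[of "y powr (- d)"])
      ultimately show ?thesis by simp
    qed
    have 1: "summable (\<lambda>n. \<bar>c n k * w ^ n\<bar>)" for k using rowabs[of k] by (simp add: sums_iff)
    have 2: "summable (\<lambda>k. \<Sum>n. \<bar>c n k * w ^ n\<bar>)"
    proof -
      have "summable (\<lambda>k. y powr (- \<mu>) * (pg k * (y powr (- d)) ^ k))"
        unfolding pg_def by (intro summable_mult sums_summable[OF binomial_series_pochhammer[OF r(1)]])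
      moreover have "(\<Sum>n. \<bar>c n k * w ^ n\<bar>) = y powr (- \<mu>) * (pg k * (y powr (- d)) ^ k)" for k
        by (rule sums_unique[OF rowabs, symmetric])
      ultimately show ?thesis by simp
    qed
    show "summable (\<lambda>k. \<bar>c n k * w ^ n\<bar>)" by (rule abs_summable_double_series_column[OF 1 2])
    have "(\<lambda>n. \<Sum>k. c n k * w ^ n) sums (\<Sum>k. \<Sum>n. c n k * w ^ n)"
      by (rule abs_summable_double_series_swap[OF 1 2])
    moreover have "(\<Sum>k. \<Sum>n. c n k * w ^ n) = y powr (- \<mu>) * (1 - (- (y powr (- d)))) powr (- g)"
    proof -
      have "(\<Sum>n. c n k * w ^ n) = y powr (- \<mu>) * (pg k * (- (y powr (- d))) ^ k)" for k
        by (rule sums_unique[OF row, symmetric])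
      moreover have "(\<lambda>k. y powr (- \<mu>) * (pg k * (- (y powr (- d))) ^ k)) sums (y powr (- \<mu>) * (1 - (- (y powr (- d)))) powr (- g))"
        unfolding pg_def by (intro sums_mult binomial_series_pochhammer r)
      ultimately show ?thesis by (simp add: sums_iff)
    qed
    moreover have "y powr (- \<mu>) * (1 - (- (y powr (- d)))) powr (- g) = y powr (- lam) * (1 + y powr d) powr (- g)"
      using powr_binomial_split[of y lam d g] y by (simp add: mu)
    ultimately show "(\<lambda>n. \<Sum>k. c n k * w ^ n) sums ((K * (1 - w)) powr (- lam) * (1 + (K * (1 - w)) powr d) powr (- g))"
      by (simp add: y_def)
  qed
  have sc: "summable (c n)" for n
  proof -
    have "summable (\<lambda>k. c n k * (\<delta> / 2) ^ n)" by (rule summable_rabs_cancel[OF col]) (use \<delta> in auto)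
    then have "summable (\<lambda>k. (\<delta> / 2) ^ n * c n k)" by (simp only: mult.commute)
    then show ?thesis using \<delta> by (subst (asm) summable_cmult_iff) simp
  qed
  obtain C where C: "\<And>n. 0 \<le> C n"
    "\<And>w. 0 \<le> w \<and> w < 1 \<Longrightarrow> (\<lambda>n. C n * w ^ n) sums ((K * (1 - w)) powr (- lam) * (1 + (K * (1 - w)) powr d) powr (- g))"
    using ps unfolding nonneg_power_series_def by blast
  have "C = (\<lambda>n. \<Sum>k. c n k)"
  proof (rule power_series_unique_right[OF \<delta>(1)])
    fix w assume w: "0 \<le> w" "w < \<delta>"
    show "(\<lambda>n. C n * w ^ n) sums ((K * (1 - w)) powr (- lam) * (1 + (K * (1 - w)) powr d) powr (- g))"
      using w \<delta> by (intro C) auto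
    show "(\<lambda>n. (\<Sum>k. c n k) * w ^ n) sums ((K * (1 - w)) powr (- lam) * (1 + (K * (1 - w)) powr d) powr (- g))"
      using swap[OF w] unfolding suminf_mult2[OF sc] .
  qed
  then have "(\<Sum>k. c n k) \<ge> 0" using C(1)[of n] by simp
  then show "(\<Sum>k. (-1) ^ k * (pochhammer g k / fact k) * K powr (- (\<mu> + d * real k)) * (pochhammer (\<mu> + d * real k) n / fact n)) \<ge> 0"
    by (simp only: c_def pg_def x_def)
  show "summable (\<lambda>k. (-1) ^ k * (pochhammer g k / fact k) * K powr (- (\<mu> + d * real k)) * (pochhammer (\<mu> + d * real k) n / fact n))"
    using sc[of n] by (simp only: c_def pg_def x_def)
qed

text \<open>
  Post-Widder inversion: with \<open>K = n / t\<close>, the coefficient of \<open>w\<^sup>n\<close> in \<open>H (K (1 - w))\<close>, multiplied by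
  \<open>K\<close>, tends to the value of the kernel at \<open>t\<close>.
\<close>

theorem prabhakar_kernel_nonnegI:
  fixes g d lam \<mu> t :: real
  assumes g: "g > 0" and d: "d > 0" and mu: "\<mu> = lam + d * g" "\<mu> > 0" and t: "t > 0"
    and ps: "\<And>K. K > 1 \<Longrightarrow> nonneg_power_series (\<lambda>w. (K * (1 - w)) powr (- lam) * (1 + (K * (1 - w)) powr d) powr (- g))"
  shows "prabhakar_kernel g d \<mu> t \<ge> 0"
  unfolding prabhakar_kernel_eq[OF g d mu(2) t]
proof (rule tendsto_lowerbound[OF prabhakar_limit[OF g d mu(2) t]])
  have "eventually (\<lambda>n. real n > t) sequentially" by real_asymp
  then show "eventually (\<lambda>n. 0 \<le> (\<Sum>k. (-1) ^ k * (pochhammer g k / fact k) * t powr (\<mu> + d * real k - 1)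
           * (real n powr (1 - (\<mu> + d * real k)) * (pochhammer (\<mu> + d * real k) n / fact n)))) sequentially"
  proof eventually_elim
    case (elim n)
    \<comment> \<open>The condition \<open>K > 1\<close> holds as soon as \<open>n > t\<close>.\<close>
    define K where "K = real n / t"
    have K: "K > 1" using elim t by (simp add: K_def)
    have n: "real n > 0" using elim t by linarith
    define c where "c = (\<lambda>k. (-1) ^ k * (pochhammer g k / fact k) * K powr (- (\<mu> + d * real k)) * (pochhammer (\<mu> + d * real k) n / fact n))"
    have e: "(-1) ^ k * (pochhammer g k / fact k) * t powr (\<mu> + d * real k - 1)
           * (real n powr (1 - (\<mu> + d * real k)) * (pochhammer (\<mu> + d * real k) n / fact n)) = K * c k" for k
    proof -
      define x where "x = \<mu> + d * real k"
      have "t powr (x - 1) * real n powr (1 - x) = (real n / t) powr (1 - x)"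
        using t n by (simp add: powr_divide powr_diff field_simps)
      also have "\<dots> = K * K powr (- x)"
        using K t by (simp add: K_def powr_diff powr_minus field_simps)
      finally have "t powr (x - 1) * real n powr (1 - x) = K * K powr (- x)" .
      then have "(-1) ^ k * (pochhammer g k / fact k) * (t powr (x - 1) * real n powr (1 - x)) * (pochhammer x n / fact n)
         = (-1) ^ k * (pochhammer g k / fact k) * (K * K powr (- x)) * (pochhammer x n / fact n)"
        by (simp only:)
      then show ?thesis unfolding c_def x_def[symmetric] by (simp only: mult_ac)
    qed
    have c0: "suminf c \<ge> 0"
      unfolding c_def by (rule shifted_kernel_coefficients_nonneg[OF g d mu K ps[OF K]])
    have "summable c"
      unfolding c_def by (rule shifted_kernel_coefficients_summable[OF g d mu K ps[OF K]])
    then have "(\<Sum>k. K * c k) \<ge> 0" using c0 K by (simp add: suminf_mult)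
    then show ?case unfolding e .
  qed
qed simp

lemma nonneg_power_series_one_minus_powr:
  fixes r :: real
  assumes "0 < r" "r \<le> 1"
  shows "nonneg_power_series (\<lambda>w. 1 - (1 - w) powr r)"
  unfolding nonneg_power_series_def
proof (intro exI[of _ "\<lambda>n. (if n = 0 then 1 else 0) - pochhammer (- r) n / fact n"] conjI allI impI)
  fix n
  show "0 \<le> (if n = 0 then 1 else 0) - pochhammer (- r) n / fact n"
  proof (cases n)
    case (Suc l)
    have "pochhammer (1 - r) l \<ge> 0" using assms
      by (induction l) (auto simp: pochhammer_Suc)
    then show ?thesis using assms by (simp add: Suc pochhammer_rec divide_nonpos_pos mult_nonpos_nonneg)
  qed simp
next
  fix w :: real assume w: "0 \<le> w \<and> w < 1"
  have "(\<lambda>n. (if n = 0 then 1 else 0) * w ^ n - (pochhammer (- r) n / fact n) * w ^ n) sums (1 - (1 - w) powr (- (- r)))"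
  proof (intro sums_diff binomial_series_pochhammer)
    have "(\<lambda>n. (if n = 0 then 1 else 0) * w ^ n) = (\<lambda>n. if n = 0 then 1 else 0)" by auto
    then show "(\<lambda>n. (if n = 0 then 1 else 0) * w ^ n) sums 1" using sums_single[of 0 "\<lambda>_. 1"] by simp
  qed (use w in auto)
  then show "(\<lambda>n. ((if n = 0 then 1 else 0) - pochhammer (- r) n / fact n) * w ^ n) sums (1 - (1 - w) powr r)"
    by (simp add: left_diff_distrib)
qed

lemma nonneg_power_series_powr_minus:
  fixes p :: real
  assumes "p \<ge> 0"
  shows "nonneg_power_series (\<lambda>w. (1 - w) powr (- p))"
  unfolding nonneg_power_series_def
proof (intro exI[of _ "\<lambda>n. pochhammer p n / fact n"] conjI allI impI)
  fix n show "0 \<le> pochhammer p n / fact n"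
    using assms by (cases "p = 0") (auto simp: pochhammer_0_left pochhammer_nonneg)
next
  fix w :: real assume "0 \<le> w \<and> w < 1"
  then show "(\<lambda>n. pochhammer p n / fact n * w ^ n) sums (1 - w) powr (- p)"
    by (intro binomial_series_pochhammer) auto
qed

text \<open>
  With \<open>A = K\<^sup>d\<close> and \<open>B = 1 - (1 - w)\<^sup>d\<close> one has \<open>1 + (K (1 - w))\<^sup>d = (1 + A) (1 - q B)\<close> for
  \<open>q = A / (1 + A)\<close>, so the power with exponent \<open>-g\<close> is a power series in \<open>B\<close> with nonnegative
  coefficients.
\<close>

theorem prabhakar_kernel_nonneg_le_1:
  fixes g d lam t :: real
  assumes g: "g > 0" and d: "0 < d" "d \<le> 1" and lam: "lam \<ge> 0" and t: "t > 0"
  shows "prabhakar_kernel g d (lam + d * g) t \<ge> 0"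
proof (rule prabhakar_kernel_nonnegI[OF g d(1) refl _ t])
  show "lam + d * g > 0" using lam d g by (simp add: add_nonneg_pos)
  fix K :: real assume K: "K > 1"
  define A where "A = K powr d"
  define q where "q = A / (1 + A)"
  have A: "A > 0" using K by (simp add: A_def)
  have q: "0 \<le> q" "q < 1" using A by (auto simp: q_def)
  have "nonneg_power_series (\<lambda>w. (1 + (K * (1 - w)) powr d) powr (- g))"
  proof (rule nonneg_power_series_compose[OF nonneg_power_series_one_minus_powr[OF d]])
    fix j show "(1 + A) powr (- g) * (pochhammer g j / fact j) * q ^ j \<ge> 0"
      using g q by (simp add: pochhammer_nonneg)
  next
    fix w :: real assume w: "0 \<le> w" "w < 1"
    define B where "B = 1 - (1 - w) powr d"
    have B: "0 \<le> B" "B \<le> 1" using w d by (auto simp: B_def powr_le1)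
    have "q * B < 1" using q B by (metis less_le_trans mult_left_le mult.commute mult_le_one not_less order_le_less_trans)
    then have "(\<lambda>j. (1 + A) powr (- g) * ((pochhammer g j / fact j) * (q * B) ^ j)) sums ((1 + A) powr (- g) * (1 - q * B) powr (- g))"
      using q B by (intro sums_mult binomial_series_pochhammer) auto
    moreover have "(1 + A) powr (- g) * (1 - q * B) powr (- g) = (1 + (K * (1 - w)) powr d) powr (- g)"
    proof -
      have "(1 + A) * (1 - q * B) = 1 + A * (1 - B)" using A by (simp add: q_def field_simps)
      also have "A * (1 - B) = (K * (1 - w)) powr d" using K w by (simp add: A_def B_def powr_mult)
      finally show ?thesis using A \<open>q * B < 1\<close> by (simp add: powr_mult[symmetric])
    qed
    ultimately show "(\<lambda>j. (1 + A) powr (- g) * (pochhammer g j / fact j) * q ^ j * (1 - (1 - w) powr d) ^ j) sums ((1 + (K * (1 - w)) powr d) powr (- g))"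
      by (simp add: B_def power_mult_distrib mult_ac)
  qed
  moreover have "nonneg_power_series (\<lambda>w. (K * (1 - w)) powr (- lam))"
  proof -
    have "nonneg_power_series (\<lambda>w. K powr (- lam) * (1 - w) powr (- lam))"
      using lam by (intro nonneg_power_series_mult nonneg_power_series_const nonneg_power_series_powr_minus) auto
    then show ?thesis using K unfolding nonneg_power_series_def by (simp add: powr_mult)
  qed
  ultimately show "nonneg_power_series (\<lambda>w. (K * (1 - w)) powr (- lam) * (1 + (K * (1 - w)) powr d) powr (- g))"
    by (intro nonneg_power_series_mult)
qed

section \<open>Laplace representations and subordination\<close>

text \<open>
  Euler's integral, scaled by \<open>z\<close>.
\<close>

lemma nn_integral_Gamma:
  fixes p z :: real
  assumes p: "p > 0" and z: "z > 0"
  shows "(\<integral>\<^sup>+t\<in>{0<..}. ennreal (t powr (p - 1) * exp (- (z * t))) \<partial>lborel) = ennreal (Gamma p * z powr (- p))"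
proof -
  have "ennreal (Gamma p) = (\<integral>\<^sup>+t. ennreal (indicator {0..} t * t powr (p - 1) / exp t) \<partial>lborel)"
    by (rule Gamma_conv_nn_integral_real[OF p])
  also have "\<dots> = ennreal \<bar>z\<bar> * (\<integral>\<^sup>+t. ennreal (indicator {0..} (0 + z * t) * (0 + z * t) powr (p - 1) / exp (0 + z * t)) \<partial>lborel)"
    using z by (intro nn_integral_real_affine) auto
  also have "(\<integral>\<^sup>+t. ennreal (indicator {0..} (0 + z * t) * (0 + z * t) powr (p - 1) / exp (0 + z * t)) \<partial>lborel)
     = (\<integral>\<^sup>+t. ennreal (z powr (p - 1)) * (ennreal (t powr (p - 1) * exp (- (z * t))) * indicator {0<..} t) \<partial>lborel)"
  proof (intro nn_integral_cong)
    fix t :: real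
    show "ennreal (indicator {0..} (0 + z * t) * (0 + z * t) powr (p - 1) / exp (0 + z * t))
       = ennreal (z powr (p - 1)) * (ennreal (t powr (p - 1) * exp (- (z * t))) * indicator {0<..} t)"
      using z by (cases "t > 0"; cases "t = 0")
        (auto simp: indicator_def zero_le_mult_iff powr_mult exp_minus field_simps simp flip: ennreal_mult)
  qed
  also have "\<dots> = ennreal (z powr (p - 1)) * (\<integral>\<^sup>+t\<in>{0<..}. ennreal (t powr (p - 1) * exp (- (z * t))) \<partial>lborel)"
    by (rule nn_integral_cmult) measurable
  finally have "ennreal (Gamma p) = ennreal \<bar>z\<bar> * (ennreal (z powr (p - 1)) * (\<integral>\<^sup>+t\<in>{0<..}. ennreal (t powr (p - 1) * exp (- (z * t))) \<partial>lborel))" .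
  also have "\<dots> = ennreal (z powr p) * (\<integral>\<^sup>+t\<in>{0<..}. ennreal (t powr (p - 1) * exp (- (z * t))) \<partial>lborel)"
    using z by (simp add: mult.assoc[symmetric] ennreal_mult[symmetric] powr_diff)
  finally have *: "ennreal (Gamma p) = ennreal (z powr p) * (\<integral>\<^sup>+t\<in>{0<..}. ennreal (t powr (p - 1) * exp (- (z * t))) \<partial>lborel)" .
  have "ennreal (Gamma p * z powr (- p)) = ennreal (z powr (- p)) * ennreal (Gamma p)"
    using Gamma_real_pos[OF p] by (simp add: ennreal_mult[symmetric] mult.commute)
  also have "\<dots> = (\<integral>\<^sup>+t\<in>{0<..}. ennreal (t powr (p - 1) * exp (- (z * t))) \<partial>lborel)"
    unfolding * using z by (simp add: mult.assoc[symmetric] ennreal_mult[symmetric] powr_add[symmetric])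
  finally show ?thesis by simp
qed

text \<open>
  \<open>F\<close> is the Laplace transform of the image of \<open>M\<close> under \<open>\<tau>\<close>.  Carrying \<open>M\<close> and \<open>\<tau>\<close> separately makes
  it unnecessary to compute image measures; the integrals only enter through Tonelli's theorem.
\<close>

definition laplace_represents :: "'w measure \<Rightarrow> ('w \<Rightarrow> real) \<Rightarrow> (real \<Rightarrow> real) \<Rightarrow> bool" where
  "laplace_represents M \<tau> F \<longleftrightarrow> \<tau> \<in> borel_measurable M \<and> (AE w in M. 0 \<le> \<tau> w)
     \<and> (\<forall>z>0. (\<integral>\<^sup>+w. ennreal (exp (- (z * \<tau> w))) \<partial>M) = ennreal (F z))"

definition prabhakar_transform :: "real \<Rightarrow> real \<Rightarrow> real \<Rightarrow> real \<Rightarrow> real" where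
  "prabhakar_transform g d lam z = z powr (- lam) * (1 + z powr d) powr (- g)"

lemma prabhakar_transform_nonneg: "prabhakar_transform g d lam z \<ge> 0"
  by (simp add: prabhakar_transform_def)

text \<open>
  The exponential series of \<open>exp (A B \<tau>)\<close> has nonnegative terms, so it may be integrated term by
  term without any integrability assumption.
\<close>

lemma laplace_shift_expansion:
  fixes A B :: real
  assumes [measurable]: "\<tau> \<in> borel_measurable M" and nn: "AE w in M. 0 \<le> \<tau> w" and A: "A > 0" and B: "B \<ge> 0"
  shows "(\<integral>\<^sup>+w. ennreal (exp (- (A * (1 - B) * \<tau> w))) \<partial>M)
     = (\<Sum>j. (\<integral>\<^sup>+w. ennreal (exp (- (A * \<tau> w)) * ((A * \<tau> w) ^ j / fact j)) \<partial>M) * ennreal (B ^ j))"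
proof -
  have "(\<integral>\<^sup>+w. ennreal (exp (- (A * (1 - B) * \<tau> w))) \<partial>M)
     = (\<integral>\<^sup>+w. (\<Sum>j. ennreal (exp (- (A * \<tau> w)) * ((A * \<tau> w) ^ j / fact j)) * ennreal (B ^ j)) \<partial>M)"
  proof (rule nn_integral_cong_AE)
    show "AE w in M. ennreal (exp (- (A * (1 - B) * \<tau> w)))
       = (\<Sum>j. ennreal (exp (- (A * \<tau> w)) * ((A * \<tau> w) ^ j / fact j)) * ennreal (B ^ j))"
      using nn
    proof eventually_elim
      case (elim w)
      define u where "u = A * \<tau> w"
      have u: "u \<ge> 0" using A elim by (simp add: u_def)
      have "(\<lambda>j. (u * B) ^ j /\<^sub>R fact j) sums exp (u * B)" by (rule exp_converges)
      then have "(\<lambda>j. exp (- u) * ((u * B) ^ j /\<^sub>R fact j)) sums (exp (- u) * exp (u * B))" by (rule sums_mult)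
      moreover have "exp (- u) * ((u * B) ^ j /\<^sub>R fact j) = (exp (- u) * (u ^ j / fact j)) * B ^ j" for j
        by (simp add: power_mult_distrib field_simps)
      moreover have "exp (- u) * exp (u * B) = exp (- (A * (1 - B) * \<tau> w))"
        by (simp add: exp_add[symmetric] u_def algebra_simps)
      ultimately have s: "(\<lambda>j. (exp (- u) * (u ^ j / fact j)) * B ^ j) sums exp (- (A * (1 - B) * \<tau> w))" by simp
      have "(\<Sum>j. ennreal (exp (- u) * (u ^ j / fact j)) * ennreal (B ^ j)) = (\<Sum>j. ennreal ((exp (- u) * (u ^ j / fact j)) * B ^ j))"
        using u B by (intro suminf_cong ennreal_mult[symmetric]) auto
      also have "\<dots> = ennreal (exp (- (A * (1 - B) * \<tau> w)))"
        using u B by (intro suminf_ennreal_eq s) auto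
      finally show ?case by (simp add: u_def)
    qed
  qed
  also have "\<dots> = (\<Sum>j. (\<integral>\<^sup>+w. ennreal (exp (- (A * \<tau> w)) * ((A * \<tau> w) ^ j / fact j)) * ennreal (B ^ j) \<partial>M))"
    by (rule nn_integral_suminf) measurable
  also have "\<dots> = (\<Sum>j. (\<integral>\<^sup>+w. ennreal (exp (- (A * \<tau> w)) * ((A * \<tau> w) ^ j / fact j)) \<partial>M) * ennreal (B ^ j))"
    by (intro suminf_cong nn_integral_multc) measurable
  finally show ?thesis .
qed

lemma ennreal_power_series_real:
  fixes c :: "nat \<Rightarrow> ennreal" and F :: "real \<Rightarrow> real"
  assumes R: "R > 0" and F: "\<And>B. 0 \<le> B \<Longrightarrow> B < R \<Longrightarrow> F B \<ge> 0"
    and s: "\<And>B. 0 \<le> B \<Longrightarrow> B < R \<Longrightarrow> (\<Sum>j. c j * ennreal (B ^ j)) = ennreal (F B)"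
  shows "c j = ennreal (enn2real (c j))"
    and "0 \<le> B \<Longrightarrow> B < R \<Longrightarrow> (\<lambda>j. enn2real (c j) * B ^ j) sums F B"
proof -
  have fin: "c j = ennreal (enn2real (c j))" for j
  proof -
    have "c j * ennreal ((R / 2) ^ j) \<le> (\<Sum>j. c j * ennreal ((R / 2) ^ j))"
      using sum_le_suminf[of "\<lambda>j. c j * ennreal ((R / 2) ^ j)" "{j}"] by simp
    also have "\<dots> < top" using s[of "R / 2"] R by simp
    finally have "c j < top" using R by (auto simp: ennreal_mult_less_top)
    then show ?thesis by simp
  qed
  show "c j = ennreal (enn2real (c j))" by (rule fin)
  assume B: "0 \<le> B" "B < R"
  have "(\<Sum>j. ennreal (enn2real (c j) * B ^ j)) = (\<Sum>j. c j * ennreal (B ^ j))"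
    using fin B by (intro suminf_cong) (metis ennreal_mult enn2real_nonneg zero_le_power)
  then have e: "(\<Sum>j. ennreal (enn2real (c j) * B ^ j)) = ennreal (F B)" using s[OF B] by simp
  have sm: "summable (\<lambda>j. enn2real (c j) * B ^ j)"
    using B e by (intro summable_suminf_not_top) auto
  have "ennreal (\<Sum>j. enn2real (c j) * B ^ j) = ennreal (F B)"
    using B e sm by (subst suminf_ennreal2[symmetric]) auto
  moreover have "(\<Sum>j. enn2real (c j) * B ^ j) \<ge> 0"
    by (rule suminf_nonneg[OF sm]) (use B in simp)
  ultimately have "(\<Sum>j. enn2real (c j) * B ^ j) = F B"
    using F[OF B] by simp
  then show "(\<lambda>j. enn2real (c j) * B ^ j) sums F B" using sm by (simp add: sums_iff)
qed

text \<open>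
  Subordination: if \<open>F\<close> is completely monotone, so is \<open>z \<mapsto> F (z\<^sup>r)\<close> for \<open>0 < r \<le> 1\<close>.  With \<open>A = K\<^sup>r\<close> and
  \<open>B = 1 - (1 - w)\<^sup>r\<close> the argument is \<open>A (1 - B)\<close>, and the expansion above is a power series in \<open>B\<close> with
  nonnegative coefficients.
\<close>

theorem laplace_represents_subordinate:
  fixes F :: "real \<Rightarrow> real"
  assumes rep: "laplace_represents M \<tau> F" and F: "\<And>z. z > 0 \<Longrightarrow> F z \<ge> 0"
    and r: "0 < r" "r \<le> 1" and K: "K > 0"
  shows "nonneg_power_series (\<lambda>w. F ((K * (1 - w)) powr r))"
proof -
  define A where "A = K powr r"
  have A: "A > 0" using K by (simp add: A_def)
  define c where "c = (\<lambda>j. \<integral>\<^sup>+w. ennreal (exp (- (A * \<tau> w)) * ((A * \<tau> w) ^ j / fact j)) \<partial>M)"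
  have exp: "(\<Sum>j. c j * ennreal (B ^ j)) = ennreal (F (A * (1 - B)))" if "0 \<le> B" "B < 1" for B
  proof -
    have "A * (1 - B) > 0" using that A by simp
    then show ?thesis
      using rep that laplace_shift_expansion[of \<tau> M A B] A unfolding laplace_represents_def c_def by simp
  qed
  have Fn: "F (A * (1 - B)) \<ge> 0" if "0 \<le> B" "B < 1" for B using that A by (intro F) simp
  show ?thesis
  proof (rule nonneg_power_series_compose[OF nonneg_power_series_one_minus_powr[OF r]])
    fix j show "enn2real (c j) \<ge> 0" by simp
  next
    fix w :: real assume w: "0 \<le> w" "w < 1"
    define B where "B = 1 - (1 - w) powr r"
    have B: "0 \<le> B" "B < 1" using w r by (auto simp: B_def powr_le1)
    have "(\<lambda>j. enn2real (c j) * B ^ j) sums F (A * (1 - B))"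
      by (rule ennreal_power_series_real(2)[of 1 "\<lambda>B. F (A * (1 - B))" c B]) (use exp Fn B in auto)
    moreover have "A * (1 - B) = (K * (1 - w)) powr r" using K w by (simp add: A_def B_def powr_mult)
    ultimately show "(\<lambda>j. enn2real (c j) * (1 - (1 - w) powr r) ^ j) sums F ((K * (1 - w)) powr r)"
      by (simp add: B_def)
  qed
qed

lemma prabhakar_transform_powr:
  assumes "z > 0"
  shows "prabhakar_transform g d lam (z powr r) = prabhakar_transform g (r * d) (r * lam) z"
  using assms by (simp add: prabhakar_transform_def powr_powr)

theorem prabhakar_kernel_nonneg_of_represents:
  fixes g d lam r t :: real
  assumes g: "g > 0" and d: "d > 0" and mu: "lam + d * g > 0" and r: "0 < r" "r \<le> 1" and t: "t > 0"
    and rep: "laplace_represents M \<tau> (prabhakar_transform g d lam)"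
  shows "prabhakar_kernel g (r * d) (r * (lam + d * g)) t \<ge> 0"
proof (rule prabhakar_kernel_nonnegI[of g "r * d" _ "r * lam"])
  fix K :: real assume K: "K > 1"
  have "nonneg_power_series (\<lambda>w. prabhakar_transform g d lam ((K * (1 - w)) powr r))"
    using K by (intro laplace_represents_subordinate[OF rep prabhakar_transform_nonneg r]) simp
  then show "nonneg_power_series (\<lambda>w. (K * (1 - w)) powr (- (r * lam)) * (1 + (K * (1 - w)) powr (r * d)) powr (- g))"
    using K unfolding nonneg_power_series_def
    by (simp add: prabhakar_transform_powr) (simp add: prabhakar_transform_def)
next
  show "r * (lam + d * g) > 0" using mu r by simp
qed (use g d r t in \<open>auto simp: algebra_simps\<close>)

text \<open>
  For \<open>d \<le> 2\<close> and \<open>Re z > 0\<close> the argument of \<open>z\<^sup>d\<close> stays strictly between \<open>-\<pi>\<close> and \<open>\<pi>\<close>, so \<open>1 + z\<^sup>d\<close> avoids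
  the branch cut of the logarithm.
\<close>

lemma prabhakar_transform_holomorphic:
  assumes d: "0 < d" "d \<le> 2"
  shows "\<exists>Hc. Hc holomorphic_on {z. Re z > 0}
    \<and> (\<forall>x>0. Hc (complex_of_real x) = complex_of_real (prabhakar_transform g d lam x))"
proof -
  define Hc where "Hc = (\<lambda>z::complex. exp (- of_real lam * Ln z) * exp (- of_real g * Ln (1 + exp (of_real d * Ln z))))"
  have slit: "z \<notin> \<real>\<^sub>\<le>\<^sub>0" "1 + exp (of_real d * Ln z) \<notin> \<real>\<^sub>\<le>\<^sub>0" if z: "Re z > 0" for z
  proof -
    have z0: "z \<noteq> 0" using z by auto
    show "z \<notin> \<real>\<^sub>\<le>\<^sub>0" using z by (auto simp: complex_nonpos_Reals_iff)
    have "\<bar>Im (Ln z)\<bar> < pi / 2" using z z0 Re_Ln_pos_lt by auto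
    then have "d * \<bar>Im (Ln z)\<bar> < 2 * (pi / 2)"
      using d by (intro mult_le_less_imp_less) auto
    then have a: "\<bar>d * Im (Ln z)\<bar> < pi" using d by (simp add: abs_mult)
    show "1 + exp (of_real d * Ln z) \<notin> \<real>\<^sub>\<le>\<^sub>0"
    proof
      assume "1 + exp (of_real d * Ln z) \<in> \<real>\<^sub>\<le>\<^sub>0"
      then have *: "Re (exp (of_real d * Ln z)) < 0" "Im (exp (of_real d * Ln z)) = 0"
        by (auto simp: complex_nonpos_Reals_iff)
      then have s: "sin (d * Im (Ln z)) = 0" by (simp add: Im_exp)
      have "d * Im (Ln z) = 0"
        by (rule sin_eq_0_pi) (use s a in \<open>auto simp: abs_less_iff\<close>)
      then have "cos (d * Im (Ln z)) = 1" by (simp only: cos_zero)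
      then show False using *(1) by (simp add: Re_exp)
    qed
  qed
  have hol: "Hc holomorphic_on {z. Re z > 0}"
    unfolding Hc_def by (intro holomorphic_intros) (use slit in auto)
  have "Hc (complex_of_real x) = complex_of_real (prabhakar_transform g d lam x)" if x: "x > 0" for x
  proof -
    have q: "exp (complex_of_real u * complex_of_real (ln y)) = complex_of_real (y powr u)" if "y > 0" for u y
    proof -
      have "exp (complex_of_real u * complex_of_real (ln y)) = exp (complex_of_real (u * ln y))"
        by (rule arg_cong[OF of_real_mult[symmetric]])
      also have "\<dots> = complex_of_real (exp (u * ln y))" by (rule exp_of_real)
      also have "exp (u * ln y) = y powr u" using that by (auto simp: powr_def)
      finally show ?thesis .
    qed
    have p: "1 + x powr d > 0" using x by (simp add: add_pos_nonneg)
    have "1 + complex_of_real (x powr d) = complex_of_real (1 + x powr d)" by simp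
    then have l: "Ln (1 + complex_of_real (x powr d)) = complex_of_real (ln (1 + x powr d))"
      by (simp only: Ln_of_real[OF p])
    have m: "- complex_of_real u = complex_of_real (- u)" for u by simp
    show ?thesis
      unfolding Hc_def Ln_of_real[OF x] q[OF x] l m q[OF p] prabhakar_transform_def of_real_mult ..
  qed
  with hol show ?thesis by blast
qed

text \<open>
  Landau's argument for transforms of nonnegative measures.  The power series around \<open>2\<close> of the
  Laplace transform has nonnegative coefficients in \<open>2 - z\<close> and agrees with the Taylor series of
  \<open>H\<close>, which converges in the disc of radius \<open>2\<close>; by monotone convergence the Laplace integral is
  finite, and equal to \<open>H\<close>, down to \<open>0\<close>.
\<close>

theorem laplace_represents_extend:
  assumes d: "0 < d" "d \<le> 2" and [measurable]: "\<tau> \<in> borel_measurable M" and nn: "AE w in M. 0 \<le> \<tau> w"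
    and L: "\<And>z. z > 1 \<Longrightarrow> (\<integral>\<^sup>+w. ennreal (exp (- (z * \<tau> w))) \<partial>M) = ennreal (prabhakar_transform g d lam z)"
  shows "laplace_represents M \<tau> (prabhakar_transform g d lam)"
proof -
  define H where "H = prabhakar_transform g d lam"
  obtain Hc where Hc: "Hc holomorphic_on {z. Re z > 0}" "\<And>x. x > 0 \<Longrightarrow> Hc (complex_of_real x) = complex_of_real (H x)"
    using prabhakar_transform_holomorphic[OF d, of g lam] unfolding H_def by blast
  define c where "c = (\<lambda>j. \<integral>\<^sup>+w. ennreal (exp (- (2 * \<tau> w)) * ((2 * \<tau> w) ^ j / fact j)) \<partial>M)"
  have exp: "(\<integral>\<^sup>+w. ennreal (exp (- (2 * (1 - B) * \<tau> w))) \<partial>M) = (\<Sum>j. c j * ennreal (B ^ j))" if "0 \<le> B" for B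
    unfolding c_def using that by (intro laplace_shift_expansion nn) auto
  have s1: "(\<Sum>j. c j * ennreal (B ^ j)) = ennreal (H (2 * (1 - B)))" if "0 \<le> B" "B < 1 / 2" for B
    using exp[of B] L[of "2 * (1 - B)"] that by (simp add: H_def)
  have Hn: "H z \<ge> 0" for z by (simp add: H_def prabhakar_transform_nonneg)
  have c: "(\<lambda>j. enn2real (c j) * B ^ j) sums H (2 * (1 - B))" if "0 \<le> B" "B < 1 / 2" for B
    by (rule ennreal_power_series_real(2)[of "1/2" "\<lambda>B. H (2 * (1 - B))" c B]) (use s1 Hn that in auto)
  have cfin: "c j = ennreal (enn2real (c j))" for j
    by (rule ennreal_power_series_real(1)[of "1/2" "\<lambda>B. H (2 * (1 - B))" c]) (use s1 Hn in auto)
  \<comment> \<open>Taylor coefficients of \<open>H\<close> at \<open>2\<close>, rescaled to the variable \<open>B = (2 - z) / 2\<close>.\<close>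
  define e where "e = (\<lambda>n. Re ((deriv ^^ n) Hc 2 / fact n) * (- 2) ^ n)"
  have e: "(\<lambda>n. e n * B ^ n) sums H (2 * (1 - B))" if "0 \<le> B" "B < 1" for B
  proof -
    have sub: "ball 2 2 \<subseteq> {z::complex. Re z > 0}"
    proof
      fix z :: complex assume "z \<in> ball 2 2"
      then have "cmod (2 - z) < 2" by (simp add: dist_norm)
      then have "\<bar>Re (2 - z)\<bar> < 2" using abs_Re_le_cmod[of "2 - z"] by linarith
      then show "z \<in> {z. Re z > 0}" by auto
    qed
    have "complex_of_real (2 * (1 - B)) \<in> ball 2 2"
    proof -
      have "2 - complex_of_real (2 * (1 - B)) = complex_of_real (2 * B)" by simp
      then show ?thesis using that by (simp only: mem_ball dist_norm norm_of_real)
    qed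
    then have "(\<lambda>n. (deriv ^^ n) Hc 2 / fact n * (complex_of_real (2 * (1 - B)) - 2) ^ n) sums Hc (complex_of_real (2 * (1 - B)))"
      by (intro holomorphic_power_series[OF holomorphic_on_subset[OF Hc(1) sub]])
    then have "(\<lambda>n. Re ((deriv ^^ n) Hc 2 / fact n * (complex_of_real (2 * (1 - B)) - 2) ^ n)) sums Re (Hc (complex_of_real (2 * (1 - B))))"
      by (rule sums_Re)
    moreover have "complex_of_real (2 * (1 - B)) - 2 = complex_of_real (- 2 * B)" by simp
    moreover have "Re (x * complex_of_real (- 2 * B) ^ n) = Re x * (- 2) ^ n * B ^ n" for x n
    proof -
      have "Re (x * complex_of_real (- 2 * B) ^ n) = Re x * (- 2 * B) ^ n"
        unfolding of_real_power[symmetric] by simp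
      then show ?thesis by (simp only: power_mult_distrib mult.assoc)
    qed
    ultimately show ?thesis using Hc(2)[of "2 * (1 - B)"] that by (simp only: e_def) simp
  qed
  have ce: "(\<lambda>j. enn2real (c j)) = e"
    by (rule power_series_unique_right[of "1/2" _ "\<lambda>B. H (2 * (1 - B))"]) (use c e in auto)
  have "(\<integral>\<^sup>+w. ennreal (exp (- (z * \<tau> w))) \<partial>M) = ennreal (H z)" if z: "z > 0" for z
  proof (cases "z > 1")
    case True
    then show ?thesis using L by (simp add: H_def)
  next
    case False
    define B where "B = 1 - z / 2"
    have B: "0 \<le> B" "B < 1" "2 * (1 - B) = z" using z False by (auto simp: B_def)
    have en: "e n \<ge> 0" for n using ce by (metis enn2real_nonneg)
    have "(\<integral>\<^sup>+w. ennreal (exp (- (z * \<tau> w))) \<partial>M) = (\<Sum>j. c j * ennreal (B ^ j))"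
      using exp[OF B(1)] unfolding B(3) .
    also have "\<dots> = (\<Sum>j. ennreal (e j * B ^ j))"
    proof (intro suminf_cong)
      fix j
      have "c j = ennreal (e j)" using cfin[of j] ce by metis
      then show "c j * ennreal (B ^ j) = ennreal (e j * B ^ j)" using en B by (simp add: ennreal_mult)
    qed
    also have "\<dots> = ennreal (H z)" using e[OF B(1,2)] en B by (intro suminf_ennreal_eq) auto
    finally show ?thesis .
  qed
  then show ?thesis using nn by (auto simp: laplace_represents_def H_def)
qed

section \<open>The Laplace transform of a nonnegative kernel\<close>

definition kernel_measure :: "(real \<Rightarrow> real) \<Rightarrow> real measure" where
  "kernel_measure h = density lborel (\<lambda>t. ennreal (h t) * indicator {0<..} t)"

lemma sets_kernel_measure [measurable_cong]: "sets (kernel_measure h) = sets borel"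
  by (simp add: kernel_measure_def)

lemma AE_kernel_measure_pos:
  assumes [measurable]: "h \<in> borel_measurable borel"
  shows "AE t in kernel_measure h. 0 < t"
  unfolding kernel_measure_def by (subst AE_density) (auto simp: indicator_def)

lemma nn_integral_kernel_measure:
  assumes [measurable]: "h \<in> borel_measurable borel" "f \<in> borel_measurable borel"
  shows "(\<integral>\<^sup>+t. f t \<partial>kernel_measure h) = (\<integral>\<^sup>+t\<in>{0<..}. ennreal (h t) * f t \<partial>lborel)"
  unfolding kernel_measure_def by (subst nn_integral_density) (auto simp: mult_ac)

lemma borel_measurable_prabhakar_kernel [measurable]: "prabhakar_kernel g d \<mu> \<in> borel_measurable borel"
  unfolding prabhakar_kernel_def prabhakar_def by measurable

text \<open>
  Only for \<open>z > 1\<close> is the series that results from termwise integration, a binomial series in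
  \<open>z\<^bsup>-d\<^esup>\<close>, absolutely convergent.
\<close>

lemma prabhakar_kernel_laplace:
  fixes g d lam z :: real
  assumes g: "g > 0" and d: "d > 0" and mu: "lam + d * g > 0" and z: "z > 1"
    and nn: "\<And>t. t > 0 \<Longrightarrow> prabhakar_kernel g d (lam + d * g) t \<ge> 0"
  shows "(\<integral>\<^sup>+t. ennreal (exp (- (z * t))) \<partial>kernel_measure (prabhakar_kernel g d (lam + d * g))) = ennreal (prabhakar_transform g d lam z)"
proof -
  define \<mu> where "\<mu> = lam + d * g"
  have mu0: "\<mu> > 0" using mu by (simp add: \<mu>_def)
  define x where "x = (\<lambda>k. \<mu> + d * real k)"
  have x: "x k > 0" for k using mu0 d by (simp add: x_def add_pos_nonneg)
  define c where "c = (\<lambda>k. (-1) ^ k * (pochhammer g k / fact k) * rGamma (x k))"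
  define u where "u = (\<lambda>k (t::real). indicator {0<..} t * (t powr (x k - 1) * exp (- (z * t))))"
  have rG: "rGamma (x k) * Gamma (x k) = 1" "rGamma (x k) > 0" for k
    using Gamma_real_pos[OF x[of k]] by (auto simp: rGamma_inverse_Gamma)
  have pg: "pochhammer g k > 0" for k using g by (simp add: pochhammer_pos)
  have um [measurable]: "u k \<in> borel_measurable lborel" for k unfolding u_def by measurable
  have u: "has_bochner_integral lborel (u k) (Gamma (x k) * z powr (- x k))" for k
  proof (rule has_bochner_integral_nn_integral)
    have "(\<integral>\<^sup>+t. ennreal (u k t) \<partial>lborel) = (\<integral>\<^sup>+t\<in>{0<..}. ennreal (t powr (x k - 1) * exp (- (z * t))) \<partial>lborel)"
      by (intro nn_integral_cong) (auto simp: u_def indicator_def)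
    also have "\<dots> = ennreal (Gamma (x k) * z powr (- x k))" using z x by (intro nn_integral_Gamma) auto
    finally show "(\<integral>\<^sup>+t. ennreal (u k t) \<partial>lborel) = ennreal (Gamma (x k) * z powr (- x k))" .
    show "0 \<le> Gamma (x k) * z powr (- x k)" using Gamma_real_pos[OF x[of k]] by simp
    show "AE t in lborel. 0 \<le> u k t" by (auto simp: u_def)
  qed (rule um)
  have zk: "z powr (- x k) = z powr (- \<mu>) * (z powr (- d)) ^ k" for k
    using z by (simp add: x_def powr_powr powr_add[symmetric] powr_realpow[symmetric] algebra_simps)
  have r: "\<bar>z powr (- d)\<bar> < 1" "\<bar>- (z powr (- d))\<bar> < 1" using z d by (auto simp: powr_less_one)
  have cG: "c k * (Gamma (x k) * z powr (- x k)) = z powr (- \<mu>) * ((pochhammer g k / fact k) * (- (z powr (- d))) ^ k)" for k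
  proof -
    have "c k * (Gamma (x k) * z powr (- x k)) = (rGamma (x k) * Gamma (x k)) * ((-1) ^ k * (pochhammer g k / fact k) * z powr (- x k))"
      by (simp add: c_def mult_ac)
    then show ?thesis unfolding rG(1) zk power_minus[of "z powr (- d)"] by (simp add: mult_ac)
  qed
  have acG: "\<bar>c k\<bar> * (Gamma (x k) * z powr (- x k)) = z powr (- \<mu>) * ((pochhammer g k / fact k) * (z powr (- d)) ^ k)" for k
  proof -
    have "\<bar>c k\<bar> = (pochhammer g k / fact k) * rGamma (x k)" using pg[of k] rG(2)[of k] by (simp add: c_def abs_mult)
    then have "\<bar>c k\<bar> * (Gamma (x k) * z powr (- x k)) = (rGamma (x k) * Gamma (x k)) * ((pochhammer g k / fact k) * z powr (- x k))"
      by (simp add: mult_ac)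
    then show ?thesis unfolding rG(1) zk by (simp add: mult_ac)
  qed
  define f where "f = (\<lambda>k t. c k * u k t)"
  have f: "has_bochner_integral lborel (f k) (c k * (Gamma (x k) * z powr (- x k)))" for k
    unfolding f_def by (intro has_bochner_integral_mult_right u)
  have fi: "integrable lborel (f k)" "integral\<^sup>L lborel (f k) = c k * (Gamma (x k) * z powr (- x k))" for k
    using f[of k] by (auto simp: has_bochner_integral_iff)
  have nf: "integral\<^sup>L lborel (\<lambda>t. norm (f k t)) = z powr (- \<mu>) * ((pochhammer g k / fact k) * (z powr (- d)) ^ k)" for k
  proof -
    have "norm (f k t) = \<bar>c k\<bar> * u k t" for t by (simp add: f_def u_def abs_mult)
    moreover have "has_bochner_integral lborel (\<lambda>t. \<bar>c k\<bar> * u k t) (\<bar>c k\<bar> * (Gamma (x k) * z powr (- x k)))"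
      by (intro has_bochner_integral_mult_right u)
    ultimately show ?thesis unfolding acG by (simp add: has_bochner_integral_iff)
  qed
  have K: "prabhakar_kernel g d \<mu> t = (\<Sum>k. c k * t powr (x k - 1))" if "t > 0" for t
    unfolding prabhakar_kernel_eq[OF g d mu0 that] c_def x_def by (simp add: mult_ac)
  have sf: "summable (\<lambda>k. norm (f k t))" for t
  proof (cases "t > 0")
    case True
    have "summable (\<lambda>k. exp (- (z * t)) * ((pochhammer g k / fact k) * t powr (\<mu> + d * real k - 1) * rGamma (\<mu> + d * real k)))"
      by (rule summable_mult[OF abs_summable_prabhakar_powr[OF g d mu0 True]])
    moreover have "norm (f k t) = exp (- (z * t)) * ((pochhammer g k / fact k) * t powr (\<mu> + d * real k - 1) * rGamma (\<mu> + d * real k))" for k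
      using True pg[of k] rG(2)[of k] by (simp add: f_def u_def c_def x_def abs_mult mult_ac)
    ultimately show ?thesis by simp
  qed (simp add: f_def u_def)
  have sumnf: "summable (\<lambda>k. integral\<^sup>L lborel (\<lambda>t. norm (f k t)))"
    unfolding nf by (intro summable_mult sums_summable[OF binomial_series_pochhammer[OF r(1)]])
  have fsum: "(\<Sum>k. f k t) = indicator {0<..} t * (exp (- (z * t)) * prabhakar_kernel g d \<mu> t)" for t
  proof (cases "t > 0")
    case True
    have e: "f k t = exp (- (z * t)) * (c k * t powr (x k - 1))" for k using True by (simp add: f_def u_def)
    have "summable (\<lambda>k. f k t)" using sf[of t] by (rule summable_norm_cancel)
    then have "summable (\<lambda>k. c k * t powr (x k - 1))" unfolding e by (subst (asm) summable_cmult_iff) simp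
    then show ?thesis using True unfolding e K[OF True] by (simp add: suminf_mult)
  qed (simp add: f_def u_def)
  have int: "integrable lborel (\<lambda>t. \<Sum>k. f k t)"
    by (rule integrable_suminf[OF fi(1) AE_I2[OF sf] sumnf])
  have "(\<lambda>k. integral\<^sup>L lborel (f k)) sums (\<integral>t. (\<Sum>k. f k t) \<partial>lborel)"
    by (rule sums_integral[OF fi(1) AE_I2[OF sf] sumnf])
  moreover have "(\<lambda>k. integral\<^sup>L lborel (f k)) sums (z powr (- \<mu>) * (1 - (- (z powr (- d)))) powr (- g))"
    unfolding fi(2) cG by (intro sums_mult binomial_series_pochhammer r)
  ultimately have val: "(\<integral>t. (\<Sum>k. f k t) \<partial>lborel) = z powr (- \<mu>) * (1 - (- (z powr (- d)))) powr (- g)"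
    by (rule sums_unique2)
  also have "\<dots> = prabhakar_transform g d lam z"
    using powr_binomial_split[of z lam d g] z by (simp add: \<mu>_def prabhakar_transform_def)
  finally have val: "(\<integral>t. (\<Sum>k. f k t) \<partial>lborel) = prabhakar_transform g d lam z" .
  have "(\<integral>\<^sup>+t. ennreal (exp (- (z * t))) \<partial>kernel_measure (prabhakar_kernel g d \<mu>))
     = (\<integral>\<^sup>+t. ennreal (\<Sum>k. f k t) \<partial>lborel)"
  proof (subst nn_integral_kernel_measure)
    show "(\<integral>\<^sup>+t\<in>{0<..}. ennreal (prabhakar_kernel g d \<mu> t) * ennreal (exp (- (z * t))) \<partial>lborel) = (\<integral>\<^sup>+t. ennreal (\<Sum>k. f k t) \<partial>lborel)"
    proof (intro nn_integral_cong)
      fix t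
      show "ennreal (prabhakar_kernel g d \<mu> t) * ennreal (exp (- (z * t))) * indicator {0<..} t = ennreal (\<Sum>k. f k t)"
        unfolding fsum using nn[of t] by (cases "t > 0") (simp_all add: \<mu>_def ennreal_mult mult.commute)
    qed
  qed measurable
  also have "\<dots> = ennreal (\<integral>t. (\<Sum>k. f k t) \<partial>lborel)"
  proof (rule nn_integral_eq_integral[OF int])
    have "(\<Sum>k. f k t) \<ge> 0" for t unfolding fsum using nn[of t] by (cases "t > 0") (simp_all add: \<mu>_def)
    then show "AE t in lborel. 0 \<le> (\<Sum>k. f k t)" by simp
  qed
  finally show ?thesis unfolding val by (simp add: \<mu>_def)
qed

section \<open>Substitutions and the Mellin transform\<close>

lemma nn_integral_exp_substitution:
  fixes f :: "real \<Rightarrow> ennreal"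
  assumes [measurable]: "f \<in> borel_measurable borel"
  shows "(\<integral>\<^sup>+x\<in>{0<..}. f x \<partial>lborel) = (\<integral>\<^sup>+u. f (exp u) * ennreal (exp u) \<partial>lborel)"
proof -
  define I where "I = (\<lambda>n. {exp (- real (Suc n))..exp (real (Suc n))})"
  define J where "J = (\<lambda>n. {- real (Suc n)..real (Suc n)})"
  have eq: "(\<integral>\<^sup>+x. f x * indicator (I n) x \<partial>lborel) = (\<integral>\<^sup>+u. f (exp u) * ennreal (exp u) * indicator (J n) u \<partial>lborel)" for n
    unfolding I_def J_def by (rule nn_integral_substitution_aux) (auto intro!: derivative_eq_intros continuous_intros)
  have "(\<lambda>n. \<integral>\<^sup>+x. f x * indicator (I n) x \<partial>lborel) \<longlonglongrightarrow> (\<integral>\<^sup>+x\<in>{0<..}. f x \<partial>lborel)"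
  proof (rule nn_integral_LIMSEQ)
    show "incseq (\<lambda>n x. f x * indicator (I n) x)"
    proof (intro incseq_SucI le_funI mult_left_mono)
      fix n x
      have "I n \<subseteq> I (Suc n)" by (auto simp: I_def intro: order_trans)
      then show "indicator (I n) x \<le> (indicator (I (Suc n)) x :: ennreal)" by (auto simp: indicator_def)
    qed simp
    show "(\<lambda>n. f x * indicator (I n) x) \<longlonglongrightarrow> f x * indicator {0<..} x" for x
    proof (rule tendsto_eventually, cases "x > 0")
      case True
      have "eventually (\<lambda>n. \<bar>ln x\<bar> \<le> real (Suc n)) sequentially" by real_asymp
      then show "eventually (\<lambda>n. f x * indicator (I n) x = f x * indicator {0<..} x) sequentially"
      proof eventually_elim
        case (elim n)
        have "exp (- real (Suc n)) \<le> exp (ln x)" "exp (ln x) \<le> exp (real (Suc n))"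
          using elim by (simp_all only: exp_le_cancel_iff)
        then show ?case using True by (simp add: I_def indicator_def)
      qed
    next
      case False
      have "x \<notin> I n" for n
      proof
        assume "x \<in> I n"
        then have "exp (- real (Suc n)) \<le> x" by (simp add: I_def)
        then show False using False exp_gt_zero[of "- real (Suc n)"] by linarith
      qed
      then show "eventually (\<lambda>n. f x * indicator (I n) x = f x * indicator {0<..} x) sequentially"
        using False by (simp add: indicator_def)
    qed
  qed (simp add: I_def)
  moreover have "(\<lambda>n. \<integral>\<^sup>+u. f (exp u) * ennreal (exp u) * indicator (J n) u \<partial>lborel) \<longlonglongrightarrow> (\<integral>\<^sup>+u. f (exp u) * ennreal (exp u) \<partial>lborel)"
  proof (rule nn_integral_LIMSEQ)
    show "incseq (\<lambda>n u. f (exp u) * ennreal (exp u) * indicator (J n) u)"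
    proof (intro incseq_SucI le_funI mult_left_mono)
      fix n u
      have "J n \<subseteq> J (Suc n)" by (auto simp: J_def)
      then show "indicator (J n) u \<le> (indicator (J (Suc n)) u :: ennreal)" by (auto simp: indicator_def)
    qed simp
    show "(\<lambda>n. f (exp u) * ennreal (exp u) * indicator (J n) u) \<longlonglongrightarrow> f (exp u) * ennreal (exp u)" for u
    proof (rule tendsto_eventually)
      have "eventually (\<lambda>n. \<bar>u\<bar> \<le> real (Suc n)) sequentially" by real_asymp
      then show "eventually (\<lambda>n. f (exp u) * ennreal (exp u) * indicator (J n) u = f (exp u) * ennreal (exp u)) sequentially"
      proof eventually_elim
        case (elim n)
        then have "u \<in> J n" unfolding J_def atLeastAtMost_iff by linarith
        then show ?case by simp
      qed
    qed
  qed (simp add: J_def)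
  ultimately show ?thesis unfolding eq by (rule LIMSEQ_unique)
qed

text \<open>
  In the logarithmic scale the power map is multiplication by \<open>p\<close>, for either sign of \<open>p\<close>.
\<close>

lemma nn_integral_powr_substitution:
  fixes f :: "real \<Rightarrow> ennreal" and p :: real
  assumes [measurable]: "f \<in> borel_measurable borel" and p: "p \<noteq> 0"
  shows "(\<integral>\<^sup>+x\<in>{0<..}. f x \<partial>lborel) = (\<integral>\<^sup>+x\<in>{0<..}. ennreal (\<bar>p\<bar> * x powr (p - 1)) * f (x powr p) \<partial>lborel)"
proof -
  have "(\<integral>\<^sup>+x\<in>{0<..}. f x \<partial>lborel) = (\<integral>\<^sup>+u. f (exp u) * ennreal (exp u) \<partial>lborel)"
    by (rule nn_integral_exp_substitution) measurable
  also have "\<dots> = ennreal \<bar>p\<bar> * (\<integral>\<^sup>+u. f (exp (0 + p * u)) * ennreal (exp (0 + p * u)) \<partial>lborel)"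
    using p by (intro nn_integral_real_affine) auto
  also have "\<dots> = (\<integral>\<^sup>+u. ennreal \<bar>p\<bar> * (f (exp (0 + p * u)) * ennreal (exp (0 + p * u))) \<partial>lborel)"
    by (rule nn_integral_cmult[symmetric]) measurable
  also have "\<dots> = (\<integral>\<^sup>+u. (ennreal (\<bar>p\<bar> * exp u powr (p - 1)) * f (exp u powr p)) * ennreal (exp u) \<partial>lborel)"
  proof (intro nn_integral_cong)
    fix u :: real
    have e: "exp u powr p = exp (0 + p * u)" "exp u powr (p - 1) = exp (p * u - u)"
      by (simp_all add: powr_def algebra_simps)
    have "ennreal (\<bar>p\<bar> * exp (p * u - u)) * ennreal (exp u) = ennreal (\<bar>p\<bar> * (exp (p * u - u) * exp u))"
      by (simp add: ennreal_mult[symmetric] mult.assoc)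
    also have "exp (p * u - u) * exp u = exp (0 + p * u)" by (simp add: exp_add[symmetric])
    also have "ennreal (\<bar>p\<bar> * exp (0 + p * u)) = ennreal \<bar>p\<bar> * ennreal (exp (0 + p * u))" by (simp add: ennreal_mult)
    finally have k: "ennreal (\<bar>p\<bar> * exp (p * u - u)) * ennreal (exp u) = ennreal \<bar>p\<bar> * ennreal (exp (0 + p * u))" .
    have "(ennreal (\<bar>p\<bar> * exp u powr (p - 1)) * f (exp u powr p)) * ennreal (exp u)
        = (ennreal (\<bar>p\<bar> * exp (p * u - u)) * ennreal (exp u)) * f (exp (0 + p * u))"
      unfolding e by (simp only: mult_ac)
    then show "ennreal \<bar>p\<bar> * (f (exp (0 + p * u)) * ennreal (exp (0 + p * u)))
       = (ennreal (\<bar>p\<bar> * exp u powr (p - 1)) * f (exp u powr p)) * ennreal (exp u)"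
      unfolding k by (simp only: mult_ac)
  qed
  also have "\<dots> = (\<integral>\<^sup>+x\<in>{0<..}. ennreal (\<bar>p\<bar> * x powr (p - 1)) * f (x powr p) \<partial>lborel)"
    by (rule nn_integral_exp_substitution[symmetric]) measurable
  finally show ?thesis .
qed

lemma nn_integral_powr_exp_powr:
  fixes d p u :: real
  assumes d: "d > 0" and p: "p > 0" and u: "u > 0"
  shows "(\<integral>\<^sup>+z\<in>{0<..}. ennreal (z powr (d * p - 1) * exp (- (u * z powr d))) \<partial>lborel) = ennreal (Gamma p / d * u powr (- p))"
proof -
  have "ennreal (Gamma p * u powr (- p)) = (\<integral>\<^sup>+t\<in>{0<..}. ennreal (t powr (p - 1) * exp (- (u * t))) \<partial>lborel)"
    by (rule nn_integral_Gamma[OF p u, symmetric])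
  also have "\<dots> = (\<integral>\<^sup>+z\<in>{0<..}. ennreal (\<bar>d\<bar> * z powr (d - 1)) * ennreal ((z powr d) powr (p - 1) * exp (- (u * z powr d))) \<partial>lborel)"
    using d by (intro nn_integral_powr_substitution) auto
  also have "\<dots> = (\<integral>\<^sup>+z. ennreal d * (ennreal (z powr (d * p - 1) * exp (- (u * z powr d))) * indicator {0<..} z) \<partial>lborel)"
  proof (intro nn_integral_cong)
    fix z :: real
    show "ennreal (\<bar>d\<bar> * z powr (d - 1)) * ennreal ((z powr d) powr (p - 1) * exp (- (u * z powr d))) * indicator {0<..} z
       = ennreal d * (ennreal (z powr (d * p - 1) * exp (- (u * z powr d))) * indicator {0<..} z)"
    proof (cases "z > 0")
      case True
      have "z powr (d - 1) * (z powr d) powr (p - 1) = z powr (d * p - 1)"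
        by (simp add: powr_powr powr_add[symmetric] algebra_simps)
      then have "(\<bar>d\<bar> * z powr (d - 1)) * ((z powr d) powr (p - 1) * exp (- (u * z powr d))) = d * (z powr (d * p - 1) * exp (- (u * z powr d)))"
        using d by (simp add: mult.assoc[symmetric])
      then show ?thesis using True d by (simp add: ennreal_mult[symmetric])
    qed simp
  qed
  also have "\<dots> = ennreal d * (\<integral>\<^sup>+z\<in>{0<..}. ennreal (z powr (d * p - 1) * exp (- (u * z powr d))) \<partial>lborel)"
    by (rule nn_integral_cmult) measurable
  finally have e: "ennreal (Gamma p * u powr (- p)) = ennreal d * (\<integral>\<^sup>+z\<in>{0<..}. ennreal (z powr (d * p - 1) * exp (- (u * z powr d))) \<partial>lborel)" .
  have "ennreal (Gamma p / d * u powr (- p)) = ennreal (1 / d) * ennreal (Gamma p * u powr (- p))"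
    using d Gamma_real_pos[OF p] by (simp add: ennreal_mult[symmetric])
  also have "\<dots> = (\<integral>\<^sup>+z\<in>{0<..}. ennreal (z powr (d * p - 1) * exp (- (u * z powr d))) \<partial>lborel)"
    unfolding e using d by (simp add: mult.assoc[symmetric] ennreal_mult[symmetric])
  finally show ?thesis by simp
qed

text \<open>
  Euler's beta integral: write \<open>(1 + z\<^sup>d)\<^bsup>-(p + q)\<^esup>\<close> as a Gamma integral over \<open>u\<close> and integrate over \<open>z\<close>
  first.
\<close>

lemma mellin_prabhakar_transform:
  fixes d lam p q :: real
  assumes d: "d > 0" and p: "p > 0" and q: "q > 0"
  shows "(\<integral>\<^sup>+z\<in>{0<..}. ennreal (z powr (lam + d * p - 1) * prabhakar_transform (p + q) d lam z) \<partial>lborel)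
       = ennreal (Gamma p * Gamma q / (d * Gamma (p + q)))"
proof -
  have pq: "p + q > 0" using p q by simp
  have Gpq: "Gamma (p + q) > 0" "Gamma p > 0" "Gamma q > 0" using p q by (auto intro: Gamma_real_pos)
  define F where "F = (\<lambda>z u::real. ennreal (z powr (d * p - 1) * (u powr (p + q - 1) * exp (- ((1 + z powr d) * u)))) * indicator {0<..} u * indicator {0<..} z)"
  have Fm: "(\<lambda>(z, u). F z u) \<in> borel_measurable (lborel \<Otimes>\<^sub>M lborel)" unfolding F_def by measurable
  have 1: "(\<integral>\<^sup>+u. F z u \<partial>lborel) = ennreal (Gamma (p + q)) * (ennreal (z powr (lam + d * p - 1) * prabhakar_transform (p + q) d lam z) * indicator {0<..} z)" for z
  proof (cases "z > 0")
    case True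
    have "(\<integral>\<^sup>+u. F z u \<partial>lborel) = (\<integral>\<^sup>+u. ennreal (z powr (d * p - 1)) * (ennreal (u powr (p + q - 1) * exp (- ((1 + z powr d) * u))) * indicator {0<..} u) \<partial>lborel)"
      by (intro nn_integral_cong) (use True in \<open>simp add: F_def ennreal_mult mult.assoc\<close>)
    also have "\<dots> = ennreal (z powr (d * p - 1)) * (\<integral>\<^sup>+u\<in>{0<..}. ennreal (u powr (p + q - 1) * exp (- ((1 + z powr d) * u))) \<partial>lborel)"
      by (rule nn_integral_cmult) measurable
    also have "\<dots> = ennreal (z powr (d * p - 1)) * ennreal (Gamma (p + q) * (1 + z powr d) powr (- (p + q)))"
      by (subst nn_integral_Gamma[OF pq]) (auto simp: add_pos_nonneg)
    also have "\<dots> = ennreal (Gamma (p + q) * (z powr (d * p - 1) * (1 + z powr d) powr (- (p + q))))"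
      using Gpq by (simp add: ennreal_mult[symmetric] mult_ac)
    also have "z powr (d * p - 1) * (1 + z powr d) powr (- (p + q)) = z powr (lam + d * p - 1) * prabhakar_transform (p + q) d lam z"
      using True by (simp add: prabhakar_transform_def mult.assoc[symmetric] powr_add[symmetric])
    finally show ?thesis using True Gpq by (simp add: ennreal_mult[symmetric] prabhakar_transform_nonneg)
  qed (simp add: F_def)
  have 2: "(\<integral>\<^sup>+z. F z u \<partial>lborel) = ennreal (Gamma p / d) * (ennreal (u powr (q - 1) * exp (- (1 * u))) * indicator {0<..} u)" for u
  proof (cases "u > 0")
    case True
    have "(\<integral>\<^sup>+z. F z u \<partial>lborel) = (\<integral>\<^sup>+z. ennreal (u powr (p + q - 1) * exp (- u)) * (ennreal (z powr (d * p - 1) * exp (- (u * z powr d))) * indicator {0<..} z) \<partial>lborel)"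
    proof (intro nn_integral_cong)
      fix z :: real
      have "z powr (d * p - 1) * (u powr (p + q - 1) * exp (- ((1 + z powr d) * u)))
          = (u powr (p + q - 1) * exp (- u)) * (z powr (d * p - 1) * exp (- (u * z powr d)))"
      proof -
        have "exp (- ((1 + z powr d) * u)) = exp (- u) * exp (- (u * z powr d))"
          by (simp add: exp_add[symmetric] algebra_simps)
        then show ?thesis by (simp only: mult_ac)
      qed
      then show "F z u = ennreal (u powr (p + q - 1) * exp (- u)) * (ennreal (z powr (d * p - 1) * exp (- (u * z powr d))) * indicator {0<..} z)"
        using True by (cases "z > 0") (simp_all add: F_def ennreal_mult[symmetric])
    qed
    also have "\<dots> = ennreal (u powr (p + q - 1) * exp (- u)) * (\<integral>\<^sup>+z\<in>{0<..}. ennreal (z powr (d * p - 1) * exp (- (u * z powr d))) \<partial>lborel)"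
      by (rule nn_integral_cmult) measurable
    also have "\<dots> = ennreal ((u powr (p + q - 1) * exp (- u)) * (Gamma p / d * u powr (- p)))"
      unfolding nn_integral_powr_exp_powr[OF d p True] using Gpq d by (intro ennreal_mult[symmetric]) auto
    also have "(u powr (p + q - 1) * exp (- u)) * (Gamma p / d * u powr (- p)) = Gamma p / d * (u powr (q - 1) * exp (- (1 * u)))"
    proof -
      have "u powr (p + q - 1) * u powr (- p) = u powr (q - 1)" by (simp add: powr_add[symmetric])
      then show ?thesis by (simp add: mult_ac)
    qed
    finally show ?thesis using True Gpq d by (simp add: ennreal_mult[symmetric])
  qed (simp add: F_def)
  have "ennreal (Gamma (p + q)) * (\<integral>\<^sup>+z\<in>{0<..}. ennreal (z powr (lam + d * p - 1) * prabhakar_transform (p + q) d lam z) \<partial>lborel)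
     = (\<integral>\<^sup>+z. ennreal (Gamma (p + q)) * (ennreal (z powr (lam + d * p - 1) * prabhakar_transform (p + q) d lam z) * indicator {0<..} z) \<partial>lborel)"
    by (rule nn_integral_cmult[symmetric]) (simp add: prabhakar_transform_def)
  also have "\<dots> = (\<integral>\<^sup>+z. (\<integral>\<^sup>+u. F z u \<partial>lborel) \<partial>lborel)" unfolding 1 ..
  also have "\<dots> = (\<integral>\<^sup>+u. (\<integral>\<^sup>+z. F z u \<partial>lborel) \<partial>lborel)"
    by (rule lborel_pair.Fubini'[OF Fm, symmetric])
  also have "\<dots> = ennreal (Gamma p / d) * (\<integral>\<^sup>+u\<in>{0<..}. ennreal (u powr (q - 1) * exp (- (1 * u))) \<partial>lborel)"
    unfolding 2 by (rule nn_integral_cmult) measurable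
  also have "\<dots> = ennreal (Gamma p / d * Gamma q)"
    by (subst nn_integral_Gamma[OF q]) (use Gpq d in \<open>simp_all add: ennreal_mult[symmetric]\<close>)
  finally have e: "ennreal (Gamma (p + q)) * (\<integral>\<^sup>+z\<in>{0<..}. ennreal (z powr (lam + d * p - 1) * prabhakar_transform (p + q) d lam z) \<partial>lborel)
     = ennreal (Gamma p / d * Gamma q)" .
  have "(\<integral>\<^sup>+z\<in>{0<..}. ennreal (z powr (lam + d * p - 1) * prabhakar_transform (p + q) d lam z) \<partial>lborel)
     = ennreal (1 / Gamma (p + q)) * (ennreal (Gamma (p + q)) * (\<integral>\<^sup>+z\<in>{0<..}. ennreal (z powr (lam + d * p - 1) * prabhakar_transform (p + q) d lam z) \<partial>lborel))"
    using Gpq by (simp add: mult.assoc[symmetric] ennreal_mult[symmetric])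
  also have "\<dots> = ennreal (Gamma p * Gamma q / (d * Gamma (p + q)))"
    unfolding e using Gpq d by (simp add: ennreal_mult[symmetric])
  finally show ?thesis .
qed

section \<open>From a nonnegative kernel to the random variable\<close>

text \<open>
  Multiplying \<open>H\<close> by \<open>z\<^bsup>w-1\<^esup>\<close> and integrating, once through the Laplace representation and once
  directly, gives the negative moments of \<open>h\<close>; the Gamma factor \<open>\<Gamma> w\<close> with \<open>w = c + d s\<close> that appears
  on one side is the denominator in the moments of \<open>X\<close>.  The density of \<open>X\<close> is that of \<open>t\<^bsup>-d\<^esup>\<close> under
  the measure with density \<open>h\<close>, weighted by a power.  The condition \<open>a d \<le> c\<close> keeps \<open>w\<close> positive on the whole strip.
\<close>

lemma X_exists_of_laplace:
  fixes a b c d :: real and h :: "real \<Rightarrow> real"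
  assumes pos: "a > 0" "b > 0" "c > 0" "d > 0" and lam: "c \<ge> a * d"
    and hm [measurable]: "h \<in> borel_measurable borel" and hn: "\<And>t. t > 0 \<Longrightarrow> h t \<ge> 0"
    and rep: "laplace_represents (kernel_measure h) (\<lambda>t. t) (prabhakar_transform (a + b) d (c - a * d))"
  shows "X_exists a b c d"
proof -
  have L: "(\<integral>\<^sup>+t\<in>{0<..}. ennreal (h t) * ennreal (exp (- (z * t))) \<partial>lborel) = ennreal (prabhakar_transform (a + b) d (c - a * d) z)"
    if "z > 0" for z
    using rep that unfolding laplace_represents_def
    by (subst nn_integral_kernel_measure[symmetric]) auto
  have Gp: "Gamma (a + b) > 0" "Gamma a > 0" "Gamma b > 0" "Gamma c > 0" using pos by (auto intro: Gamma_real_pos)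
  have mom: "(\<integral>\<^sup>+t\<in>{0<..}. ennreal (h t * t powr (- (c + d * s))) \<partial>lborel)
      = ennreal (Gamma (a + s) * Gamma (b - s) * rGamma (c + d * s) / (d * Gamma (a + b)))"
    if s: "- a < s" "s < b" for s
  proof -
    define w where "w = c + d * s"
    have "d * (- a) < d * s" using pos s by (intro mult_strict_left_mono) auto
    then have w: "w > 0" using lam by (simp add: w_def algebra_simps)
    have Gw: "Gamma w > 0" "rGamma w = 1 / Gamma w" using w by (auto intro: Gamma_real_pos simp: rGamma_inverse_Gamma inverse_eq_divide)
    have Gs: "Gamma (a + s) > 0" "Gamma (b - s) > 0" using s by (auto intro: Gamma_real_pos)
    define F where "F = (\<lambda>z t::real. ennreal (z powr (w - 1)) * (ennreal (h t) * ennreal (exp (- (z * t)))) * indicator {0<..} t * indicator {0<..} z)"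
    have Fm: "(\<lambda>(z, t). F z t) \<in> borel_measurable (lborel \<Otimes>\<^sub>M lborel)" unfolding F_def by measurable
    have 1: "(\<integral>\<^sup>+t. F z t \<partial>lborel) = ennreal (z powr (w - 1) * prabhakar_transform (a + b) d (c - a * d) z) * indicator {0<..} z" for z
    proof (cases "z > 0")
      case True
      have "(\<integral>\<^sup>+t. F z t \<partial>lborel) = (\<integral>\<^sup>+t. ennreal (z powr (w - 1)) * (ennreal (h t) * ennreal (exp (- (z * t))) * indicator {0<..} t) \<partial>lborel)"
        using True by (intro nn_integral_cong) (simp add: F_def mult.assoc)
      also have "\<dots> = ennreal (z powr (w - 1)) * ennreal (prabhakar_transform (a + b) d (c - a * d) z)"
        unfolding L[OF True, symmetric] by (rule nn_integral_cmult) measurable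
      finally show ?thesis using True by (simp add: ennreal_mult prabhakar_transform_nonneg)
    qed (simp add: F_def)
    have 2: "(\<integral>\<^sup>+z. F z t \<partial>lborel) = ennreal (Gamma w) * (ennreal (h t * t powr (- w)) * indicator {0<..} t)" for t
    proof (cases "t > 0")
      case True
      have "(\<integral>\<^sup>+z. F z t \<partial>lborel) = (\<integral>\<^sup>+z. ennreal (h t) * (ennreal (z powr (w - 1) * exp (- (t * z))) * indicator {0<..} z) \<partial>lborel)"
        using True by (intro nn_integral_cong) (simp add: F_def ennreal_mult mult_ac)
      also have "\<dots> = ennreal (h t) * (\<integral>\<^sup>+z\<in>{0<..}. ennreal (z powr (w - 1) * exp (- (t * z))) \<partial>lborel)"
        by (rule nn_integral_cmult) measurable
      also have "\<dots> = ennreal (h t) * ennreal (Gamma w * t powr (- w))"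
        by (subst nn_integral_Gamma[OF w True]) simp
      finally show ?thesis using True hn[OF True] Gw by (simp add: ennreal_mult[symmetric] mult_ac)
    qed (simp add: F_def)
    have "ennreal (Gamma w) * (\<integral>\<^sup>+t\<in>{0<..}. ennreal (h t * t powr (- w)) \<partial>lborel) = (\<integral>\<^sup>+t. (\<integral>\<^sup>+z. F z t \<partial>lborel) \<partial>lborel)"
      unfolding 2 by (rule nn_integral_cmult[symmetric]) measurable
    also have "\<dots> = (\<integral>\<^sup>+z. (\<integral>\<^sup>+t. F z t \<partial>lborel) \<partial>lborel)"
      by (rule lborel_pair.Fubini'[OF Fm])
    also have "\<dots> = (\<integral>\<^sup>+z\<in>{0<..}. ennreal (z powr ((c - a * d) + d * (a + s) - 1) * prabhakar_transform ((a + s) + (b - s)) d (c - a * d) z) \<partial>lborel)"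
      unfolding 1 by (simp add: w_def algebra_simps)
    also have "\<dots> = ennreal (Gamma (a + s) * Gamma (b - s) / (d * Gamma ((a + s) + (b - s))))"
      using s pos by (intro mellin_prabhakar_transform) auto
    finally have e: "ennreal (Gamma w) * (\<integral>\<^sup>+t\<in>{0<..}. ennreal (h t * t powr (- w)) \<partial>lborel)
       = ennreal (Gamma (a + s) * Gamma (b - s) / (d * Gamma (a + b)))" by simp
    have "(\<integral>\<^sup>+t\<in>{0<..}. ennreal (h t * t powr (- w)) \<partial>lborel)
       = ennreal (1 / Gamma w) * (ennreal (Gamma w) * (\<integral>\<^sup>+t\<in>{0<..}. ennreal (h t * t powr (- w)) \<partial>lborel))"
      using Gw by (simp add: mult.assoc[symmetric] ennreal_mult[symmetric])
    also have "\<dots> = ennreal (Gamma (a + s) * Gamma (b - s) * rGamma w / (d * Gamma (a + b)))"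
      unfolding e using Gw Gs Gp pos by (simp add: ennreal_mult[symmetric])
    finally show ?thesis by (simp add: w_def)
  qed
  \<comment> \<open>The change of variables \<open>t = x\<^bsup>-1/d\<^esup>\<close>.\<close>
  define q where "q = - 1 / d"
  have q: "q \<noteq> 0" "\<bar>q\<bar> = 1 / d" using pos by (auto simp: q_def)
  define C where "C = Gamma c * Gamma (a + b) / (Gamma a * Gamma b)"
  have C: "C > 0" using Gp by (simp add: C_def)
  define g where "g = (\<lambda>x. C * (x powr (c / d + q - 1) * h (x powr q)))"
  have gm [measurable]: "g \<in> borel_measurable borel" unfolding g_def by measurable
  have gn: "g x \<ge> 0" if "x > 0" for x using that C hn[of "x powr q"] by (simp add: g_def)
  have moment: "(\<integral>\<^sup>+x\<in>{0<..}. ennreal (x powr s * g x) \<partial>lborel) = ennreal (X_moment a b c d s)" if s: "- a < s" "s < b" for s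
  proof -
    have "(\<integral>\<^sup>+t\<in>{0<..}. ennreal (h t * t powr (- (c + d * s))) \<partial>lborel)
       = (\<integral>\<^sup>+x\<in>{0<..}. ennreal (\<bar>q\<bar> * x powr (q - 1)) * ennreal (h (x powr q) * (x powr q) powr (- (c + d * s))) \<partial>lborel)"
      by (rule nn_integral_powr_substitution) (use q in auto)
    also have "\<dots> = (\<integral>\<^sup>+x. ennreal (1 / (d * C)) * (ennreal (x powr s * g x) * indicator {0<..} x) \<partial>lborel)"
    proof (intro nn_integral_cong)
      fix x :: real
      show "ennreal (\<bar>q\<bar> * x powr (q - 1)) * ennreal (h (x powr q) * (x powr q) powr (- (c + d * s))) * indicator {0<..} x
         = ennreal (1 / (d * C)) * (ennreal (x powr s * g x) * indicator {0<..} x)"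
      proof (cases "x > 0")
        case True
        have "q * (- (c + d * s)) = c / d + s" using pos by (simp add: q_def field_simps)
        then have "x powr (q - 1) * (x powr q) powr (- (c + d * s)) = x powr (q - 1) * x powr (c / d + s)"
          by (simp only: powr_powr)
        also have "\<dots> = x powr s * x powr (c / d + q - 1)" by (simp add: powr_add[symmetric] algebra_simps)
        finally have e: "x powr (q - 1) * (x powr q) powr (- (c + d * s)) = x powr s * x powr (c / d + q - 1)" .
        have "(\<bar>q\<bar> * x powr (q - 1)) * (h (x powr q) * (x powr q) powr (- (c + d * s)))
           = (1 / d) * h (x powr q) * (x powr (q - 1) * (x powr q) powr (- (c + d * s)))" unfolding q(2) by (simp only: mult_ac)
        also have "\<dots> = 1 / (d * C) * (x powr s * g x)" unfolding e using C by (simp add: g_def)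
        finally have "(\<bar>q\<bar> * x powr (q - 1)) * (h (x powr q) * (x powr q) powr (- (c + d * s))) = 1 / (d * C) * (x powr s * g x)" .
        moreover have "h (x powr q) \<ge> 0" using True by (intro hn) simp
        ultimately show ?thesis using True gn[OF True] pos C by (simp add: ennreal_mult[symmetric])
      qed simp
    qed
    also have "\<dots> = ennreal (1 / (d * C)) * (\<integral>\<^sup>+x\<in>{0<..}. ennreal (x powr s * g x) \<partial>lborel)"
      by (rule nn_integral_cmult) measurable
    finally have e: "ennreal (Gamma (a + s) * Gamma (b - s) * rGamma (c + d * s) / (d * Gamma (a + b)))
       = ennreal (1 / (d * C)) * (\<integral>\<^sup>+x\<in>{0<..}. ennreal (x powr s * g x) \<partial>lborel)"
      unfolding mom[OF s] .
    have "(\<integral>\<^sup>+x\<in>{0<..}. ennreal (x powr s * g x) \<partial>lborel)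
        = ennreal (d * C) * (ennreal (1 / (d * C)) * (\<integral>\<^sup>+x\<in>{0<..}. ennreal (x powr s * g x) \<partial>lborel))"
      using pos C by (simp add: mult.assoc[symmetric] ennreal_mult[symmetric])
    also have "\<dots> = ennreal (d * C * (Gamma (a + s) * Gamma (b - s) * rGamma (c + d * s) / (d * Gamma (a + b))))"
      unfolding e[symmetric] using pos C by (intro ennreal_mult'[symmetric]) auto
    also have "d * C * (Gamma (a + s) * Gamma (b - s) * rGamma (c + d * s) / (d * Gamma (a + b))) = X_moment a b c d s"
    proof -
      have "d * (x * y / v) * (w / (d * y)) = x / v * w" if "d \<noteq> 0" "y \<noteq> 0" for x y v w :: real
        using that by simp
      moreover have "Gamma (a + b) \<noteq> 0" using Gp(1) by (metis less_irrefl)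
      ultimately show ?thesis unfolding C_def X_moment_def using pos(4) by (metis less_irrefl)
    qed
    finally show ?thesis .
  qed
  have Xpos: "X_moment a b c d s \<ge> 0" if s: "- a < s" "s < b" for s
  proof -
    have "d * (- a) < d * s" using pos s by (intro mult_strict_left_mono) auto
    then have "c + d * s > 0" using lam by (simp add: algebra_simps)
    then have "rGamma (c + d * s) > 0" by (simp add: rGamma_inverse_Gamma Gamma_real_pos)
    moreover have "Gamma (a + s) > 0" "Gamma (b - s) > 0" using s by (auto intro: Gamma_real_pos)
    ultimately show ?thesis using Gp by (simp add: X_moment_def)
  qed
  show ?thesis unfolding X_exists_def
  proof (intro exI[of _ g] conjI allI impI)
    show "0 \<le> g x" if "0 < x" for x using gn[OF that] .
    fix s assume s: "- a < s \<and> s < b"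
    have "has_bochner_integral lborel (\<lambda>x. indicator {0<..} x *\<^sub>R (x powr s * g x)) (X_moment a b c d s)"
    proof (rule has_bochner_integral_nn_integral)
      show "AE x in lborel. 0 \<le> indicator {0<..} x *\<^sub>R (x powr s * g x)"
        using gn by (auto simp: indicator_def)
      have "(\<integral>\<^sup>+x. ennreal (indicator {0<..} x *\<^sub>R (x powr s * g x)) \<partial>lborel) = (\<integral>\<^sup>+x\<in>{0<..}. ennreal (x powr s * g x) \<partial>lborel)"
        by (intro nn_integral_cong) (simp add: indicator_def)
      then show "(\<integral>\<^sup>+x. ennreal (indicator {0<..} x *\<^sub>R (x powr s * g x)) \<partial>lborel) = ennreal (X_moment a b c d s)"
        using moment s by simp
    qed (use Xpos s in auto)
    then show "set_integrable lborel {0<..} (\<lambda>x. x powr s * g x)" "(LBINT x:{0<..}. x powr s * g x) = X_moment a b c d s"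
      by (auto simp: has_bochner_integral_iff set_integrable_def set_lebesgue_integral_def)
  qed
qed

lemma laplace_represents_prabhakar_kernel:
  fixes g d lam :: real
  assumes g: "g > 0" and d: "0 < d" "d \<le> 2" and mu: "lam + d * g > 0"
    and nn: "\<And>t. t > 0 \<Longrightarrow> prabhakar_kernel g d (lam + d * g) t \<ge> 0"
  shows "laplace_represents (kernel_measure (prabhakar_kernel g d (lam + d * g))) (\<lambda>t. t) (prabhakar_transform g d lam)"
proof (rule laplace_represents_extend[OF d])
  show "(\<lambda>t. t) \<in> borel_measurable (kernel_measure (prabhakar_kernel g d (lam + d * g)))" by measurable
  show "AE t in kernel_measure (prabhakar_kernel g d (lam + d * g)). 0 \<le> t"
    using AE_kernel_measure_pos[OF borel_measurable_prabhakar_kernel] by eventually_elim simp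
  show "(\<integral>\<^sup>+t. ennreal (exp (- (z * t))) \<partial>kernel_measure (prabhakar_kernel g d (lam + d * g))) = ennreal (prabhakar_transform g d lam z)"
    if "z > 1" for z
    by (rule prabhakar_kernel_laplace[OF g d(1) mu that nn])
qed

theorem X_exists_of_prabhakar_kernel_nonneg:
  fixes a b c d :: real
  assumes pos: "a > 0" "b > 0" "c > 0" "0 < d" "d \<le> 2" and lam: "c \<ge> a * d"
    and nn: "\<And>t. t > 0 \<Longrightarrow> prabhakar_kernel (a + b) d (c - a * d + d * (a + b)) t \<ge> 0"
  shows "X_exists a b c d"
proof (rule X_exists_of_laplace[OF pos(1-4) lam borel_measurable_prabhakar_kernel nn])
  have "d * (a + b) > 0" using pos by simp
  then have "c - a * d + d * (a + b) > 0" using lam by linarith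
  then show "laplace_represents (kernel_measure (prabhakar_kernel (a + b) d (c - a * d + d * (a + b)))) (\<lambda>t. t) (prabhakar_transform (a + b) d (c - a * d))"
    using pos lam by (intro laplace_represents_prabhakar_kernel nn) auto
qed

section \<open>Lowering the index\<close>

text \<open>
  A mixture over scalings: \<open>(1 + y)\<^bsup>-g'\<^esup>\<close> is the average of \<open>(1 + y v)\<^bsup>-g\<^esup>\<close> over a Beta distributed \<open>v\<close>.
  The substitution \<open>v = r / (1 + r)\<close> turns this into \<open>\<integral> r\<^bsup>g'-1\<^esup> (1 + (1 + y) r)\<^bsup>-g\<^esup> dr\<close>, which scales to a
  beta integral.
\<close>

lemma laplace_represents_decrease_index:
  fixes g g' d lam :: real and h :: "real \<Rightarrow> real"
  assumes g: "0 < g'" "g' < g" and d: "d > 0"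
    and hm [measurable]: "h \<in> borel_measurable borel"
    and rep: "laplace_represents (kernel_measure h) (\<lambda>t. t) (prabhakar_transform g d lam)"
  shows "\<exists>(M :: (real \<times> real) measure) \<tau>. laplace_represents M \<tau> (prabhakar_transform g' d lam)"
proof -
  define q where "q = g - g'"
  have q: "q > 0" "g = g' + q" using g by (auto simp: q_def)
  define B where "B = Gamma g' * Gamma q / Gamma g"
  have B: "B > 0" using g q Gamma_real_pos[of g'] Gamma_real_pos[of q] Gamma_real_pos[of g] by (simp add: B_def)
  define u where "u = (\<lambda>r::real. (r / (1 + r)) powr (1 / d))"
  define wt where "wt = (\<lambda>r::real. r powr (g' - 1) * (1 + r) powr (- g) * u r powr lam / B)"
  define M where "M = density (lborel \<Otimes>\<^sub>M lborel) (\<lambda>(r, t). ennreal (wt r) * indicator {0<..} r * (ennreal (h t) * indicator {0<..} t))"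
  define \<tau> where "\<tau> = (\<lambda>(r, t). u r * t :: real)"
  have [measurable]: "u \<in> borel_measurable borel" "wt \<in> borel_measurable borel" unfolding u_def wt_def by measurable
  have tm [measurable]: "\<tau> \<in> borel_measurable (lborel \<Otimes>\<^sub>M lborel)" unfolding \<tau>_def by measurable
  have tM: "\<tau> \<in> borel_measurable M" unfolding M_def by measurable
  have up: "u r > 0" "u r powr d = r / (1 + r)" if "r > 0" for r using that d by (auto simp: u_def powr_powr)
  have L: "(\<integral>\<^sup>+t\<in>{0<..}. ennreal (h t) * ennreal (exp (- (z * t))) \<partial>lborel) = ennreal (prabhakar_transform g d lam z)"
    if "z > 0" for z
    using rep that unfolding laplace_represents_def
    by (subst nn_integral_kernel_measure[symmetric]) auto
  have "(\<integral>\<^sup>+p. ennreal (exp (- (z * \<tau> p))) \<partial>M) = ennreal (prabhakar_transform g' d lam z)" if z: "z > 0" for z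
  proof -
    define s where "s = 1 + z powr d"
    have s: "s > 0" by (simp add: s_def add_pos_nonneg)
    have key: "wt r * prabhakar_transform g d lam (z * u r) = z powr (- lam) * s powr (- g') / B * (s * ((s * r) powr (g' - 1) * (1 + s * r) powr (- g)))"
      if r: "r > 0" for r
    proof -
      have "(z * u r) powr d = z powr d * (r / (1 + r))" using z up[OF r] by (simp add: powr_mult)
      moreover have "1 + z powr d * (r / (1 + r)) = (1 + s * r) / (1 + r)" using r by (simp add: s_def field_simps)
      moreover have "((1 + s * r) / (1 + r)) powr (- g) = (1 + s * r) powr (- g) * (1 + r) powr g"
      proof -
        have q: "(x / y) powr (- g) = x powr (- g) * y powr g" if "x > 0" "y > 0" for x y :: real
          using that by (simp add: powr_divide powr_minus field_simps)
        show ?thesis by (rule q) (use r s in \<open>auto intro: add_pos_pos\<close>)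
      qed
      moreover have "(z * u r) powr (- lam) = z powr (- lam) * u r powr (- lam)" using z up[OF r] by (simp add: powr_mult)
      ultimately have "prabhakar_transform g d lam (z * u r) = z powr (- lam) * u r powr (- lam) * ((1 + s * r) powr (- g) * (1 + r) powr g)"
        unfolding prabhakar_transform_def by (simp only:)
      then have "wt r * prabhakar_transform g d lam (z * u r)
         = (u r powr lam * u r powr (- lam)) * ((1 + r) powr (- g) * (1 + r) powr g) * (z powr (- lam) / B * (r powr (g' - 1) * (1 + s * r) powr (- g)))"
        by (simp add: wt_def)
      also have "u r powr lam * u r powr (- lam) = 1" using up[OF r] by (simp add: powr_add[symmetric])
      also have "(1 + r) powr (- g) * (1 + r) powr g = 1" using r by (simp add: powr_add[symmetric])
      also have "r powr (g' - 1) = s powr (- g') * (s * (s * r) powr (g' - 1))"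
      proof -
        have "s powr (- g') * (s powr 1 * (s * r) powr (g' - 1)) = s powr (- g') * s powr 1 * s powr (g' - 1) * r powr (g' - 1)"
          using s r by (simp add: powr_mult)
        also have "\<dots> = r powr (g' - 1)" unfolding powr_add[symmetric] using s by simp
        finally show ?thesis using s by simp
      qed
      finally show ?thesis by (simp add: mult_ac)
    qed
    have "(\<integral>\<^sup>+p. ennreal (exp (- (z * \<tau> p))) \<partial>M)
      = (\<integral>\<^sup>+p. (case p of (r, t) \<Rightarrow> ennreal (wt r) * indicator {0<..} r * (ennreal (h t) * indicator {0<..} t)) * ennreal (exp (- (z * \<tau> p))) \<partial>(lborel \<Otimes>\<^sub>M lborel))"
      unfolding M_def by (rule nn_integral_density) measurable
    also have "\<dots> = (\<integral>\<^sup>+r. \<integral>\<^sup>+t. (ennreal (wt r) * indicator {0<..} r * (ennreal (h t) * indicator {0<..} t)) * ennreal (exp (- (z * (u r * t)))) \<partial>lborel \<partial>lborel)"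
      by (subst lborel.nn_integral_fst[symmetric]) (auto simp: \<tau>_def)
    also have "\<dots> = (\<integral>\<^sup>+r. ennreal (z powr (- lam) * s powr (- g') / B) * (ennreal s * (ennreal ((0 + s * r) powr (g' - 1) * (1 + (0 + s * r)) powr (- g)) * indicator {0<..} (0 + s * r))) \<partial>lborel)"
    proof (intro nn_integral_cong)
      fix r :: real
      show "(\<integral>\<^sup>+t. (ennreal (wt r) * indicator {0<..} r * (ennreal (h t) * indicator {0<..} t)) * ennreal (exp (- (z * (u r * t)))) \<partial>lborel)
        = ennreal (z powr (- lam) * s powr (- g') / B) * (ennreal s * (ennreal ((0 + s * r) powr (g' - 1) * (1 + (0 + s * r)) powr (- g)) * indicator {0<..} (0 + s * r)))"
      proof (cases "r > 0")
        case True
        have "(\<integral>\<^sup>+t. (ennreal (wt r) * indicator {0<..} r * (ennreal (h t) * indicator {0<..} t)) * ennreal (exp (- (z * (u r * t)))) \<partial>lborel)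
          = (\<integral>\<^sup>+t. ennreal (wt r) * (ennreal (h t) * ennreal (exp (- (z * u r * t))) * indicator {0<..} t) \<partial>lborel)"
          using True by (intro nn_integral_cong) (simp add: mult_ac)
        also have "\<dots> = ennreal (wt r) * ennreal (prabhakar_transform g d lam (z * u r))"
          unfolding L[OF mult_pos_pos[OF z up(1)[OF True]], symmetric] by (rule nn_integral_cmult) measurable
        also have "\<dots> = ennreal (wt r * prabhakar_transform g d lam (z * u r))"
          using B by (intro ennreal_mult[symmetric] prabhakar_transform_nonneg) (auto simp: wt_def)
        finally show ?thesis unfolding key[OF True] using True s B by (simp add: ennreal_mult[symmetric])
      next
        case False
        then have "\<not> 0 < s * r" using s by (simp add: zero_less_mult_iff)
        then show ?thesis using False by simp
      qed
    qed
    also have "\<dots> = ennreal (z powr (- lam) * s powr (- g') / B) * (ennreal \<bar>s\<bar> * (\<integral>\<^sup>+r. ennreal ((0 + s * r) powr (g' - 1) * (1 + (0 + s * r)) powr (- g)) * indicator {0<..} (0 + s * r) \<partial>lborel))"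
      using s by (simp add: nn_integral_cmult)
    also have "ennreal \<bar>s\<bar> * (\<integral>\<^sup>+r. ennreal ((0 + s * r) powr (g' - 1) * (1 + (0 + s * r)) powr (- g)) * indicator {0<..} (0 + s * r) \<partial>lborel)
      = (\<integral>\<^sup>+r\<in>{0<..}. ennreal (r powr (g' - 1) * (1 + r) powr (- g)) \<partial>lborel)"
      using s by (intro nn_integral_real_affine[symmetric]) auto
    also have "\<dots> = (\<integral>\<^sup>+r\<in>{0<..}. ennreal (r powr (0 + 1 * g' - 1) * prabhakar_transform (g' + q) 1 0 r) \<partial>lborel)"
      unfolding q(2) by (intro nn_integral_cong) (simp add: prabhakar_transform_def indicator_def)
    also have "\<dots> = ennreal B"
      using g q by (subst mellin_prabhakar_transform) (auto simp: B_def)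
    also have "ennreal (z powr (- lam) * s powr (- g') / B) * ennreal B = ennreal (prabhakar_transform g' d lam z)"
      using B by (simp add: ennreal_mult[symmetric] prabhakar_transform_def s_def)
    finally show ?thesis .
  qed
  moreover have "AE p in M. 0 \<le> \<tau> p"
  proof -
    have "AE p in lborel \<Otimes>\<^sub>M lborel. 0 < (case p of (r, t) \<Rightarrow> ennreal (wt r) * indicator {0<..} r * (ennreal (h t) * indicator {0<..} t)) \<longrightarrow> 0 \<le> \<tau> p"
    proof (rule AE_I2)
      fix p :: "real \<times> real"
      show "0 < (case p of (r, t) \<Rightarrow> ennreal (wt r) * indicator {0<..} r * (ennreal (h t) * indicator {0<..} t)) \<longrightarrow> 0 \<le> \<tau> p"
        by (cases p) (auto simp: \<tau>_def u_def indicator_def split: if_splits)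
    qed
    then show ?thesis unfolding M_def by (subst AE_density) auto
  qed
  ultimately show ?thesis using tM unfolding laplace_represents_def by blast
qed

section \<open>Two-sided Laplace transforms\<close>

text \<open>
  Around each point of the strip the exponential is expanded; on a disc of radius \<open>\<epsilon>\<close> the series
  is dominated by the sum of the two real exponentials at distance \<open>\<epsilon>\<close> to either side.
\<close>

theorem holomorphic_two_sided_laplace:
  fixes M :: "'w measure" and \<tau> :: "'w \<Rightarrow> real" and \<alpha> \<beta> :: real
  assumes [measurable]: "\<tau> \<in> borel_measurable M"
    and fin: "\<And>s. \<alpha> < s \<Longrightarrow> s < \<beta> \<Longrightarrow> (\<integral>\<^sup>+w. ennreal (exp (s * \<tau> w)) \<partial>M) < \<infinity>"
  shows "(\<lambda>\<zeta>. \<integral>w. exp (\<zeta> * complex_of_real (\<tau> w)) \<partial>M) holomorphic_on {\<zeta>. \<alpha> < Re \<zeta> \<and> Re \<zeta> < \<beta>}"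
proof -
  define F where "F = (\<lambda>\<zeta>. \<integral>w. exp (\<zeta> * complex_of_real (\<tau> w)) \<partial>M)"
  have int: "integrable M (\<lambda>w. exp (s * \<tau> w))" if "\<alpha> < s" "s < \<beta>" for s
    using fin[OF that] by (intro integrableI_bounded) auto
  have "F field_differentiable (at \<zeta>0)" if z0: "\<alpha> < Re \<zeta>0" "Re \<zeta>0 < \<beta>" for \<zeta>0
  proof -
    define \<epsilon> where "\<epsilon> = min (Re \<zeta>0 - \<alpha>) (\<beta> - Re \<zeta>0) / 2"
    have e: "\<epsilon> > 0" "\<alpha> < Re \<zeta>0 - \<epsilon>" "Re \<zeta>0 + \<epsilon> < \<beta>" "\<alpha> < Re \<zeta>0 + \<epsilon>" "Re \<zeta>0 - \<epsilon> < \<beta>"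
      using z0 by (auto simp: \<epsilon>_def min_def field_simps)
    define G where "G = (\<lambda>w. exp ((Re \<zeta>0 + \<epsilon>) * \<tau> w) + exp ((Re \<zeta>0 - \<epsilon>) * \<tau> w))"
    have G: "integrable M G" unfolding G_def by (intro Bochner_Integration.integrable_add int e)
    define a where "a = (\<lambda>n. \<integral>w. exp (\<zeta>0 * complex_of_real (\<tau> w)) * (complex_of_real (\<tau> w) ^ n / fact n) \<partial>M)"
    have "(\<lambda>n. a n * (\<zeta> - \<zeta>0) ^ n) sums F \<zeta>" if z: "\<zeta> \<in> ball \<zeta>0 \<epsilon>" for \<zeta>
    proof -
      define f where "f = (\<lambda>n w. exp (\<zeta>0 * complex_of_real (\<tau> w)) * ((complex_of_real (\<tau> w) * (\<zeta> - \<zeta>0)) ^ n / fact n))"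
      have [measurable]: "f n \<in> borel_measurable M" for n unfolding f_def by measurable
      define \<delta> where "\<delta> = norm (\<zeta> - \<zeta>0)"
      have \<delta>: "0 \<le> \<delta>" "\<delta> < \<epsilon>" using z by (auto simp: \<delta>_def dist_norm norm_minus_commute)
      have nf: "norm (f n w) = exp (Re \<zeta>0 * \<tau> w) * ((\<bar>\<tau> w\<bar> * \<delta>) ^ n / fact n)" for n w
        by (simp add: f_def norm_mult norm_divide norm_power \<delta>_def)
      have exs: "(\<lambda>n. (y :: real) ^ n / fact n) sums exp y" for y
        using exp_converges[of y] by (simp add: field_simps)
      have nfs: "(\<lambda>n. norm (f n w)) sums (exp (Re \<zeta>0 * \<tau> w) * exp (\<bar>\<tau> w\<bar> * \<delta>))" for w
        unfolding nf by (intro sums_mult exs)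
      have bound: "exp (Re \<zeta>0 * \<tau> w) * exp (\<bar>\<tau> w\<bar> * \<delta>) \<le> G w" for w
      proof -
        have "\<bar>\<tau> w\<bar> * \<delta> \<le> \<bar>\<tau> w\<bar> * \<epsilon>" using \<delta> by (intro mult_left_mono) auto
        then have "exp (Re \<zeta>0 * \<tau> w) * exp (\<bar>\<tau> w\<bar> * \<delta>) \<le> exp (Re \<zeta>0 * \<tau> w + \<bar>\<tau> w\<bar> * \<epsilon>)"
          by (simp add: exp_add[symmetric])
        also have "\<dots> \<le> G w"
        proof (cases "\<tau> w \<ge> 0")
          case True
          then have "Re \<zeta>0 * \<tau> w + \<bar>\<tau> w\<bar> * \<epsilon> = (Re \<zeta>0 + \<epsilon>) * \<tau> w" by (simp add: algebra_simps)
          then show ?thesis by (simp add: G_def)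
        next
          case False
          then have "Re \<zeta>0 * \<tau> w + \<bar>\<tau> w\<bar> * \<epsilon> = (Re \<zeta>0 - \<epsilon>) * \<tau> w" by (simp add: algebra_simps)
          then show ?thesis by (simp add: G_def)
        qed
        finally show ?thesis .
      qed
      have fG: "norm (f n w) \<le> G w" for n w
      proof -
        have "(\<Sum>i\<in>{n}. norm (f i w)) \<le> (\<Sum>i. norm (f i w))"
          by (rule sum_le_suminf[OF sums_summable[OF nfs]]) auto
        then show ?thesis using sums_unique[OF nfs[of w]] bound[of w] by simp
      qed
      have fi: "integrable M (f n)" for n
        by (rule Bochner_Integration.integrable_bound[OF G]) (use fG in \<open>auto intro!: AE_I2 order_trans[OF fG abs_ge_self]\<close>)
      have sumn: "summable (\<lambda>n. \<integral>w. norm (f n w) \<partial>M)"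
      proof (rule summableI_nonneg_bounded)
        fix N
        have "(\<Sum>n<N. \<integral>w. norm (f n w) \<partial>M) = (\<integral>w. (\<Sum>n<N. norm (f n w)) \<partial>M)"
          using fi by (intro Bochner_Integration.integral_sum[symmetric] integrable_norm)
        also have "\<dots> \<le> (\<integral>w. G w \<partial>M)"
        proof (rule integral_mono)
          show "integrable M (\<lambda>w. \<Sum>n<N. norm (f n w))" using fi by (intro Bochner_Integration.integrable_sum integrable_norm)
          fix w
          have "(\<Sum>n<N. norm (f n w)) \<le> (\<Sum>n. norm (f n w))"
            by (rule sum_le_suminf[OF sums_summable[OF nfs]]) auto
          then show "(\<Sum>n<N. norm (f n w)) \<le> G w" using sums_unique[OF nfs[of w]] bound[of w] by simp
        qed (rule G)
        finally show "(\<Sum>n<N. \<integral>w. norm (f n w) \<partial>M) \<le> (\<integral>w. G w \<partial>M)" .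
      qed simp
      have "(\<lambda>n. \<integral>w. f n w \<partial>M) sums (\<integral>w. (\<Sum>n. f n w) \<partial>M)"
        by (rule sums_integral[OF fi AE_I2[OF sums_summable[OF nfs]] sumn])
      moreover have "(\<integral>w. f n w \<partial>M) = a n * (\<zeta> - \<zeta>0) ^ n" for n
      proof -
        have "(\<integral>w. f n w \<partial>M) = (\<integral>w. (exp (\<zeta>0 * complex_of_real (\<tau> w)) * (complex_of_real (\<tau> w) ^ n / fact n)) * (\<zeta> - \<zeta>0) ^ n \<partial>M)"
          by (intro Bochner_Integration.integral_cong) (simp_all add: f_def power_mult_distrib)
        also have "\<dots> = a n * (\<zeta> - \<zeta>0) ^ n" unfolding a_def by (rule integral_mult_left_zero)
        finally show ?thesis .
      qed
      moreover have "(\<Sum>n. f n w) = exp (\<zeta> * complex_of_real (\<tau> w))" for w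
      proof -
        define y where "y = complex_of_real (\<tau> w) * (\<zeta> - \<zeta>0)"
        have "(\<lambda>n. y ^ n /\<^sub>R fact n) sums exp y" by (rule exp_converges)
        moreover have "y ^ n /\<^sub>R fact n = y ^ n / fact n" for n by (simp add: scaleR_conv_of_real field_simps)
        ultimately have "(\<lambda>n. y ^ n / fact n) sums exp y" by simp
        then have "(\<lambda>n. f n w) sums (exp (\<zeta>0 * complex_of_real (\<tau> w)) * exp y)"
          unfolding f_def y_def by (rule sums_mult)
        moreover have "exp (\<zeta>0 * complex_of_real (\<tau> w)) * exp y = exp (\<zeta> * complex_of_real (\<tau> w))"
          by (simp add: exp_add[symmetric] y_def algebra_simps)
        ultimately show ?thesis by (simp add: sums_iff)
      qed
      ultimately show ?thesis by (simp add: F_def)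
    qed
    then have "F holomorphic_on ball \<zeta>0 \<epsilon>" by (rule power_series_holomorphic)
    then show ?thesis using e by (intro holomorphic_on_imp_differentiable_at[of F "ball \<zeta>0 \<epsilon>"]) auto
  qed
  then have "F holomorphic_on {\<zeta>. \<alpha> < Re \<zeta> \<and> Re \<zeta> < \<beta>}"
    unfolding holomorphic_on_def by (auto intro: field_differentiable_at_within)
  then show ?thesis by (simp add: F_def)
qed

lemma integral_exp_of_real:
  fixes M :: "'w measure" and \<tau> :: "'w \<Rightarrow> real"
  assumes [measurable]: "\<tau> \<in> borel_measurable M"
    and v: "(\<integral>\<^sup>+w. ennreal (exp (s * \<tau> w)) \<partial>M) = ennreal r" "r \<ge> 0"
  shows "(\<integral>w. exp (complex_of_real s * complex_of_real (\<tau> w)) \<partial>M) = complex_of_real r"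
proof -
  have "has_bochner_integral M (\<lambda>w. exp (s * \<tau> w)) r"
    by (rule has_bochner_integral_nn_integral) (use v in auto)
  then have "(\<integral>w. complex_of_real (exp (s * \<tau> w)) \<partial>M) = complex_of_real r"
    by (subst integral_complex_of_real) (simp add: has_bochner_integral_iff)
  moreover have "complex_of_real (exp (s * \<tau> w)) = exp (complex_of_real s * complex_of_real (\<tau> w))" for w
    by (simp only: of_real_mult[symmetric] exp_of_real)
  ultimately show ?thesis by simp
qed

lemma norm_integral_exp_le:
  fixes M :: "'w measure" and \<tau> :: "'w \<Rightarrow> real"
  assumes [measurable]: "\<tau> \<in> borel_measurable M"
    and v: "(\<integral>\<^sup>+w. ennreal (exp (Re \<zeta> * \<tau> w)) \<partial>M) = ennreal r" "r \<ge> 0"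
  shows "norm (\<integral>w. exp (\<zeta> * complex_of_real (\<tau> w)) \<partial>M) \<le> r"
proof -
  have "has_bochner_integral M (\<lambda>w. exp (Re \<zeta> * \<tau> w)) r"
    by (rule has_bochner_integral_nn_integral) (use v in auto)
  then have r: "(\<integral>w. exp (Re \<zeta> * \<tau> w) \<partial>M) = r" by (simp add: has_bochner_integral_iff)
  have "norm (\<integral>w. exp (\<zeta> * complex_of_real (\<tau> w)) \<partial>M) \<le> (\<integral>w. norm (exp (\<zeta> * complex_of_real (\<tau> w))) \<partial>M)"
    by (rule integral_norm_bound)
  also have "(\<integral>w. norm (exp (\<zeta> * complex_of_real (\<tau> w))) \<partial>M) = (\<integral>w. exp (Re \<zeta> * \<tau> w) \<partial>M)"
    by (intro Bochner_Integration.integral_cong) simp_all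
  finally show ?thesis using r by simp
qed

text \<open>
  By the identity theorem the transforms agree on the whole strip, in particular on a vertical
  line.  There they are, after tilting by \<open>exp (s\<^sub>0 u)\<close> and normalising, characteristic functions of
  probability measures, and these determine the measure.
\<close>

theorem two_sided_laplace_unique:
  fixes f1 f2 :: "real \<Rightarrow> ennreal" and \<alpha> \<beta> :: real
  assumes [measurable]: "f1 \<in> borel_measurable borel" "f2 \<in> borel_measurable borel"
    and ab: "\<alpha> < \<beta>"
    and eq: "\<And>s. \<alpha> < s \<Longrightarrow> s < \<beta> \<Longrightarrow> (\<integral>\<^sup>+u. f1 u * ennreal (exp (s * u)) \<partial>lborel) = ennreal (r s)"
      "\<And>s. \<alpha> < s \<Longrightarrow> s < \<beta> \<Longrightarrow> (\<integral>\<^sup>+u. f2 u * ennreal (exp (s * u)) \<partial>lborel) = ennreal (r s)"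
    and r: "\<And>s. \<alpha> < s \<Longrightarrow> s < \<beta> \<Longrightarrow> r s > 0"
  shows "AE u in lborel. f1 u = f2 u"
proof -
  define M where "M = (\<lambda>f. density lborel f :: real measure)"
  have nnM: "(\<integral>\<^sup>+u. ennreal (exp (s * u)) \<partial>M f) = (\<integral>\<^sup>+u. f u * ennreal (exp (s * u)) \<partial>lborel)"
    if "f \<in> borel_measurable borel" for f s
    unfolding M_def using that by (subst nn_integral_density) auto
  have idm: "(\<lambda>u. u) \<in> borel_measurable (M f)" for f unfolding M_def by simp
  define F where "F = (\<lambda>f \<zeta>. \<integral>u. exp (\<zeta> * complex_of_real u) \<partial>M f)"
  define S where "S = {\<zeta>. \<alpha> < Re \<zeta> \<and> Re \<zeta> < \<beta>}"
  have hol: "F f holomorphic_on S" if "f \<in> {f1, f2}" for f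
    unfolding F_def S_def
  proof (rule holomorphic_two_sided_laplace[OF idm])
    fix s assume "\<alpha> < s" "s < \<beta>"
    then show "(\<integral>\<^sup>+u. ennreal (exp (s * u)) \<partial>M f) < \<infinity>" using that eq[of s] by (auto simp: nnM)
  qed
  have real: "F f (complex_of_real s) = complex_of_real (r s)" if "f \<in> {f1, f2}" "\<alpha> < s" "s < \<beta>" for f s
    unfolding F_def by (rule integral_exp_of_real[OF idm]) (use that eq[of s] r[of s] in \<open>auto simp: nnM\<close>)
  have S: "open S" "connected S"
  proof -
    have e: "S = {\<zeta>. \<alpha> < Re \<zeta>} \<inter> {\<zeta>. Re \<zeta> < \<beta>}" by (auto simp: S_def)
    show "open S" unfolding e by (intro open_Int open_halfspace_Re_gt open_halfspace_Re_lt)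
    show "connected S" unfolding e by (intro convex_connected convex_Int convex_halfspace_Re_gt convex_halfspace_Re_lt)
  qed
  define s0 where "s0 = (\<alpha> + \<beta>) / 2"
  have s0: "\<alpha> < s0" "s0 < \<beta>" using ab by (auto simp: s0_def)
  have FF: "F f1 \<zeta> = F f2 \<zeta>" if "\<zeta> \<in> S" for \<zeta>
  proof -
    define U where "U = complex_of_real ` {\<alpha><..<\<beta>}"
    have "F f1 \<zeta> - F f2 \<zeta> = 0"
    proof (rule analytic_continuation[of "\<lambda>\<zeta>. F f1 \<zeta> - F f2 \<zeta>" S U "complex_of_real s0" \<zeta>])
      show "(\<lambda>\<zeta>. F f1 \<zeta> - F f2 \<zeta>) holomorphic_on S" using hol by (intro holomorphic_on_diff) auto
      show "U \<subseteq> S" "complex_of_real s0 \<in> S" using s0 by (auto simp: U_def S_def)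
      show "complex_of_real s0 islimpt U"
        unfolding islimpt_approachable
      proof (intro allI impI)
        fix e :: real assume e: "e > 0"
        define s where "s = s0 + min (e / 2) ((\<beta> - s0) / 2)"
        have s: "\<alpha> < s" "s < \<beta>" "s \<noteq> s0" "\<bar>s - s0\<bar> < e" using s0 e by (auto simp: s_def min_def field_simps)
        have "dist (complex_of_real s) (complex_of_real s0) < e"
          using s by (simp add: dist_norm flip: of_real_diff)
        moreover have "complex_of_real s \<in> U" using s by (auto simp: U_def)
        ultimately show "\<exists>x'\<in>U. x' \<noteq> complex_of_real s0 \<and> dist x' (complex_of_real s0) < e"
          using s by (intro bexI[of _ "complex_of_real s"]) auto
      qed
      show "F f1 z - F f2 z = 0" if "z \<in> U" for z using that real by (auto simp: U_def)
    qed (use S that in auto)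
    then show ?thesis by simp
  qed
  define P where "P = (\<lambda>f. density lborel (\<lambda>u. f u * ennreal (exp (s0 * u) / r s0)) :: real measure)"
  have rs: "r s0 > 0" using r s0 by simp
  have Pd: "P f = density (M f) (\<lambda>u. ennreal (exp (s0 * u) / r s0))" if [measurable]: "f \<in> borel_measurable borel" for f
    unfolding P_def M_def by (subst density_density_eq) auto
  have fm: "f \<in> borel_measurable borel" if "f \<in> {f1, f2}" for f using that by auto
  have Pr: "real_distribution (P f)" if f: "f \<in> {f1, f2}" for f
  proof -
    have [measurable]: "f \<in> borel_measurable borel" using fm[OF f] .
    have "emeasure (P f) (space (P f)) = (\<integral>\<^sup>+u. f u * ennreal (exp (s0 * u) / r s0) \<partial>lborel)"
      unfolding P_def by (subst emeasure_density) auto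
    also have "\<dots> = (\<integral>\<^sup>+u. ennreal (1 / r s0) * (f u * ennreal (exp (s0 * u))) \<partial>lborel)"
    proof (intro nn_integral_cong)
      fix u
      have "ennreal (exp (s0 * u) / r s0) = ennreal (1 / r s0) * ennreal (exp (s0 * u))"
        using rs by (simp add: ennreal_mult[symmetric])
      then show "f u * ennreal (exp (s0 * u) / r s0) = ennreal (1 / r s0) * (f u * ennreal (exp (s0 * u)))"
        by (simp add: mult_ac)
    qed
    also have "\<dots> = ennreal (1 / r s0) * ennreal (r s0)"
      using eq[OF s0] f by (subst nn_integral_cmult) auto
    also have "\<dots> = 1" using rs by (simp add: ennreal_mult[symmetric])
    finally have "prob_space (P f)" by (rule prob_spaceI)
    then show ?thesis unfolding real_distribution_def real_distribution_axioms_def by (simp add: P_def)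
  qed
  have chr: "char (P f) t = F f (Complex s0 t) / complex_of_real (r s0)" if f: "f \<in> {f1, f2}" for f t
  proof -
    have "char (P f) t = (\<integral>u. (exp (s0 * u) / r s0) *\<^sub>R exp (\<i> * complex_of_real (t * u)) \<partial>M f)"
      unfolding char_def Pd[OF fm[OF f]] using rs
      by (subst integral_density) (auto simp: M_def)
    also have "\<dots> = (\<integral>u. exp (Complex s0 t * complex_of_real u) / complex_of_real (r s0) \<partial>M f)"
    proof (intro Bochner_Integration.integral_cong refl)
      fix u
      have "Complex s0 t * complex_of_real u = complex_of_real (s0 * u) + \<i> * complex_of_real (t * u)"
        by (simp add: complex_eq_iff)
      then have "exp (Complex s0 t * complex_of_real u) = complex_of_real (exp (s0 * u)) * exp (\<i> * complex_of_real (t * u))"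
        by (simp only: exp_add exp_of_real)
      then show "(exp (s0 * u) / r s0) *\<^sub>R exp (\<i> * complex_of_real (t * u)) = exp (Complex s0 t * complex_of_real u) / complex_of_real (r s0)"
        by (simp add: scaleR_conv_of_real)
    qed
    also have "\<dots> = F f (Complex s0 t) / complex_of_real (r s0)" unfolding F_def by simp
    finally show ?thesis .
  qed
  have "char (P f1) = char (P f2)"
  proof
    fix t
    have "Complex s0 t \<in> S" using s0 by (simp add: S_def)
    then show "char (P f1) t = char (P f2) t" using FF by (simp add: chr)
  qed
  then have "P f1 = P f2" using Pr by (intro Levy_uniqueness) auto
  then have "AE u in lborel. f1 u * ennreal (exp (s0 * u) / r s0) = f2 u * ennreal (exp (s0 * u) / r s0)"
    unfolding P_def by (intro sigma_finite_measure.density_unique[OF sigma_finite_lborel]) auto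
  then show ?thesis
  proof eventually_elim
    case (elim u)
    have p: "ennreal (exp (s0 * u) / r s0) * ennreal (r s0 / exp (s0 * u)) = 1"
      using rs by (simp add: ennreal_mult[symmetric])
    have "f1 u = f1 u * ennreal (exp (s0 * u) / r s0) * ennreal (r s0 / exp (s0 * u))"
      using p by (simp add: mult.assoc)
    also have "\<dots> = f2 u" unfolding elim using p by (simp add: mult.assoc)
    finally show ?case .
  qed
qed

section \<open>From the random variable to a Laplace representation\<close>

text \<open>
  The function \<open>L\<close> is the Laplace transform of the law of \<open>X\<^bsup>-1/d\<^esup>\<close>, weighted by a power of \<open>X\<close>.  Its
  Mellin transform is \<open>\<Gamma> w\<close> times a moment of \<open>X\<close>, hence that of \<open>H\<close>.  Uniqueness gives \<open>L = H\<close> almost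
  everywhere, and then everywhere because \<open>L\<close> decreases and \<open>H\<close> is continuous.
\<close>

theorem laplace_represents_of_X_exists:
  fixes a b c d :: real
  assumes pos: "a > 0" "b > 0" "c > 0" "d > 0" and ex: "X_exists a b c d"
  shows "\<exists>(M :: real measure) \<tau>. laplace_represents M \<tau> (prabhakar_transform (a + b) d (c - a * d))"
proof -
  define H where "H = prabhakar_transform (a + b) d (c - a * d)"
  obtain g where g0: "\<And>x. x > 0 \<Longrightarrow> g x \<ge> 0"
    and gi: "\<And>s. - a < s \<Longrightarrow> s < b \<Longrightarrow> set_integrable lborel {0<..} (\<lambda>x. x powr s * g x)"
    and gv: "\<And>s. - a < s \<Longrightarrow> s < b \<Longrightarrow> (LBINT x:{0<..}. x powr s * g x) = X_moment a b c d s"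
    using ex unfolding X_exists_def by blast
  define f where "f = (\<lambda>x. indicator {0<..} x * g x)"
  have "set_integrable lborel {0<..} (\<lambda>x. x powr 0 * g x)" using gi[of 0] pos by simp
  then have "(\<lambda>x. indicator {0<..} x *\<^sub>R (x powr 0 * g x)) \<in> borel_measurable lborel"
    unfolding set_integrable_def by (rule borel_measurable_integrable)
  moreover have "(\<lambda>x. indicator {0<..} x *\<^sub>R (x powr 0 * g x)) = f"
    by (auto simp: f_def indicator_def fun_eq_iff)
  ultimately have fm [measurable]: "f \<in> borel_measurable borel" by simp
  have fn: "f x \<ge> 0" for x using g0[of x] by (simp add: f_def indicator_def)
  have mom: "(\<integral>\<^sup>+x\<in>{0<..}. ennreal (x powr s * f x) \<partial>lborel) = ennreal (X_moment a b c d s)" "X_moment a b c d s \<ge> 0"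
    if s: "- a < s" "s < b" for s
  proof -
    have e: "indicator {0<..} x *\<^sub>R (x powr s * g x) = indicator {0<..} x * (x powr s * f x)" for x
      by (simp add: f_def indicator_def)
    have i: "integrable lborel (\<lambda>x. indicator {0<..} x * (x powr s * f x))"
      using gi[OF s] unfolding set_integrable_def e .
    have v: "(\<integral>x. indicator {0<..} x * (x powr s * f x) \<partial>lborel) = X_moment a b c d s"
      using gv[OF s] unfolding set_lebesgue_integral_def e .
    have "(\<integral>\<^sup>+x. ennreal (indicator {0<..} x * (x powr s * f x)) \<partial>lborel) = ennreal (X_moment a b c d s)"
      unfolding v[symmetric] by (rule nn_integral_eq_integral[OF i]) (use fn in auto)
    moreover have "(\<integral>\<^sup>+x. ennreal (indicator {0<..} x * (x powr s * f x)) \<partial>lborel) = (\<integral>\<^sup>+x\<in>{0<..}. ennreal (x powr s * f x) \<partial>lborel)"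
      by (intro nn_integral_cong) (simp add: indicator_def)
    ultimately show "(\<integral>\<^sup>+x\<in>{0<..}. ennreal (x powr s * f x) \<partial>lborel) = ennreal (X_moment a b c d s)" by simp
    show "X_moment a b c d s \<ge> 0" unfolding v[symmetric] by (rule integral_nonneg_AE) (use fn in auto)
  qed
  have Gp: "Gamma (a + b) > 0" "Gamma a > 0" "Gamma b > 0" "Gamma c > 0" using pos by (auto intro: Gamma_real_pos)
  \<comment> \<open>\<open>C\<close> makes the Mellin transform of \<open>L\<close> equal to that of \<open>H\<close>, without a constant.\<close>
  define C where "C = Gamma a * Gamma b / (d * Gamma (a + b) * Gamma c)"
  have C: "C > 0" using Gp pos by (simp add: C_def)
  define \<tau> where "\<tau> = (\<lambda>x::real. x powr (- (1 / d)))"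
  define k where "k = (\<lambda>x. C * x powr (- (c / d)) * f x)"
  have [measurable]: "k \<in> borel_measurable borel" "\<tau> \<in> borel_measurable borel" unfolding k_def \<tau>_def by measurable
  have kn: "k x \<ge> 0" for x using C fn by (simp add: k_def)
  define M where "M = kernel_measure k"
  have tM: "\<tau> \<in> borel_measurable M" unfolding M_def by measurable
  have tp: "\<tau> x > 0" if "x > 0" for x using that by (simp add: \<tau>_def)
  define L where "L = (\<lambda>z. \<integral>\<^sup>+w. ennreal (exp (- (z * \<tau> w))) \<partial>M)"
  have Lk: "L z = (\<integral>\<^sup>+x\<in>{0<..}. ennreal (k x) * ennreal (exp (- (z * \<tau> x))) \<partial>lborel)" for z
    unfolding L_def M_def by (rule nn_integral_kernel_measure) measurable
  have Lm [measurable]: "L \<in> borel_measurable borel"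
  proof -
    have "(\<lambda>z. \<integral>\<^sup>+x. (\<lambda>(z, x). ennreal (k x) * ennreal (exp (- (z * \<tau> x))) * indicator {0<..} x) (z, x) \<partial>lborel) \<in> borel_measurable borel"
      by (rule lborel.borel_measurable_nn_integral) measurable
    then show ?thesis unfolding Lk[abs_def] by simp
  qed
  have Hm [measurable]: "H \<in> borel_measurable borel" unfolding H_def prabhakar_transform_def by measurable
  \<comment> \<open>The points \<open>w = c + d s\<close> with \<open>-a < s < b\<close> and \<open>w > 0\<close>; the interval contains \<open>c\<close>.\<close>
  define \<alpha> where "\<alpha> = max 0 (c - a * d)"
  define \<beta> where "\<beta> = c + d * b"
  have ab: "\<alpha> < \<beta>" using pos by (auto simp: \<alpha>_def \<beta>_def max_def add_pos_pos mult_pos_pos mult.commute intro: less_trans[of _ 0])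
  define r where "r = (\<lambda>w. Gamma (a + (w - c) / d) * Gamma (b - (w - c) / d) / (d * Gamma (a + b)))"
  have ws: "w > 0" "- a < (w - c) / d" "(w - c) / d < b" "w = c + d * ((w - c) / d)" if "\<alpha> < w" "w < \<beta>" for w
    using that pos by (auto simp: \<alpha>_def \<beta>_def field_simps)
  have rp: "r w > 0" if w: "\<alpha> < w" "w < \<beta>" for w
    unfolding r_def using ws[OF w] pos Gp by (intro divide_pos_pos mult_pos_pos Gamma_real_pos) auto
  have LM: "(\<integral>\<^sup>+z\<in>{0<..}. ennreal (z powr (w - 1)) * L z \<partial>lborel) = ennreal (r w)" if w: "\<alpha> < w" "w < \<beta>" for w
  proof -
    define s where "s = (w - c) / d"
    have s: "- a < s" "s < b" "w = c + d * s" and w0: "w > 0" using ws[OF w] by (auto simp: s_def)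
    have Gw: "Gamma w > 0" "rGamma w = 1 / Gamma w" using w0 by (auto intro: Gamma_real_pos simp: rGamma_inverse_Gamma inverse_eq_divide)
    define F where "F = (\<lambda>z x::real. ennreal (z powr (w - 1)) * (ennreal (k x) * ennreal (exp (- (z * \<tau> x))) * indicator {0<..} x) * indicator {0<..} z)"
    have Fm: "(\<lambda>(z, x). F z x) \<in> borel_measurable (lborel \<Otimes>\<^sub>M lborel)" unfolding F_def by measurable
    have 1: "(\<integral>\<^sup>+x. F z x \<partial>lborel) = ennreal (z powr (w - 1)) * L z * indicator {0<..} z" for z
    proof (cases "z > 0")
      case True
      then show ?thesis unfolding F_def Lk by (simp add: nn_integral_cmult)
    qed (simp add: F_def)
    have 2: "(\<integral>\<^sup>+z. F z x \<partial>lborel) = ennreal (C * Gamma w) * (ennreal (x powr s * f x) * indicator {0<..} x)" for x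
    proof (cases "x > 0")
      case True
      have "(\<integral>\<^sup>+z. F z x \<partial>lborel) = (\<integral>\<^sup>+z. ennreal (k x) * (ennreal (z powr (w - 1) * exp (- (\<tau> x * z))) * indicator {0<..} z) \<partial>lborel)"
        using True by (intro nn_integral_cong) (simp add: F_def ennreal_mult mult_ac)
      also have "\<dots> = ennreal (k x) * (\<integral>\<^sup>+z\<in>{0<..}. ennreal (z powr (w - 1) * exp (- (\<tau> x * z))) \<partial>lborel)"
        by (rule nn_integral_cmult) measurable
      also have "\<dots> = ennreal (k x) * ennreal (Gamma w * \<tau> x powr (- w))"
        by (subst nn_integral_Gamma[OF w0 tp[OF True]]) simp
      also have "\<dots> = ennreal (k x * (Gamma w * \<tau> x powr (- w)))"
        using kn Gw by (intro ennreal_mult[symmetric]) auto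
      also have "k x * (Gamma w * \<tau> x powr (- w)) = C * Gamma w * (x powr s * f x)"
      proof -
        have "- (1 / d) * - w = c / d + s" using s(3) pos by (simp add: field_simps)
        then have "\<tau> x powr (- w) = x powr (c / d + s)" by (simp only: \<tau>_def powr_powr)
        then have "x powr (- (c / d)) * \<tau> x powr (- w) = x powr s" using True by (simp add: powr_add[symmetric])
        moreover have "k x * (Gamma w * \<tau> x powr (- w)) = C * Gamma w * ((x powr (- (c / d)) * \<tau> x powr (- w)) * f x)"
          unfolding k_def by (simp only: mult_ac)
        ultimately show ?thesis by simp
      qed
      finally show ?thesis using True C Gw fn[of x] by (simp add: ennreal_mult[symmetric])
    qed (simp add: F_def)
    have "(\<integral>\<^sup>+z\<in>{0<..}. ennreal (z powr (w - 1)) * L z \<partial>lborel) = (\<integral>\<^sup>+z. (\<integral>\<^sup>+x. F z x \<partial>lborel) \<partial>lborel)"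
      unfolding 1 ..
    also have "\<dots> = (\<integral>\<^sup>+x. (\<integral>\<^sup>+z. F z x \<partial>lborel) \<partial>lborel)"
      by (rule lborel_pair.Fubini'[OF Fm, symmetric])
    also have "\<dots> = ennreal (C * Gamma w) * ennreal (X_moment a b c d s)"
      unfolding 2 mom(1)[OF s(1,2), symmetric] by (rule nn_integral_cmult) measurable
    also have "\<dots> = ennreal (C * Gamma w * X_moment a b c d s)"
      using C Gw mom(2)[OF s(1,2)] by (intro ennreal_mult[symmetric]) auto
    also have "C * Gamma w * X_moment a b c d s = r w"
    proof -
      have "A * B / (dd * E * Y) * W * (Y / (A * B) * (U * V * (1 / W))) = U * V / (dd * E)"
        if "A \<noteq> 0" "B \<noteq> 0" "Y \<noteq> 0" "W \<noteq> 0" for A B dd E Y W U V :: real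
        using that by simp
      from this[of "Gamma a" "Gamma b" "Gamma c" "Gamma w" d "Gamma (a + b)" "Gamma (a + s)" "Gamma (b - s)"]
      show ?thesis using Gp Gw unfolding C_def X_moment_def r_def s(3)[symmetric] Gw(2) s_def[symmetric] by fastforce
    qed
    finally show ?thesis .
  qed
  have HM: "(\<integral>\<^sup>+z\<in>{0<..}. ennreal (z powr (w - 1)) * ennreal (H z) \<partial>lborel) = ennreal (r w)" if w: "\<alpha> < w" "w < \<beta>" for w
  proof -
    define s where "s = (w - c) / d"
    have s: "- a < s" "s < b" "w = c + d * s" using ws[OF w] by (auto simp: s_def)
    have "(\<integral>\<^sup>+z\<in>{0<..}. ennreal (z powr (w - 1)) * ennreal (H z) \<partial>lborel)
       = (\<integral>\<^sup>+z\<in>{0<..}. ennreal (z powr ((c - a * d) + d * (a + s) - 1) * prabhakar_transform ((a + s) + (b - s)) d (c - a * d) z) \<partial>lborel)"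
    proof (intro nn_integral_cong)
      fix z :: real
      have e1: "w - 1 = (c - a * d) + d * (a + s) - 1" using s(3) by (auto simp: algebra_simps)
      have e2: "a + b = (a + s) + (b - s)" by simp
      show "ennreal (z powr (w - 1)) * ennreal (H z) * indicator {0<..} z
         = ennreal (z powr ((c - a * d) + d * (a + s) - 1) * prabhakar_transform ((a + s) + (b - s)) d (c - a * d) z) * indicator {0<..} z"
        unfolding H_def e1 by (subst e2) (simp only: ennreal_mult[OF powr_ge_zero prabhakar_transform_nonneg])
    qed
    also have "\<dots> = ennreal (Gamma (a + s) * Gamma (b - s) / (d * Gamma ((a + s) + (b - s))))"
      using s pos by (intro mellin_prabhakar_transform) auto
    finally show ?thesis by (simp add: r_def s_def)
  qed
  have log: "(\<integral>\<^sup>+z\<in>{0<..}. ennreal (z powr (w - 1)) * G z \<partial>lborel) = (\<integral>\<^sup>+u. G (exp u) * ennreal (exp (w * u)) \<partial>lborel)"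
    if [measurable]: "G \<in> borel_measurable borel" for G w
  proof -
    have "(\<integral>\<^sup>+z\<in>{0<..}. ennreal (z powr (w - 1)) * G z \<partial>lborel) = (\<integral>\<^sup>+u. ennreal (exp u powr (w - 1)) * G (exp u) * ennreal (exp u) \<partial>lborel)"
      by (rule nn_integral_exp_substitution) measurable
    also have "\<dots> = (\<integral>\<^sup>+u. G (exp u) * ennreal (exp (w * u)) \<partial>lborel)"
    proof (intro nn_integral_cong)
      fix u :: real
      have "exp u powr (w - 1) * exp u = exp (w * u)" by (simp add: powr_def exp_add[symmetric] algebra_simps)
      then have "ennreal (exp u powr (w - 1)) * ennreal (exp u) = ennreal (exp (w * u))" by (simp add: ennreal_mult[symmetric])
      then show "ennreal (exp u powr (w - 1)) * G (exp u) * ennreal (exp u) = G (exp u) * ennreal (exp (w * u))"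
        by (metis mult.assoc mult.commute)
    qed
    finally show ?thesis .
  qed
  have ae: "AE u in lborel. L (exp u) = ennreal (H (exp u))"
  proof (rule two_sided_laplace_unique[OF _ _ ab, where r = r])
    show "(\<integral>\<^sup>+u. L (exp u) * ennreal (exp (w * u)) \<partial>lborel) = ennreal (r w)" if "\<alpha> < w" "w < \<beta>" for w
      using LM[OF that] by (simp add: log)
    show "(\<integral>\<^sup>+u. ennreal (H (exp u)) * ennreal (exp (w * u)) \<partial>lborel) = ennreal (r w)" if "\<alpha> < w" "w < \<beta>" for w
      using HM[OF that] by (simp add: log)
  qed (use rp in auto)
  \<comment> \<open>Almost everywhere equality yields points of equality in every interval.\<close>
  have near: "\<exists>z. p < z \<and> z < q \<and> L z = ennreal (H z)" if "0 < p" "p < q" for p q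
  proof (rule ccontr)
    assume no: "\<not> (\<exists>z. p < z \<and> z < q \<and> L z = ennreal (H z))"
    have "AE u in lborel. \<not> (ln p < u \<and> u < ln q)"
      using ae
    proof eventually_elim
      case (elim u)
      show ?case
      proof
        assume "ln p < u \<and> u < ln q"
        then have "exp (ln p) < exp u \<and> exp u < exp (ln q)" by simp
        then have "p < exp u" "exp u < q" using that by simp_all
        then show False using no elim by blast
      qed
    qed
    then have "emeasure lborel {u. ln p < u \<and> u < ln q} = 0"
      by (subst (asm) AE_iff_measurable[OF _ refl]) auto
    moreover have "{u. ln p < u \<and> u < ln q} = {ln p<..<ln q}" by auto
    ultimately show False using that by simp
  qed
  have anti: "L q \<le> L p" if "p \<le> q" for p q
    unfolding Lk
  proof (intro nn_integral_mono)
    fix x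
    show "ennreal (k x) * ennreal (exp (- (q * \<tau> x))) * indicator {0<..} x \<le> ennreal (k x) * ennreal (exp (- (p * \<tau> x))) * indicator {0<..} x"
      using that tp[of x] by (cases "x > 0") (auto intro!: mult_left_mono ennreal_leI mult_right_mono)
  qed
  have Hc: "isCont H z" if "z > 0" for z
  proof -
    have "1 + z powr d > 0" by (simp add: add_pos_nonneg)
    then show ?thesis unfolding H_def prabhakar_transform_def using that by (intro continuous_intros) auto
  qed
  have Hn: "H z \<ge> 0" for z by (simp add: H_def prabhakar_transform_nonneg)
  have LH: "L z = ennreal (H z)" if z: "z > 0" for z
  proof (rule antisym)
    have cont: "((\<lambda>x. ennreal (H x)) \<longlongrightarrow> ennreal (H z)) (at z)"
      using Hc[OF z] by (intro tendsto_ennrealI) (simp add: isCont_def)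
    show "L z \<le> ennreal (H z)"
    proof (rule ccontr)
      assume "\<not> L z \<le> ennreal (H z)"
      then have "eventually (\<lambda>x. ennreal (H x) < L z) (at z)" by (intro order_tendstoD(2)[OF cont]) auto
      then have "eventually (\<lambda>x. ennreal (H x) < L z) (at_left z)" by (simp add: eventually_at_split)
      then obtain p where p: "p < z" "\<And>y. p < y \<Longrightarrow> y < z \<Longrightarrow> ennreal (H y) < L z"
        unfolding eventually_at_left_field by blast
      define q where "q = (max p 0 + z) / 2"
      have q: "0 < q" "q < z" "p < q" using p z by (auto simp: q_def max_def field_simps)
      obtain y where y: "q < y" "y < z" "L y = ennreal (H y)" using near[OF q(1,2)] by blast
      have "p < y" using q y by linarith
      then have "L y < L z" using p(2)[of y] y by simp
      then show False using anti[of y z] y by simp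
    qed
    show "ennreal (H z) \<le> L z"
    proof (rule ccontr)
      assume "\<not> ennreal (H z) \<le> L z"
      then have "eventually (\<lambda>x. L z < ennreal (H x)) (at z)" by (intro order_tendstoD(1)[OF cont]) auto
      then have "eventually (\<lambda>x. L z < ennreal (H x)) (at_right z)" by (simp add: eventually_at_split)
      then obtain p where p: "z < p" "\<And>y. z < y \<Longrightarrow> y < p \<Longrightarrow> L z < ennreal (H y)"
        unfolding eventually_at_right_field by blast
      obtain y where y: "z < y" "y < p" "L y = ennreal (H y)" using near[of z p] p z by auto
      then have "L z < L y" using p by simp
      then show False using anti[of z y] y by simp
    qed
  qed
  have "laplace_represents M \<tau> H"
    using tM LH unfolding laplace_represents_def L_def \<tau>_def by simp
  then show ?thesis unfolding H_def by blast
qed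

section \<open>Obstructions from boundary singularities and from the sign of the moments\<close>

text \<open>
  The left-hand side is the modulus of \<open>H\<close> at \<open>e\<^bsup>i\<theta>\<^esup>\<close>, since \<open>1 + e\<^bsup>i d \<theta>\<^esup>\<close> has modulus \<open>2 cos (d \<theta> / 2)\<close>;
  the right-hand side is the value of \<open>H\<close> at the real part of that point.  The continuation is done in the
  variable \<open>\<zeta>\<close> with \<open>z = exp \<zeta>\<close>, where the sector becomes a convex strip.
\<close>

theorem laplace_represents_singularity_bound:
  fixes g d lam \<theta> :: real
  assumes d: "d \<ge> 2" and rep: "laplace_represents M \<tau> (prabhakar_transform g d lam)"
    and th: "0 < \<theta>" "\<theta> < pi / d"
  shows "(2 * cos (d * \<theta> / 2)) powr (- g) \<le> prabhakar_transform g d lam (cos \<theta>)"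
proof -
  define H where "H = prabhakar_transform g d lam"
  have Hn: "H z \<ge> 0" for z by (simp add: H_def prabhakar_transform_nonneg)
  have tm: "\<tau> \<in> borel_measurable M" and L: "\<And>z. z > 0 \<Longrightarrow> (\<integral>\<^sup>+w. ennreal (exp (- (z * \<tau> w))) \<partial>M) = ennreal (H z)"
    using rep by (auto simp: laplace_represents_def H_def)
  have tm': "(\<lambda>w. - \<tau> w) \<in> borel_measurable M" using tm by measurable
  have L': "(\<integral>\<^sup>+w. ennreal (exp (z * - \<tau> w)) \<partial>M) = ennreal (H z)" if "z > 0" for z using L[OF that] by simp
  define F where "F = (\<lambda>z. \<integral>w. exp (z * complex_of_real (- \<tau> w)) \<partial>M)"
  have holF: "F holomorphic_on {z. 0 < Re z}"
  proof -
    have "F holomorphic_on {z. 0 < Re z \<and> Re z < R}" for R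
      unfolding F_def by (rule holomorphic_two_sided_laplace[OF tm']) (use L' in auto)
    then have "F field_differentiable (at z)" if "0 < Re z" for z
    proof -
      have "open ({z. 0 < Re z} \<inter> {z'. Re z' < Re z + 1})"
        by (intro open_Int open_halfspace_Re_gt open_halfspace_Re_lt)
      then have "open {z'. 0 < Re z' \<and> Re z' < Re z + 1}" by (simp add: Int_def)
      with \<open>\<And>R. F holomorphic_on {z. 0 < Re z \<and> Re z < R}\<close>[of "Re z + 1"] show ?thesis
        using that by (intro holomorphic_on_imp_differentiable_at[of F "{z'. 0 < Re z' \<and> Re z' < Re z + 1}"]) auto
    qed
    then show ?thesis unfolding holomorphic_on_def by (auto intro: field_differentiable_at_within)
  qed
  define S where "S = {\<zeta>. Im \<zeta> < pi / d} \<inter> {\<zeta>. Im \<zeta> > - (pi / d)}"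
  define E where "E = (\<lambda>\<zeta>. exp (- of_real lam * \<zeta>) * exp (- of_real g * Ln (1 + exp (of_real d * \<zeta>))))"
  have dpos: "d > 0" using d by simp
  have pd: "pi / d \<le> pi / 2" using d by (simp add: field_simps)
  have S: "open S" "connected S" unfolding S_def
    by (intro open_Int open_halfspace_Im_gt open_halfspace_Im_lt convex_connected convex_Int convex_halfspace_Im_gt convex_halfspace_Im_lt)+
  have SIm: "\<bar>Im \<zeta>\<bar> < pi / d" "\<bar>Im \<zeta>\<bar> < pi / 2" "\<bar>d * Im \<zeta>\<bar> < pi" if "\<zeta> \<in> S" for \<zeta>
  proof -
    show 1: "\<bar>Im \<zeta>\<bar> < pi / d" using that by (auto simp: S_def abs_less_iff)
    then show "\<bar>Im \<zeta>\<bar> < pi / 2" using pd by linarith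
    have "d * \<bar>Im \<zeta>\<bar> < pi" using 1 dpos by (simp add: field_simps)
    then show "\<bar>d * Im \<zeta>\<bar> < pi" using dpos by (simp add: abs_mult)
  qed
  have Re_exp_pos: "Re (exp \<zeta>) > 0" if "\<zeta> \<in> S" for \<zeta>
  proof -
    have "cos (Im \<zeta>) > 0" using SIm(2)[OF that] by (intro cos_gt_zero_pi) (auto simp: abs_less_iff)
    then show ?thesis by (simp add: Re_exp)
  qed
  have slit: "1 + exp (of_real d * \<zeta>) \<notin> \<real>\<^sub>\<le>\<^sub>0" if z: "\<zeta> \<in> S" for \<zeta>
  proof
    assume "1 + exp (of_real d * \<zeta>) \<in> \<real>\<^sub>\<le>\<^sub>0"
    then have *: "Re (exp (of_real d * \<zeta>)) < 0" "Im (exp (of_real d * \<zeta>)) = 0"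
      by (auto simp: complex_nonpos_Reals_iff)
    then have s: "sin (d * Im \<zeta>) = 0" by (simp add: Im_exp)
    have "d * Im \<zeta> = 0"
      by (rule sin_eq_0_pi) (use s SIm(3)[OF z] in \<open>auto simp: abs_less_iff\<close>)
    then have "cos (d * Im \<zeta>) = 1" by (simp only: cos_zero)
    then show False using *(1) by (simp add: Re_exp)
  qed
  have holE: "E holomorphic_on S" unfolding E_def by (intro holomorphic_intros) (use slit in auto)
  have holFe: "(\<lambda>\<zeta>. F (exp \<zeta>)) holomorphic_on S"
  proof -
    have "(F \<circ> exp) holomorphic_on S"
      by (rule holomorphic_on_compose_gen[OF _ holF]) (use Re_exp_pos in \<open>auto intro!: holomorphic_intros\<close>)
    then show ?thesis by (simp add: o_def)
  qed
  have realF: "F (exp (complex_of_real x)) = complex_of_real (H (exp x))" for x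
  proof -
    have "F (complex_of_real (exp x)) = complex_of_real (H (exp x))"
      unfolding F_def by (rule integral_exp_of_real[OF tm' L'[OF exp_gt_zero] Hn])
    then show ?thesis by (simp only: exp_of_real)
  qed
  have realE: "E (complex_of_real x) = complex_of_real (H (exp x))" for x
  proof -
    have p: "1 + exp (d * x) > 0" by (simp add: add_pos_pos)
    have e: "exp (complex_of_real u * complex_of_real y) = complex_of_real (exp (u * y))" for u y
      by (simp only: of_real_mult[symmetric] exp_of_real)
    have "1 + complex_of_real (exp (d * x)) = complex_of_real (1 + exp (d * x))" by simp
    then have l: "Ln (1 + complex_of_real (exp (d * x))) = complex_of_real (ln (1 + exp (d * x)))"
      by (simp only: Ln_of_real[OF p])
    have m: "- complex_of_real u = complex_of_real (- u)" for u by simp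
    have h: "H (exp x) = exp (- lam * x) * exp (- g * ln (1 + exp (d * x)))"
      using p unfolding H_def prabhakar_transform_def by (simp add: powr_def)
    show ?thesis unfolding E_def e l m h of_real_mult ..
  qed
  define \<zeta>0 where "\<zeta>0 = Complex 0 \<theta>"
  have z0S: "\<zeta>0 \<in> S" using th by (auto simp: S_def \<zeta>0_def)
  have "F (exp \<zeta>0) - E \<zeta>0 = 0"
  proof (rule analytic_continuation[of "\<lambda>\<zeta>. F (exp \<zeta>) - E \<zeta>" S "range complex_of_real" 0 \<zeta>0])
    show "(\<lambda>\<zeta>. F (exp \<zeta>) - E \<zeta>) holomorphic_on S" by (intro holomorphic_on_diff holFe holE)
    show "range complex_of_real \<subseteq> S" "0 \<in> S" using dpos by (auto simp: S_def)
    show "0 islimpt range complex_of_real"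
      unfolding islimpt_approachable
    proof (intro allI impI)
      fix e :: real assume e: "e > 0"
      have "complex_of_real (e / 2) \<noteq> 0" "norm (complex_of_real (e / 2)) < e"
        unfolding norm_of_real of_real_eq_0_iff using e by simp_all
      then show "\<exists>x'\<in>range complex_of_real. x' \<noteq> 0 \<and> dist x' 0 < e"
        by (intro bexI[OF _ rangeI[of complex_of_real "e / 2"]] conjI) (simp_all only: dist_norm diff_zero not_False_eq_True)
    qed
    show "F (exp z) - E z = 0" if "z \<in> range complex_of_real" for z using that realF realE by auto
  qed (use S z0S in auto)
  then have FE: "F (exp \<zeta>0) = E \<zeta>0" by simp
  have "\<theta> < pi / 2" "- (pi / 2) < \<theta>" using th pd pi_gt_zero by linarith+
  then have ct: "cos \<theta> > 0" by (intro cos_gt_zero_pi)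
  have Ree: "Re (exp \<zeta>0) = cos \<theta>" by (simp add: \<zeta>0_def Re_exp)
  have "norm (F (exp \<zeta>0)) \<le> H (cos \<theta>)"
    unfolding F_def by (rule norm_integral_exp_le[OF tm' _ Hn]) (use Ree L'[OF ct] in simp)
  moreover have "norm (E \<zeta>0) = (2 * cos (d * \<theta> / 2)) powr (- g)"
  proof -
    define v where "v = d * \<theta> / 2"
    have v: "0 < v" "v < pi / 2" using th dpos by (auto simp: v_def field_simps)
    then have cv: "cos v > 0" by (intro cos_gt_zero_pi) auto
    have "of_real d * \<zeta>0 = Complex 0 (2 * v)" by (simp add: \<zeta>0_def complex_eq_iff v_def)
    then have "1 + exp (of_real d * \<zeta>0) = Complex (1 + cos (2 * v)) (sin (2 * v))"
      by (simp add: complex_eq_iff Re_exp Im_exp)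
    also have "\<dots> = Complex (2 * cos v * cos v) (2 * cos v * sin v)"
      by (simp add: cos_double_cos sin_double power2_eq_square)
    finally have w: "1 + exp (of_real d * \<zeta>0) = Complex (2 * cos v * cos v) (2 * cos v * sin v)" .
    have "(2 * cos v * cos v)\<^sup>2 + (2 * cos v * sin v)\<^sup>2 = (2 * cos v)\<^sup>2 * ((sin v)\<^sup>2 + (cos v)\<^sup>2)"
      by (simp only: power_mult_distrib distrib_left mult_ac add_ac)
    then have e2: "(2 * cos v * cos v)\<^sup>2 + (2 * cos v * sin v)\<^sup>2 = (2 * cos v)\<^sup>2" by (simp only: sin_cos_squared_add mult_1_right)
    have nw: "norm (1 + exp (of_real d * \<zeta>0)) = 2 * cos v"
      unfolding w complex_norm e2 real_sqrt_abs using cv by simp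
    have "1 + exp (of_real d * \<zeta>0) \<noteq> 0" using nw cv by (metis less_irrefl mult_pos_pos norm_zero zero_less_numeral)
    then have "Re (Ln (1 + exp (of_real d * \<zeta>0))) = ln (2 * cos v)" using nw by (simp add: Re_Ln)
    then have "norm (E \<zeta>0) = exp (- g * ln (2 * cos v))"
      by (simp add: E_def norm_mult \<zeta>0_def)
    then show ?thesis using cv by (simp add: powr_def v_def)
  qed
  ultimately show ?thesis using FE by (simp add: H_def)
qed

text \<open>
  As \<open>\<theta>\<close> tends to \<open>\<pi> / d < \<pi> / 2\<close>, the left-hand side of the bound explodes and the right-hand side does not.
\<close>

lemma not_laplace_represents_gt_2:
  assumes d: "d > 2" and g: "g > 0"
  shows "\<not> laplace_represents M \<tau> (prabhakar_transform g d lam)"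
proof
  assume rep: "laplace_represents M \<tau> (prabhakar_transform g d lam)"
  define \<theta> where "\<theta> = pi / d"
  have th: "0 < \<theta>" "\<theta> < pi / 2" using d by (auto simp: \<theta>_def field_simps)
  have c: "cos \<theta> > 0" using th by (intro cos_gt_zero_pi) auto
  have "filterlim (\<lambda>x. (2 * cos (d * x / 2)) powr (- g)) at_top (at_left \<theta>)"
  proof -
    have "((\<lambda>x. 2 * cos (d * x / 2)) \<longlongrightarrow> 2 * cos (d * \<theta> / 2)) (at_left \<theta>)" by (intro tendsto_intros) simp
    moreover have "d * \<theta> / 2 = pi / 2" using d by (simp add: \<theta>_def)
    then have "cos (d * \<theta> / 2) = 0" by (simp only: cos_pi_half)
    moreover have "eventually (\<lambda>x. 2 * cos (d * x / 2) > 0) (at_left \<theta>)"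
      using eventually_at_left_real[OF th(1)]
    proof eventually_elim
      case (elim x)
      then have "0 < d * x / 2" "d * x / 2 < pi / 2" using d by (auto simp: \<theta>_def field_simps)
      then have "cos (d * x / 2) > 0" by (intro cos_gt_zero_pi) auto
      then show ?case by simp
    qed
    ultimately have "filterlim (\<lambda>x. 2 * cos (d * x / 2)) (at_right 0) (at_left \<theta>)"
      by (simp add: filterlim_at eventually_mono)
    moreover have "filterlim (\<lambda>y::real. y powr (- g)) at_top (at_right 0)" using g by real_asymp
    ultimately show ?thesis by (rule filterlim_compose[rotated])
  qed
  then have ev: "eventually (\<lambda>x. (2 * cos (d * x / 2)) powr (- g) > prabhakar_transform g d lam (cos \<theta>) + 1) (at_left \<theta>)"
    by (simp add: filterlim_at_top_dense)
  have "((\<lambda>x. prabhakar_transform g d lam (cos x)) \<longlongrightarrow> prabhakar_transform g d lam (cos \<theta>)) (at_left \<theta>)"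
  proof -
    have "1 + cos \<theta> powr d > 0" by (simp add: add_pos_nonneg)
    then show ?thesis unfolding prabhakar_transform_def using c by (intro tendsto_intros) auto
  qed
  then have "eventually (\<lambda>x. prabhakar_transform g d lam (cos x) < prabhakar_transform g d lam (cos \<theta>) + 1) (at_left \<theta>)"
    by (rule order_tendstoD) simp
  with ev have "eventually (\<lambda>x. False) (at_left \<theta>)"
    using eventually_at_left_real[OF th(1)]
  proof eventually_elim
    case (elim x)
    then show ?case
      using laplace_represents_singularity_bound[OF _ rep, of x] d by (auto simp: \<theta>_def)
  qed
  then show False by (simp add: trivial_limit_at_left_real)
qed

text \<open>
  For \<open>d = 2\<close> the bound at \<open>x = cos \<theta>\<close> reads \<open>(2 x)\<^bsup>-g\<^esup> \<le> x\<^bsup>-lam\<^esup> (1 + x\<^sup>2)\<^bsup>-g\<^esup>\<close>; let \<open>x\<close> tend to \<open>0\<close>.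
\<close>

lemma laplace_represents_2_index_le:
  assumes g: "g > 0" and rep: "laplace_represents M \<tau> (prabhakar_transform g 2 lam)"
  shows "g \<le> lam"
proof (rule ccontr)
  assume "\<not> g \<le> lam"
  then have lg: "lam < g" by simp
  have bound: "x powr (lam - g) \<le> 2 powr g" if x: "0 < x" "x < 1" for x :: real
  proof -
    define \<theta> where "\<theta> = arccos x"
    have c: "cos \<theta> = x" using x by (simp add: \<theta>_def cos_arccos)
    have th: "0 < \<theta>" "\<theta> < pi / 2"
      using x arccos_lt_bounded[of x] arccos_less_arccos[of 0 x] by (auto simp: \<theta>_def)
    have "(2 * cos (2 * \<theta> / 2)) powr (- g) \<le> prabhakar_transform g 2 lam (cos \<theta>)"
      using th by (intro laplace_represents_singularity_bound[OF _ rep]) auto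
    then have "(2 * x) powr (- g) \<le> prabhakar_transform g 2 lam x" using c by simp
    also have "\<dots> \<le> x powr (- lam) * 1"
      unfolding prabhakar_transform_def using g by (intro mult_left_mono) (auto simp: powr_minus inverse_le_1_iff ge_one_powr_ge_zero)
    finally have "(2 * x) powr (- g) * (2 powr g * x powr lam) \<le> x powr (- lam) * (2 powr g * x powr lam)"
      by (intro mult_right_mono) auto
    moreover have "(2 * x) powr (- g) * (2 powr g * x powr lam) = x powr (lam - g)"
      using x by (simp add: powr_mult powr_diff powr_minus field_simps)
    moreover have "x powr (- lam) * (2 powr g * x powr lam) = 2 powr g"
      using x by (simp add: powr_minus field_simps)
    ultimately show ?thesis by simp
  qed
  have "filterlim (\<lambda>x::real. x powr (lam - g)) at_top (at_right 0)" using lg by real_asymp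
  then have "eventually (\<lambda>x. x powr (lam - g) > 2 powr g) (at_right 0)" by (simp add: filterlim_at_top_dense)
  then have "eventually (\<lambda>x::real. False) (at_right 0)"
    using eventually_at_right_real[OF zero_less_one]
  proof eventually_elim
    case (elim x)
    then show ?case using bound[of x] by auto
  qed
  then show False by (simp add: trivial_limit_at_right_real)
qed

text \<open>
  Otherwise there is a negative \<open>s > -a\<close> with \<open>-1 < c + d s < 0\<close>, where \<open>1 / \<Gamma>\<close> is negative.
\<close>

lemma X_exists_imp_le:
  assumes pos: "a > 0" "b > 0" "c > 0" "d > 0" and ex: "X_exists a b c d"
  shows "a * d \<le> c"
proof (rule ccontr)
  assume "\<not> a * d \<le> c"
  then have lt: "c < a * d" by simp
  define m where "m = max (- a) (- (c + 1) / d)"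
  define s where "s = (m + (- (c / d))) / 2"
  have "- a < - (c / d)" "- (c + 1) / d < - (c / d)" and cd: "- (c / d) < 0" using lt pos by (auto simp: field_simps)
  then have m: "m < - (c / d)" "- a \<le> m" "- (c + 1) / d \<le> m" by (simp_all add: m_def)
  have mid: "x < (x + y) / 2" "(x + y) / 2 < y" if "x < y" for x y :: real using that by simp_all
  have ms: "m < s" "s < - (c / d)" unfolding s_def by (rule mid(1)[OF m(1)], rule mid(2)[OF m(1)])
  have s: "- a < s" "- (c + 1) / d < s" "s < - (c / d)" "s < 0"
    by (rule le_less_trans[OF m(2) ms(1)], rule le_less_trans[OF m(3) ms(1)], rule ms(2), rule less_trans[OF ms(2) cd])
  have cs: "- 1 < c + d * s" "c + d * s < 0" using s pos by (auto simp: field_simps)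
  define y where "y = c + d * s"
  have y: "- 1 < y" "y < 0" using cs by (auto simp: y_def)
  have "rGamma y = y * rGamma (y + 1)" by (simp add: rGamma_plus1)
  moreover have "rGamma (y + 1) > 0" using y by (simp add: rGamma_inverse_Gamma Gamma_real_pos)
  ultimately have "rGamma y < 0" using y by (simp add: mult_neg_pos)
  moreover have "Gamma (a + s) > 0" "Gamma (b - s) > 0" "Gamma a > 0" "Gamma b > 0" "Gamma c > 0" using s pos by (auto intro!: Gamma_real_pos)
  ultimately have neg: "X_moment a b c d s < 0"
    unfolding X_moment_def y_def[symmetric] by (intro mult_pos_neg divide_pos_pos mult_pos_pos)
  obtain g where g0: "\<And>x. x > 0 \<Longrightarrow> g x \<ge> 0"
    and gv: "(LBINT x:{0<..}. x powr s * g x) = X_moment a b c d s"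
    using ex s pos unfolding X_exists_def by (metis less_trans)
  have "(LBINT x:{0<..}. x powr s * g x) \<ge> 0"
    unfolding set_lebesgue_integral_def using g0 by (intro integral_nonneg_AE AE_I2) (auto simp: indicator_def)
  then show False using gv neg by simp
qed

section \<open>The Saalschuetz sum and the Whipple transformation\<close>

text \<open>
  The summand telescopes: it equals \<open>U (k + 1) - U k\<close> with \<open>U k = k P k (e + n - k) (c + k)\<close> and
  \<open>e = c - a - b\<close>.
\<close>

lemma saalschutz_step:
  fixes a b c :: real and n :: nat
  defines "P \<equiv> \<lambda>k. of_nat (n choose k) * pochhammer a k * pochhammer b k
                     * pochhammer (c - a - b) (n - k) * pochhammer (c + of_nat k + 1) (n - k)"
  shows "(\<Sum>k\<le>n. P k * ((of_nat n - of_nat k) * (c - a) * (c - b)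
              - of_nat n * (c + of_nat k) * (c - a - b))) = 0"
proof -
  define e where "e = c - a - b"
  define U where "U = (\<lambda>k. of_nat k * P k * (e + of_nat n - of_nat k) * (c + of_nat k))"
  have step: "P k * ((of_nat n - of_nat k) * (c - a) * (c - b) - of_nat n * (c + of_nat k) * e)
      = U (Suc k) - U k" if "k \<le> n" for k
  proof -
    have US: "U (Suc k) = (of_nat n - of_nat k) * P k * (a + of_nat k) * (b + of_nat k)"
    proof (cases "k = n")
      case True
      then show ?thesis by (simp add: U_def P_def)
    next
      case False
      with that have "k < n" by simp
      then obtain r where n: "n = Suc (k + r)"
        using less_imp_Suc_add by blast
      have bin: "of_nat (Suc k) * of_nat (n choose Suc k) = ((of_nat n - of_nat k) * of_nat (n choose k) :: real)"
      proof -
        have "Suc k * (n choose Suc k) = (n - k) * (n choose k)"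
          by (simp only: binomial_absorption binomial_absorb_comp)
        then show ?thesis using \<open>k < n\<close>
          by (metis of_nat_diff of_nat_mult less_imp_le)
      qed
      have "n - k = Suc r" "n - Suc k = r" using n by auto
      then have "U (Suc k) = (of_nat (Suc k) * of_nat (n choose Suc k)) * pochhammer a (Suc k)
          * pochhammer b (Suc k) * (pochhammer e r * (e + of_nat r))
          * ((c + of_nat k + 1) * pochhammer (c + of_nat k + 1 + 1) r)"
        by (simp add: U_def P_def n e_def algebra_simps)
      also have "\<dots> = ((of_nat n - of_nat k) * of_nat (n choose k)) * (pochhammer a k * (a + of_nat k))
          * (pochhammer b k * (b + of_nat k)) * pochhammer e (Suc r) * pochhammer (c + of_nat k + 1) (Suc r)"
        by (simp only: bin pochhammer_rec[of "c + of_nat k + 1"] pochhammer_Suc[of a] pochhammer_Suc[of b] pochhammer_Suc[of e])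
      also have "\<dots> = (of_nat n - of_nat k) * P k * (a + of_nat k) * (b + of_nat k)"
        using \<open>n - k = Suc r\<close> by (simp add: P_def e_def mult_ac del: pochhammer_Suc)
      finally show ?thesis .
    qed
    have Uk: "U k = of_nat k * P k * (e + of_nat n - of_nat k) * (c + of_nat k)"
      by (simp only: U_def)
    show ?thesis unfolding US Uk e_def by algebra
  qed
  have "(\<Sum>k\<le>n. P k * ((of_nat n - of_nat k) * (c - a) * (c - b) - of_nat n * (c + of_nat k) * e))
     = (\<Sum>k\<le>n. U (Suc k) - U k)"
    using step by (intro sum.cong) auto
  also have "\<dots> = U (Suc n) - U 0"
    by (induction n) simp_all
  also have "\<dots> = 0" by (simp add: U_def P_def)
  finally show ?thesis by (simp add: e_def)
qed

text \<open>
  The Pfaff-Saalschuetz sum for a balanced \<open>\<^sub>3F\<^sub>2\<close>, with denominators cleared.  In the induction step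
  Pascal's rule turns the sum for \<open>n + 1\<close> into the sum for \<open>n\<close> times the expected factor, up to the
  telescoping sum above.
\<close>

lemma saalschutz:
  fixes a b c :: real
  assumes c: "c > 0"
  shows "(\<Sum>k\<le>n. of_nat (n choose k) * pochhammer a k * pochhammer b k
           * pochhammer (c - a - b) (n - k) * pochhammer (c + of_nat k) (n - k))
         = pochhammer (c - a) n * pochhammer (c - b) n"
proof (induction n)
  case 0
  then show ?case by simp
next
  case (Suc n)
  define P where "P = (\<lambda>k. of_nat (n choose k) * pochhammer a k * pochhammer b k
                     * pochhammer (c - a - b) (n - k) * pochhammer (c + of_nat k + 1) (n - k))"
  have t: "of_nat (n choose k) * pochhammer a k * pochhammer b k
           * pochhammer (c - a - b) (n - k) * pochhammer (c + of_nat k) (n - k)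
         = P k * (c + of_nat k) / (c + of_nat n)" if "k \<le> n" for k
  proof -
    have "(c + of_nat k) * pochhammer (c + of_nat k + 1) (n - k) = pochhammer (c + of_nat k) (n - k) * (c + of_nat n)"
      using pochhammer_Suc[of "c + of_nat k" "n - k"] pochhammer_rec[of "c + of_nat k" "n - k"] that
      by (simp add: of_nat_diff)
    moreover have "c + of_nat n \<noteq> 0" using c by (metis add_pos_nonneg less_irrefl of_nat_0_le_iff)
    moreover have "P k * (c + of_nat k) = (of_nat (n choose k) * pochhammer a k * pochhammer b k
           * pochhammer (c - a - b) (n - k)) * ((c + of_nat k) * pochhammer (c + of_nat k + 1) (n - k))"
      by (simp only: P_def mult_ac)
    ultimately show ?thesis by (intro eq_divide_imp) (simp_all only: mult.assoc not_False_eq_True)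
  qed
  define F where "F = (\<lambda>k. pochhammer a k * pochhammer b k
           * pochhammer (c - a - b) (Suc n - k) * pochhammer (c + of_nat k) (Suc n - k))"
  have "(\<Sum>k\<le>Suc n. of_nat (Suc n choose k) * pochhammer a k * pochhammer b k
           * pochhammer (c - a - b) (Suc n - k) * pochhammer (c + of_nat k) (Suc n - k))
      = (\<Sum>k\<le>Suc n. of_nat (Suc n choose k) * F k)"
    by (simp only: F_def mult.assoc)
  also have "\<dots> = F 0 + (\<Sum>k\<le>n. (of_nat (n choose k) + of_nat (n choose Suc k)) * F (Suc k))"
    unfolding sum.atMost_Suc_shift binomial_Suc_Suc by simp
  also have "\<dots> = (F 0 + (\<Sum>k\<le>n. of_nat (n choose Suc k) * F (Suc k))) + (\<Sum>k\<le>n. of_nat (n choose k) * F (Suc k))"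
    by (simp add: algebra_simps sum.distrib)
  also have "F 0 + (\<Sum>k\<le>n. of_nat (n choose Suc k) * F (Suc k)) = (\<Sum>k\<le>Suc n. of_nat (n choose k) * F k)"
    by (subst sum.atMost_Suc_shift) simp
  also have "\<dots> = (\<Sum>k\<le>n. of_nat (n choose k) * F k)" by simp
  also have "\<dots> + (\<Sum>k\<le>n. of_nat (n choose k) * F (Suc k))
      = (\<Sum>k\<le>n. of_nat (n choose k) * (F k + F (Suc k)))"
    by (simp add: algebra_simps sum.distrib)
  also have "\<dots> = (\<Sum>k\<le>n. P k * ((c - a) * (c - b) + of_nat n * (c + of_nat k)))"
  proof (intro sum.cong refl)
    fix k assume "k \<in> {..n}"
    then obtain r where n: "n = k + r" using le_Suc_ex by auto
    have Sk: "c + of_nat (Suc k) = c + of_nat k + 1" by simp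
    from n have nk: "Suc n - k = Suc r" "Suc n - Suc k = r" "n - k = r" by auto
    have "of_nat (n choose k) * (F k + F (Suc k))
      = of_nat (n choose k) * pochhammer a k * pochhammer b k * pochhammer (c - a - b) r * pochhammer (c + of_nat k + 1) r
        * ((c - a - b + of_nat r) * (c + of_nat k) + (a + of_nat k) * (b + of_nat k))"
      unfolding F_def nk Sk pochhammer_Suc[of a] pochhammer_Suc[of b] pochhammer_Suc[of "c - a - b"] pochhammer_rec[of "c + of_nat k" r]
      by algebra
    also have "(c - a - b + of_nat r) * (c + of_nat k) + (a + of_nat k) * (b + of_nat k)
       = (c - a) * (c - b) + of_nat n * (c + of_nat k)"
      by (simp add: n algebra_simps)
    finally show "of_nat (n choose k) * (F k + F (Suc k)) = P k * ((c - a) * (c - b) + of_nat n * (c + of_nat k))"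
      by (simp add: P_def nk)
  qed
  also have "\<dots> = (\<Sum>k\<le>n. P k * (c + of_nat k) / (c + of_nat n) * ((c - a + of_nat n) * (c - b + of_nat n))
       + P k * ((of_nat n - of_nat k) * (c - a) * (c - b)
              - of_nat n * (c + of_nat k) * (c - a - b)) / (c + of_nat n))"
  proof (intro sum.cong refl)
    fix k
    have "c + of_nat n \<noteq> 0" using c by (metis add_pos_nonneg less_irrefl of_nat_0_le_iff)
    moreover have "((c - a) * (c - b) + of_nat n * (c + of_nat k)) * (c + of_nat n)
        = (c + of_nat k) * ((c - a + of_nat n) * (c - b + of_nat n))
          + ((of_nat n - of_nat k) * (c - a) * (c - b) - of_nat n * (c + of_nat k) * (c - a - b))"
      by algebra
    ultimately have "(c - a) * (c - b) + of_nat n * (c + of_nat k)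
        = ((c + of_nat k) * ((c - a + of_nat n) * (c - b + of_nat n))
          + ((of_nat n - of_nat k) * (c - a) * (c - b) - of_nat n * (c + of_nat k) * (c - a - b))) / (c + of_nat n)"
      by (rule eq_divide_imp)
    moreover have "p * ((s * t + q) / h) = p * s / h * t + p * q / h" for p s t q h :: real
      by (simp add: add_divide_distrib distrib_left)
    ultimately show "P k * ((c - a) * (c - b) + of_nat n * (c + of_nat k)) =
      P k * (c + of_nat k) / (c + of_nat n) * ((c - a + of_nat n) * (c - b + of_nat n))
       + P k * ((of_nat n - of_nat k) * (c - a) * (c - b)
              - of_nat n * (c + of_nat k) * (c - a - b)) / (c + of_nat n)"
      by metis
  qed
  also have "\<dots> = (\<Sum>k\<le>n. P k * (c + of_nat k) / (c + of_nat n)) * ((c - a + of_nat n) * (c - b + of_nat n))"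
    unfolding sum.distrib sum_divide_distrib[symmetric] sum_distrib_right[symmetric]
    using saalschutz_step[of n a b c] by (simp add: P_def)
  also have "(\<Sum>k\<le>n. P k * (c + of_nat k) / (c + of_nat n)) = pochhammer (c - a) n * pochhammer (c - b) n"
    unfolding Suc.IH[symmetric] using t by (intro sum.cong) auto
  finally show ?case by (simp add: pochhammer_Suc mult_ac)
qed

lemma pochhammer_reflect:
  fixes x :: real
  shows "pochhammer (1 - x - of_nat r) r = (-1) ^ r * pochhammer x r"
  using pochhammer_minus[of "x + of_nat r - 1" r] by (simp add: algebra_simps)

text \<open>
  The same sum in the form in which the lower parameters \<open>v\<close> and \<open>w\<close> play symmetric roles.
\<close>

lemma saalschutz_alternating:
  fixes v w z E :: real
  assumes v: "v > 0" and bal: "v + w = 1 - of_nat n + z + E"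
  shows "(\<Sum>i\<le>n. (-1) ^ i * of_nat (n choose i) * pochhammer z i * pochhammer E i
           * pochhammer (v + of_nat i) (n - i) * pochhammer (w + of_nat i) (n - i))
         = pochhammer (v - z) n * pochhammer (w - z) n"
proof -
  have "(\<Sum>i\<le>n. (-1) ^ i * of_nat (n choose i) * pochhammer z i * pochhammer E i
           * pochhammer (v + of_nat i) (n - i) * pochhammer (w + of_nat i) (n - i))
      = (-1) ^ n * (\<Sum>i\<le>n. of_nat (n choose i) * pochhammer z i * pochhammer E i
           * pochhammer (v - z - E) (n - i) * pochhammer (v + of_nat i) (n - i))"
    unfolding sum_distrib_left
  proof (intro sum.cong refl)
    fix i assume "i \<in> {..n}"
    then have i: "i \<le> n" by simp
    have eq: "v - z - E = 1 - (w + of_nat i) - of_nat (n - i)"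
      using bal i by (simp add: of_nat_diff)
    have sg: "(-1) ^ n * (-1) ^ (n - i) = ((-1) ^ i :: real)"
    proof -
      obtain r where n: "n = i + r" using i le_Suc_ex by blast
      then have "n - i = r" by simp
      then show ?thesis by (simp only: n power_add mult.assoc minus_one_mult_self mult_1_right)
    qed
    show "(-1) ^ i * of_nat (n choose i) * pochhammer z i * pochhammer E i
           * pochhammer (v + of_nat i) (n - i) * pochhammer (w + of_nat i) (n - i)
        = (-1) ^ n * (of_nat (n choose i) * pochhammer z i * pochhammer E i
           * pochhammer (v - z - E) (n - i) * pochhammer (v + of_nat i) (n - i))"
      unfolding eq pochhammer_reflect sg[symmetric] by (simp add: mult_ac)
  qed
  also have "\<dots> = (-1) ^ n * (pochhammer (v - z) n * pochhammer (v - E) n)"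
    by (subst saalschutz[OF v]) simp
  also have "pochhammer (v - E) n = (-1) ^ n * pochhammer (w - z) n"
  proof -
    have "v - E = 1 - (w - z) - of_nat n" using bal by simp
    then show ?thesis by (simp only: pochhammer_reflect)
  qed
  finally show ?thesis by simp
qed

text \<open>
  The Whipple transformation of a balanced terminating \<open>\<^sub>4F\<^sub>3\<close>.  The Saalschuetz sum is used twice: to
  expand \<open>(x)\<^sub>j (y)\<^sub>j / (u)\<^sub>j\<close>, and, after exchanging the sums, to evaluate the inner sum.
\<close>

lemma whipple_polynomial:
  fixes x y z u v w :: real
  assumes u: "u > 0" and v: "v > 0" and bal: "u + v + w = 1 - of_nat n + x + y + z"
  shows "(\<Sum>j\<le>n. (-1) ^ j * of_nat (n choose j) * pochhammer x j * pochhammer y j * pochhammer z j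
            / pochhammer u j * pochhammer (v + of_nat j) (n - j) * pochhammer (w + of_nat j) (n - j))
       = (\<Sum>k\<le>n. (-1) ^ k * of_nat (n choose k) * pochhammer (u - x) k * pochhammer (u - y) k
            * pochhammer z k / pochhammer u k * pochhammer (v - z) (n - k) * pochhammer (w - z) (n - k))"
proof -
  define A B E where "A = u - x" and "B = u - y" and "E = u - A - B"
  have up: "pochhammer u j \<noteq> 0" for j using pochhammer_pos[OF u] by (simp add: less_imp_neq[symmetric])
  have inner: "pochhammer x j * pochhammer y j / pochhammer u j
      = (\<Sum>k\<le>j. of_nat (j choose k) * pochhammer A k * pochhammer B k * pochhammer E (j - k) / pochhammer u k)" for j
  proof -
    have "pochhammer x j * pochhammer y j = (\<Sum>k\<le>j. of_nat (j choose k) * pochhammer A k * pochhammer B k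
           * pochhammer E (j - k) * pochhammer (u + of_nat k) (j - k))"
      using saalschutz[OF u, where a=A and b=B and n=j] by (simp add: A_def B_def E_def)
    also have "\<dots> / pochhammer u j = (\<Sum>k\<le>j. of_nat (j choose k) * pochhammer A k * pochhammer B k
        * pochhammer E (j - k) / pochhammer u k)"
      unfolding sum_divide_distrib
    proof (intro sum.cong refl)
      fix k assume "k \<in> {..j}"
      then have "pochhammer u j = pochhammer u k * pochhammer (u + of_nat k) (j - k)"
        by (intro pochhammer_product) simp
      moreover from this have "pochhammer (u + of_nat k) (j - k) \<noteq> 0" using up[of j] by auto
      ultimately show "of_nat (j choose k) * pochhammer A k * pochhammer B k
           * pochhammer E (j - k) * pochhammer (u + of_nat k) (j - k) / pochhammer u j =
         of_nat (j choose k) * pochhammer A k * pochhammer B k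
        * pochhammer E (j - k) / pochhammer u k" by simp
    qed
    finally show ?thesis .
  qed
  define g where "g = (\<lambda>j k. (-1) ^ j * of_nat (n choose j) * pochhammer z j
      * pochhammer (v + of_nat j) (n - j) * pochhammer (w + of_nat j) (n - j)
      * (of_nat (j choose k) * pochhammer A k * pochhammer B k * pochhammer E (j - k) / pochhammer u k))"
  have "(\<Sum>j\<le>n. (-1) ^ j * of_nat (n choose j) * pochhammer x j * pochhammer y j * pochhammer z j
            / pochhammer u j * pochhammer (v + of_nat j) (n - j) * pochhammer (w + of_nat j) (n - j))
    = (\<Sum>j\<le>n. \<Sum>k\<le>j. g j k)"
  proof (intro sum.cong refl)
    fix j
    have "(-1) ^ j * of_nat (n choose j) * pochhammer x j * pochhammer y j * pochhammer z j
            / pochhammer u j * pochhammer (v + of_nat j) (n - j) * pochhammer (w + of_nat j) (n - j)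
      = (-1) ^ j * of_nat (n choose j) * pochhammer z j
      * pochhammer (v + of_nat j) (n - j) * pochhammer (w + of_nat j) (n - j) * (pochhammer x j * pochhammer y j / pochhammer u j)"
      by (simp add: field_simps)
    then show "(-1) ^ j * of_nat (n choose j) * pochhammer x j * pochhammer y j * pochhammer z j
            / pochhammer u j * pochhammer (v + of_nat j) (n - j) * pochhammer (w + of_nat j) (n - j) = (\<Sum>k\<le>j. g j k)"
      by (simp only: inner g_def sum_distrib_left)
  qed
  also have "\<dots> = (\<Sum>k\<le>n. \<Sum>j=k..n. g j k)"
    unfolding sum.Sigma[OF finite_atMost ballI[OF finite_atMost]] sum.Sigma[OF finite_atMost ballI[OF finite_atLeastAtMost]]
    by (rule sum.reindex_bij_witness[of _ prod.swap prod.swap]) auto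
  also have "\<dots> = (\<Sum>k\<le>n. (-1) ^ k * of_nat (n choose k) * pochhammer A k * pochhammer B k
            * pochhammer z k / pochhammer u k * pochhammer (v - z) (n - k) * pochhammer (w - z) (n - k))"
  proof (intro sum.cong refl)
    fix k assume "k \<in> {..n}"
    then obtain r where n: "n = k + r" using le_Suc_ex by auto
    have "(\<Sum>j=k..n. g j k) = (\<Sum>i\<le>r. g (k + i) k)"
      unfolding n using sum.shift_bounds_cl_nat_ivl[of "\<lambda>j. g j k" 0 k r]
      by (simp add: atMost_atLeast0 add.commute)
    also have "\<dots> = (\<Sum>i\<le>r. ((-1) ^ k * of_nat (n choose k) * pochhammer A k * pochhammer B k * pochhammer z k / pochhammer u k)
        * ((-1) ^ i * of_nat (r choose i) * pochhammer (z + of_nat k) i * pochhammer E i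
           * pochhammer (v + of_nat k + of_nat i) (r - i) * pochhammer (w + of_nat k + of_nat i) (r - i)))"
    proof (intro sum.cong refl)
      fix i assume "i \<in> {..r}"
      then have i: "i \<le> r" by simp
      have "(n choose (k + i)) * ((k + i) choose k) = (n choose k) * ((n - k) choose (k + i - k))"
        using i n by (intro choose_mult) auto
      then have bin: "of_nat (n choose (k + i)) * of_nat ((k + i) choose k) = (of_nat (n choose k) * of_nat (r choose i) :: real)"
        by (simp add: n flip: of_nat_mult)
      have e: "n - (k + i) = r - i" "k + i - k = i" using n by auto
      have "g (k + i) k = (-1) ^ (k + i) * (of_nat (n choose (k + i)) * of_nat ((k + i) choose k)) * pochhammer z (k + i)
      * pochhammer (v + of_nat k + of_nat i) (r - i) * pochhammer (w + of_nat k + of_nat i) (r - i)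
      * (pochhammer A k * pochhammer B k * pochhammer E i / pochhammer u k)"
        by (simp add: g_def e add.assoc)
      also have "\<dots> = ((-1) ^ k * of_nat (n choose k) * pochhammer A k * pochhammer B k * pochhammer z k / pochhammer u k)
        * ((-1) ^ i * of_nat (r choose i) * pochhammer (z + of_nat k) i * pochhammer E i
           * pochhammer (v + of_nat k + of_nat i) (r - i) * pochhammer (w + of_nat k + of_nat i) (r - i))"
        unfolding bin pochhammer_product' power_add by (simp add: mult_ac)
      finally show "g (k + i) k = ((-1) ^ k * of_nat (n choose k) * pochhammer A k * pochhammer B k * pochhammer z k / pochhammer u k)
        * ((-1) ^ i * of_nat (r choose i) * pochhammer (z + of_nat k) i * pochhammer E i
           * pochhammer (v + of_nat k + of_nat i) (r - i) * pochhammer (w + of_nat k + of_nat i) (r - i))" .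
    qed
    also have "\<dots> = ((-1) ^ k * of_nat (n choose k) * pochhammer A k * pochhammer B k * pochhammer z k / pochhammer u k)
        * (pochhammer ((v + of_nat k) - (z + of_nat k)) r * pochhammer ((w + of_nat k) - (z + of_nat k)) r)"
      unfolding sum_distrib_left[symmetric]
      by (subst saalschutz_alternating)
         (use v bal in \<open>auto simp: n A_def B_def E_def add_pos_nonneg\<close>)
    finally show "(\<Sum>j=k..n. g j k) = (-1) ^ k * of_nat (n choose k) * pochhammer A k * pochhammer B k
            * pochhammer z k / pochhammer u k * pochhammer (v - z) (n - k) * pochhammer (w - z) (n - k)"
      by (simp add: n)
  qed
  finally show ?thesis by (simp only: A_def B_def)
qed

section \<open>A terminating hypergeometric sum with at most one negative term\<close>

lemma pochhammer_nonneg':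
  fixes x :: real
  assumes "0 \<le> x"
  shows "0 \<le> pochhammer x k"
  using assms by (induction k) (auto simp: pochhammer_Suc)

lemma pochhammer_mono:
  fixes x y :: real
  assumes "- 1 < x" "x \<le> y" "0 < y"
  shows "pochhammer x k \<le> pochhammer y k"
proof (cases "0 \<le> x")
  case True
  then show ?thesis
    using assms by (induction k) (auto simp: pochhammer_Suc intro!: mult_mono pochhammer_nonneg')
next
  case False
  show ?thesis
  proof (cases k)
    case 0
    then show ?thesis by simp
  next
    case (Suc l)
    have "pochhammer x k \<le> 0"
      using False assms(1) by (auto simp: Suc pochhammer_rec mult_le_0_iff intro!: pochhammer_nonneg')
    also have "0 \<le> pochhammer y k" using assms by (intro pochhammer_nonneg') simp
    finally show ?thesis .
  qed
qed

text \<open>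
  The transform of the \<open>\<^sub>4F\<^sub>3\<close> sum below.  For \<open>k < n\<close> all factors are nonnegative when \<open>g \<le> 2 m\<close>; for
  \<open>k = n\<close> the factor \<open>(m - 1/2)\<^sub>n\<close> may be negative.
\<close>

definition whipple_sum :: "real \<Rightarrow> real \<Rightarrow> nat \<Rightarrow> real" where
  "whipple_sum g m n = (\<Sum>k\<le>n. of_nat (n choose k) * pochhammer (m - 1/2 + of_nat (n - k)) k * pochhammer (g/2) k
            * pochhammer g k / pochhammer (g + m + 1/2) k * pochhammer (m - g/2) (n - k) * pochhammer m (n - k))"

lemma hypergeometric_4F3_eq_whipple_sum:
  fixes g m :: real
  assumes g: "g > 0" and m: "m > 0"
  shows "(\<Sum>j\<le>n. (-1) ^ j * of_nat (n choose j) * pochhammer (of_nat n + (g + 2 * m - 1)) j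
             * pochhammer (g/2 + m + 1/2) j * pochhammer g j
            / (pochhammer (g + m + 1/2) j * pochhammer (g/2 + m) j * pochhammer (g + m) j))
       = whipple_sum g m n / (pochhammer (g/2 + m) n * pochhammer (g + m) n)"
proof -
  let ?c = "g + m + 1/2" and ?v = "g/2 + m" and ?b = "g + m" and ?y = "g/2 + m + 1/2"
  let ?x = "of_nat n + (g + 2 * m - 1)"
  have nz: "pochhammer ?v j \<noteq> 0" "pochhammer ?b j \<noteq> 0" "pochhammer ?c j \<noteq> 0" for j
    using pochhammer_pos[of ?v j] pochhammer_pos[of ?b j] pochhammer_pos[of ?c j] g m by auto
  have "(\<Sum>j\<le>n. (-1) ^ j * of_nat (n choose j) * pochhammer ?x j * pochhammer ?y j * pochhammer g j
            / (pochhammer ?c j * pochhammer ?v j * pochhammer ?b j)) * (pochhammer ?v n * pochhammer ?b n)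
    = (\<Sum>j\<le>n. (-1) ^ j * of_nat (n choose j) * pochhammer ?x j * pochhammer ?y j * pochhammer g j
            / pochhammer ?c j * pochhammer (?v + of_nat j) (n - j) * pochhammer (?b + of_nat j) (n - j))"
    unfolding sum_distrib_right
  proof (intro sum.cong refl)
    fix j assume "j \<in> {..n}"
    then have "pochhammer ?v n = pochhammer ?v j * pochhammer (?v + of_nat j) (n - j)"
      "pochhammer ?b n = pochhammer ?b j * pochhammer (?b + of_nat j) (n - j)"
      by (intro pochhammer_product; simp)+
    then show "(-1) ^ j * of_nat (n choose j) * pochhammer ?x j * pochhammer ?y j * pochhammer g j
            / (pochhammer ?c j * pochhammer ?v j * pochhammer ?b j) * (pochhammer ?v n * pochhammer ?b n)
         = (-1) ^ j * of_nat (n choose j) * pochhammer ?x j * pochhammer ?y j * pochhammer g j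
            / pochhammer ?c j * pochhammer (?v + of_nat j) (n - j) * pochhammer (?b + of_nat j) (n - j)"
      using nz[of j] by simp
  qed
  also have "\<dots> = (\<Sum>k\<le>n. (-1) ^ k * of_nat (n choose k) * pochhammer (?c - ?x) k * pochhammer (?c - ?y) k
            * pochhammer g k / pochhammer ?c k * pochhammer (?v - g) (n - k) * pochhammer (?b - g) (n - k))"
    by (rule whipple_polynomial) (use g m in \<open>auto simp: field_simps\<close>)
  also have "\<dots> = whipple_sum g m n"
    unfolding whipple_sum_def
  proof (intro sum.cong refl)
    fix k assume "k \<in> {..n}"
    then have k: "k \<le> n" by simp
    have "?c - ?x = 1 - (m - 1/2 + of_nat (n - k)) - of_nat k"
      using k by (simp add: of_nat_diff)
    then have p: "pochhammer (?c - ?x) k = (-1) ^ k * pochhammer (m - 1/2 + of_nat (n - k)) k"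
      by (simp only: pochhammer_reflect)
    have q: "?c - ?y = g / 2" "?v - g = m - g/2" "?b - g = m" by (auto simp: field_simps)
    show "(-1) ^ k * of_nat (n choose k) * pochhammer (?c - ?x) k * pochhammer (?c - ?y) k
            * pochhammer g k / pochhammer ?c k * pochhammer (?v - g) (n - k) * pochhammer (?b - g) (n - k)
        = of_nat (n choose k) * pochhammer (m - 1/2 + of_nat (n - k)) k * pochhammer (g/2) k
            * pochhammer g k / pochhammer ?c k * pochhammer (m - g/2) (n - k) * pochhammer m (n - k)"
      unfolding p q by simp
  qed
  finally show ?thesis using nz by (simp add: field_simps)
qed

text \<open>
  For \<open>m < 1/2\<close> this compares the only negative term, \<open>k = n\<close>, with the term \<open>k = 0\<close>.  For index \<open>1\<close> the
  inequality is equivalent to \<open>g \<le> m (2 m + 1)\<close>, and the step from one index to the next only improves it.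
\<close>

lemma whipple_sum_end_terms:
  fixes g m :: real
  assumes g: "g > 0" and m: "0 < m" "m < 1/2" and 1: "g \<le> 2 * m" and 2: "g \<le> m * (2 * m + 1)"
  shows "- pochhammer (m - 1/2) (Suc n) * pochhammer (g/2) (Suc n) * pochhammer g (Suc n)
     \<le> pochhammer (m - g/2) (Suc n) * pochhammer m (Suc n) * pochhammer (g + m + 1/2) (Suc n)"
proof (induction n)
  case 0
  have "(m - g/2) * m * (g + m + 1/2) - (1/2 - m) * (g/2) * g = (m * (m + 1/2) - g/2) * (g/2 + m)"
    by (simp add: field_simps power2_eq_square)
  also have "\<dots> \<ge> 0" using g m 2 by (intro mult_nonneg_nonneg) (auto simp: field_simps)
  finally show ?case by (simp add: algebra_simps)
next
  case (Suc n)
  define N :: real where "N = of_nat (Suc n)"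
  have N: "N \<ge> 1" by (simp add: N_def)
  have "m * m \<le> (1/2) * (1/2)" using m by (intro mult_mono) auto
  then have gm: "g \<le> m + 1/2" using 2 by (simp add: algebra_simps)
  have r: "(m - 1/2 + N) * (g/2 + N) * (g + N) \<le> (m - g/2 + N) * (m + N) * (g + m + 1/2 + N)"
  proof (rule mult_mono)
    have "(m - g/2 + N) * (m + N) - (m - 1/2 + N) * (g/2 + N) = N * (m + 1/2 - g) + m * (m - g/2) + (1/2 - m) * (g/2)"
      by (simp add: field_simps)
    also have "\<dots> \<ge> 0" using N m g gm 1 by (intro add_nonneg_nonneg mult_nonneg_nonneg) auto
    finally show "(m - 1/2 + N) * (g/2 + N) \<le> (m - g/2 + N) * (m + N)" by simp
  qed (use m g 1 N in auto)
  have n0: "0 \<le> - pochhammer (m - 1/2) (Suc n) * pochhammer (g/2) (Suc n) * pochhammer g (Suc n)"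
    using m g by (auto simp: pochhammer_rec[of "m - 1/2"] mult_le_0_iff zero_le_mult_iff intro!: mult_nonneg_nonneg pochhammer_nonneg')
  have "- pochhammer (m - 1/2) (Suc (Suc n)) * pochhammer (g/2) (Suc (Suc n)) * pochhammer g (Suc (Suc n))
     = (- pochhammer (m - 1/2) (Suc n) * pochhammer (g/2) (Suc n) * pochhammer g (Suc n)) * ((m - 1/2 + N) * (g/2 + N) * (g + N))"
    unfolding pochhammer_Suc[of _ "Suc n"] N_def by (simp only: mult_ac mult_minus_left mult_minus_right)
  also have "\<dots> \<le> (pochhammer (m - g/2) (Suc n) * pochhammer m (Suc n) * pochhammer (g + m + 1/2) (Suc n))
      * ((m - g/2 + N) * (m + N) * (g + m + 1/2 + N))"
    by (rule mult_mono) (use Suc.IH r n0 N m g 1 in \<open>auto intro!: mult_nonneg_nonneg pochhammer_nonneg'\<close>)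
  also have "\<dots> = pochhammer (m - g/2) (Suc (Suc n)) * pochhammer m (Suc (Suc n)) * pochhammer (g + m + 1/2) (Suc (Suc n))"
    unfolding pochhammer_Suc[of _ "Suc n"] N_def by (simp only: mult_ac)
  finally show ?case .
qed

lemma whipple_sum_nonneg:
  fixes g m :: real
  assumes g: "g > 0" and 1: "g \<le> 2 * m" and 2: "g \<le> m * (2 * m + 1)"
  shows "whipple_sum g m n \<ge> 0"
proof -
  have m: "m > 0" using g 1 by simp
  define T where "T = (\<lambda>k. of_nat (n choose k) * pochhammer (m - 1/2 + of_nat (n - k)) k * pochhammer (g/2) k
            * pochhammer g k / pochhammer (g + m + 1/2) k * pochhammer (m - g/2) (n - k) * pochhammer m (n - k))"
  have T0: "T k \<ge> 0" if "m \<ge> 1/2 \<or> k < n" for k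
  proof -
    have "0 \<le> m - 1/2 + of_nat (n - k)" using that m by auto
    then show ?thesis unfolding T_def using g m 1
      by (intro mult_nonneg_nonneg divide_nonneg_nonneg pochhammer_nonneg') auto
  qed
  show ?thesis
  proof (cases "m \<ge> 1/2 \<or> n = 0")
    case True
    then show ?thesis
    proof
      assume "m \<ge> 1/2"
      then have "(\<Sum>k\<le>n. T k) \<ge> 0" using T0 by (intro sum_nonneg) simp
      then show ?thesis by (simp only: whipple_sum_def T_def)
    qed (simp add: whipple_sum_def)
  next
    case False
    then obtain l where n: "n = Suc l" by (cases n) auto
    have mh: "m < 1/2" using False by simp
    have cp: "pochhammer (g + m + 1/2) n > 0" using g m by (intro pochhammer_pos) simp
    have "T 0 + T n \<ge> 0"
    proof -
      have "T 0 + T n = (pochhammer (m - g/2) n * pochhammer m n * pochhammer (g + m + 1/2) n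
          + pochhammer (m - 1/2) n * pochhammer (g/2) n * pochhammer g n) / pochhammer (g + m + 1/2) n"
        using cp by (simp add: T_def field_simps)
      also have "\<dots> \<ge> 0" using whipple_sum_end_terms[OF g m mh 1 2, of l] cp
        by (intro divide_nonneg_pos) (auto simp: n)
      finally show ?thesis .
    qed
    moreover have "whipple_sum g m n = (T 0 + T n) + (\<Sum>k\<in>{1..l}. T k)"
    proof -
      have "{..n} = {0, n} \<union> {1..l}" by (auto simp: n)
      then have "(\<Sum>k\<le>n. T k) = (\<Sum>k\<in>{0, n}. T k) + (\<Sum>k\<in>{1..l}. T k)"
        by (simp only:, subst sum.union_disjoint) (auto simp: n)
      then show ?thesis by (simp add: whipple_sum_def T_def n)
    qed
    moreover have "(\<Sum>k\<in>{1..l}. T k) \<ge> 0" using T0 by (intro sum_nonneg) (auto simp: n)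
    ultimately show ?thesis by simp
  qed
qed

text \<open>
  Each summand is at most \<open>(m)\<^sub>n\<close> times a term of the Vandermonde sum for \<open>(m)\<^sub>n\<close>.
\<close>

lemma whipple_sum_le:
  fixes g m :: real
  assumes g: "g > 0" and 1: "g \<le> 2 * m"
  shows "whipple_sum g m n \<le> pochhammer (g/2 + m) n * pochhammer (g + m) n"
proof -
  have m: "m > 0" using g 1 by simp
  have "whipple_sum g m n \<le> (\<Sum>k\<le>n. pochhammer m n * (of_nat (n choose k) * pochhammer (g/2) k * pochhammer (m - g/2) (n - k)))"
    unfolding whipple_sum_def
  proof (intro sum_mono)
    fix k assume "k \<in> {..n}"
    then have k: "k \<le> n" by simp
    have cp: "pochhammer (g + m + 1/2) k > 0" using g m by (intro pochhammer_pos) simp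
    have le1: "pochhammer g k / pochhammer (g + m + 1/2) k \<le> 1"
      using cp pochhammer_mono[of g "g + m + 1/2" k] g m by simp
    have ge0: "0 \<le> pochhammer g k / pochhammer (g + m + 1/2) k"
      using cp g by (intro divide_nonneg_pos pochhammer_nonneg') auto
    have "pochhammer (m - 1/2 + of_nat (n - k)) k * (pochhammer g k / pochhammer (g + m + 1/2) k)
        \<le> pochhammer (m + of_nat (n - k)) k"
    proof (cases "pochhammer (m - 1/2 + of_nat (n - k)) k \<ge> 0")
      case True
      have "pochhammer (m - 1/2 + of_nat (n - k)) k * (pochhammer g k / pochhammer (g + m + 1/2) k) \<le> pochhammer (m - 1/2 + of_nat (n - k)) k * 1"
        using True le1 by (intro mult_left_mono) auto
      also have "\<dots> \<le> pochhammer (m + of_nat (n - k)) k"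
        using m by (simp, intro pochhammer_mono) (auto intro: add_pos_nonneg simp: less_eq_real_def)
      finally show ?thesis .
    next
      case False
      then have "pochhammer (m - 1/2 + of_nat (n - k)) k * (pochhammer g k / pochhammer (g + m + 1/2) k) \<le> 0"
        using ge0 by (intro mult_nonpos_nonneg) auto
      also have "0 \<le> pochhammer (m + of_nat (n - k)) k" using m by (intro pochhammer_nonneg') auto
      finally show ?thesis .
    qed
    then have "(of_nat (n choose k) * pochhammer (g/2) k * pochhammer (m - g/2) (n - k) * pochhammer m (n - k)) *
        (pochhammer (m - 1/2 + of_nat (n - k)) k * (pochhammer g k / pochhammer (g + m + 1/2) k))
        \<le> (of_nat (n choose k) * pochhammer (g/2) k * pochhammer (m - g/2) (n - k) * pochhammer m (n - k)) * pochhammer (m + of_nat (n - k)) k"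
      using g m 1 by (intro mult_left_mono mult_nonneg_nonneg pochhammer_nonneg') auto
    moreover have "pochhammer m n = pochhammer m (n - k) * pochhammer (m + of_nat (n - k)) k"
      using pochhammer_product'[of m "n - k" k] k by simp
    ultimately show "of_nat (n choose k) * pochhammer (m - 1/2 + of_nat (n - k)) k * pochhammer (g/2) k
            * pochhammer g k / pochhammer (g + m + 1/2) k * pochhammer (m - g/2) (n - k) * pochhammer m (n - k)
       \<le> pochhammer m n * (of_nat (n choose k) * pochhammer (g/2) k * pochhammer (m - g/2) (n - k))"
      by (simp add: mult_ac)
  qed
  also have "\<dots> = pochhammer m n * pochhammer m n"
    unfolding sum_distrib_left[symmetric] using pochhammer_binomial_sum[of "g/2" "m - g/2" n] by simp
  also have "\<dots> \<le> pochhammer (g/2 + m) n * pochhammer (g + m) n"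
    using g m by (intro mult_mono pochhammer_mono pochhammer_nonneg') auto
  finally show ?thesis .
qed

section \<open>Bailey inversion and squares of Bessel series\<close>

text \<open>
  With \<open>f = e + 1\<close> this is \<open>(e + 2 n) \<Gamma>(e + n + j) / ((n - j)! \<Gamma>(e + 1))\<close>, the kernel of the inversion of
  Bailey pairs.  Writing \<open>e + 2 n\<close> as \<open>(e + n + j) + (n - j)\<close> gives a formula that remains valid at
  \<open>n = 0\<close>, where the Gamma function can have a pole.
\<close>

definition bailey_weight :: "real \<Rightarrow> nat \<Rightarrow> nat \<Rightarrow> real" where
  "bailey_weight f n j = pochhammer f (n + j) / fact (n - j)
     + (if j < n then pochhammer f (n + j - 1) / fact (n - j - 1) else 0)"

text \<open>
  The partial sums of the orthogonality relation have a closed form; for \<open>q = 0\<close> it vanishes.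
\<close>

lemma bailey_orthogonality_partial:
  fixes f :: real
  assumes f: "f > 0" and N: "N = j + p + q" "j < N"
  shows "(\<Sum>i\<le>p. (-1) ^ i * bailey_weight f (j + i) j / (fact (N - (j + i)) * pochhammer f (N + (j + i))))
     = (-1) ^ p * pochhammer f (2 * j + p) * q / (fact p * fact q * pochhammer f (N + j + p) * (N - j))"
  using N
proof (induction p arbitrary: q)
  case 0
  then show ?case by (simp add: bailey_weight_def mult_2)
next
  case (Suc p)
  have IH: "(\<Sum>i\<le>p. (-1) ^ i * bailey_weight f (j + i) j / (fact (N - (j + i)) * pochhammer f (N + (j + i))))
     = (-1) ^ p * pochhammer f (2 * j + p) * Suc q / (fact p * fact (Suc q) * pochhammer f (N + j + p) * (N - j))"
    using Suc.prems by (intro Suc.IH) auto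
  define A B where "A = pochhammer f (2 * j + p)" and "B = pochhammer f (N + j + p)"
  have B: "B \<noteq> 0" unfolding B_def using f by (metis less_irrefl pochhammer_pos)
  have D: "f + real (N + j + p) \<noteq> 0" using f by (metis add_pos_nonneg less_irrefl of_nat_0_le_iff)
  have w: "bailey_weight f (j + Suc p) j = A * (f + real (2 * j + p) + real (Suc p)) / fact (Suc p)"
  proof -
    have e1: "j + Suc p + j = Suc (2 * j + p)" "j + Suc p - j = Suc p" "j + Suc p + j - 1 = 2 * j + p" "j + Suc p - j - 1 = p"
      by auto
    have e2: "A / fact p = A * real (Suc p) / fact (Suc p)" by (simp del: of_nat_Suc)
    have "bailey_weight f (j + Suc p) j = A * (f + real (2 * j + p)) / fact (Suc p) + A / fact p"
      unfolding bailey_weight_def e1 pochhammer_Suc A_def by simp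
    then show ?thesis unfolding e2 by (simp only: add_divide_distrib distrib_left)
  qed
  have nj: "real N - real j \<noteq> 0" "real (N - j) = real N - real j" using Suc.prems by auto
  have nj': "real N - real j = real p + 1 + real q" using Suc.prems by simp
  have e3: "N - (j + Suc p) = q" "N + (j + Suc p) = Suc (N + j + p)" using Suc.prems by auto
  have "(\<Sum>i\<le>Suc p. (-1) ^ i * bailey_weight f (j + i) j / (fact (N - (j + i)) * pochhammer f (N + (j + i))))
    = (-1) ^ p * A * Suc q / (fact p * fact (Suc q) * B * (N - j))
      - (-1) ^ p * (A * (f + real (2 * j + p) + real (Suc p)) / fact (Suc p)) / (fact q * (B * (f + real (N + j + p))))"
    by (simp only: sum.atMost_Suc IH w e3 pochhammer_Suc A_def[symmetric] B_def[symmetric]) simp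
  also have "(-1) ^ p * A * Suc q / (fact p * fact (Suc q) * B * (N - j))
      = (-1) ^ p * A * real (Suc p) * (f + real (N + j + p)) / (fact (Suc p) * fact q * (B * (f + real (N + j + p))) * (N - j))"
  proof -
    have "s * Q / (x * (Q * y) * b * n) = s * P * D / (P * x * y * (b * D) * n)"
      if "Q \<noteq> 0" "P \<noteq> 0" "D \<noteq> 0" for s Q x y b n P D :: real
      using that by simp
    from this[of "real (Suc q)" "real (Suc p)" "f + real (N + j + p)"] D show ?thesis
      unfolding fact_Suc of_nat_mult by (simp only: of_nat_fact of_nat_eq_0_iff nat.distinct simp_thms not_False_eq_True)
  qed
  also have "(-1) ^ p * (A * (f + real (2 * j + p) + real (Suc p)) / fact (Suc p)) / (fact q * (B * (f + real (N + j + p))))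
      = (-1) ^ p * A * ((f + real (2 * j + p) + real (Suc p)) * (N - j)) / (fact (Suc p) * fact q * (B * (f + real (N + j + p))) * (N - j))"
  proof -
    have "s * (a * x / y) / (z * w) = s * a * (x * n) / (y * z * w * n)" if "n \<noteq> 0" for s a x y z w n :: real
      using that by simp
    then show ?thesis using nj by metis
  qed
  also have "(-1) ^ p * A * real (Suc p) * (f + real (N + j + p)) / (fact (Suc p) * fact q * (B * (f + real (N + j + p))) * (N - j))
      - (-1) ^ p * A * ((f + real (2 * j + p) + real (Suc p)) * (N - j)) / (fact (Suc p) * fact q * (B * (f + real (N + j + p))) * (N - j))
      = (-1) ^ p * A * (real (Suc p) * (f + real (N + j + p)) - (f + real (2 * j + p) + real (Suc p)) * (N - j))
        / (fact (Suc p) * fact q * (B * (f + real (N + j + p))) * (N - j))"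
    by (simp only: diff_divide_distrib right_diff_distrib mult.assoc)
  also have "real (Suc p) * (f + real (N + j + p)) - (f + real (2 * j + p) + real (Suc p)) * (N - j)
     = - (f + real (2 * j + p)) * q"
    unfolding nj using Suc.prems(1) by (simp add: algebra_simps)
  finally have eq: "(\<Sum>i\<le>Suc p. (-1) ^ i * bailey_weight f (j + i) j / (fact (N - (j + i)) * pochhammer f (N + (j + i))))
     = (-1) ^ p * A * (- (f + real (2 * j + p)) * q) / (fact (Suc p) * fact q * (B * (f + real (N + j + p))) * (N - j))" .
  have "pochhammer f (2 * j + Suc p) = A * (f + real (2 * j + p))"
    "pochhammer f (N + j + Suc p) = B * (f + real (N + j + p))"
    by (simp_all only: A_def B_def add_Suc_right pochhammer_Suc)
  moreover have "s * a * (- y * q) / z = - 1 * s * (a * y) * q / z" for s a y q z :: real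
    by simp
  ultimately show ?case unfolding eq power_Suc by metis
qed

lemma bailey_orthogonality:
  fixes f :: real
  assumes f: "f > 0" and j: "j \<le> N"
  shows "(\<Sum>i\<le>N - j. (-1) ^ i * bailey_weight f (j + i) j / (fact (N - (j + i)) * pochhammer f (N + (j + i))))
     = (if j = N then 1 else 0)"
proof (cases "j = N")
  case True
  have "pochhammer f (2 * N) \<noteq> 0" using f by (metis less_irrefl pochhammer_pos)
  then show ?thesis using True by (simp add: bailey_weight_def mult_2)
next
  case False
  then show ?thesis using bailey_orthogonality_partial[OF f, of N j "N - j" 0] j by simp
qed

text \<open>
  The two triangular systems of a Bailey pair are inverse to each other: exchange the sums and
  use orthogonality.
\<close>

lemma bailey_inversion:
  fixes f :: real and G :: "nat \<Rightarrow> real"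
  assumes f: "f > 0"
  shows "(\<Sum>n\<le>N. (-1) ^ n * (\<Sum>j\<le>n. (-1) ^ j * bailey_weight f n j * G j) / (fact (N - n) * pochhammer f (N + n))) = G N"
proof -
  define h where "h = (\<lambda>n j. (-1) ^ n * ((-1) ^ j * bailey_weight f n j * G j) / (fact (N - n) * pochhammer f (N + n)))"
  have "(\<Sum>n\<le>N. (-1) ^ n * (\<Sum>j\<le>n. (-1) ^ j * bailey_weight f n j * G j) / (fact (N - n) * pochhammer f (N + n)))
      = (\<Sum>n\<le>N. \<Sum>j\<le>n. h n j)"
    by (simp only: h_def sum_distrib_left sum_divide_distrib)
  also have "\<dots> = (\<Sum>j\<le>N. \<Sum>n=j..N. h n j)"
    unfolding sum.Sigma[OF finite_atMost ballI[OF finite_atMost]] sum.Sigma[OF finite_atMost ballI[OF finite_atLeastAtMost]]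
    by (rule sum.reindex_bij_witness[of _ prod.swap prod.swap]) auto
  also have "\<dots> = (\<Sum>j\<le>N. G j * (if j = N then 1 else 0))"
  proof (intro sum.cong refl)
    fix j assume "j \<in> {..N}"
    then have j: "j \<le> N" by simp
    have "(\<Sum>n=j..N. h n j) = (\<Sum>i\<le>N - j. h (j + i) j)"
      using sum.shift_bounds_cl_nat_ivl[of "\<lambda>n. h n j" 0 j "N - j"] j
      by (simp add: atMost_atLeast0 add.commute)
    also have "\<dots> = (\<Sum>i\<le>N - j. G j * ((-1) ^ i * bailey_weight f (j + i) j / (fact (N - (j + i)) * pochhammer f (N + (j + i)))))"
    proof (intro sum.cong refl)
      fix i
      have "(-1) ^ (j + i) * ((-1) ^ j * x) = ((-1) ^ i * x :: real)" for x
        by (simp add: power_add mult_ac)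
      then show "h (j + i) j = G j * ((-1) ^ i * bailey_weight f (j + i) j / (fact (N - (j + i)) * pochhammer f (N + (j + i))))"
        unfolding h_def by (simp add: mult.assoc mult.commute)
    qed
    also have "\<dots> = G j * (if j = N then 1 else 0)"
      unfolding sum_distrib_left[symmetric] bailey_orthogonality[OF f j] ..
    finally show "(\<Sum>n=j..N. h n j) = G j * (if j = N then 1 else 0)" .
  qed
  also have "\<dots> = G N" by (simp add: if_distrib cong: if_cong)
  finally show ?thesis .
qed

lemma bailey_weight_eq:
  fixes f :: real
  assumes "j \<le> n"
  shows "bailey_weight f n j = bailey_weight f n 0 * (of_nat (n choose j) * fact j * pochhammer (of_nat n + (f - 1)) j)"
proof (cases n)
  case 0
  then show ?thesis using assms by simp
next
  case (Suc l)
  have w: "bailey_weight f n j = pochhammer f (l + j) * (f + real (l + n)) / fact (n - j)" if "j \<le> n" for j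
  proof -
    have e: "n + j = Suc (l + j)" "n + j - 1 = l + j" using Suc by auto
    have "(if j < n then pochhammer f (l + j) / fact (n - j - 1) else 0) = pochhammer f (l + j) * real (n - j) / fact (n - j)"
    proof (cases "j < n")
      case True
      then obtain r where "n - j = Suc r" by (metis Suc_diff_Suc)
      then show ?thesis using True by (simp add: field_simps del: of_nat_Suc)
    qed (use that in auto)
    then have "bailey_weight f n j = pochhammer f (l + j) * (f + real (l + j)) / fact (n - j) + pochhammer f (l + j) * real (n - j) / fact (n - j)"
      unfolding bailey_weight_def e(2) unfolding e(1) pochhammer_Suc by simp
    also have "\<dots> = pochhammer f (l + j) * ((f + real (l + j)) + real (n - j)) / fact (n - j)"
      by (simp only: add_divide_distrib distrib_left)
    finally show ?thesis using that by (simp add: of_nat_diff)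
  qed
  have "of_nat (n choose j) * fact j * fact (n - j) = (fact n :: real)"
    using binomial_fact_lemma[OF assms] by (metis (no_types, lifting) mult.commute mult.left_commute of_nat_fact of_nat_mult)
  then have b: "of_nat (n choose j) * fact j / fact n = (1 / fact (n - j) :: real)"
    by (simp add: field_simps)
  have "real n + (f - 1) = f + real l" by (simp add: Suc)
  then have "pochhammer f (l + j) = pochhammer f l * pochhammer (real n + (f - 1)) j"
    by (simp only: pochhammer_product')
  then have "bailey_weight f n j = pochhammer f l * (f + real (l + n)) * pochhammer (real n + (f - 1)) j * (1 / fact (n - j))"
    unfolding w[OF assms] by simp
  also have "\<dots> = bailey_weight f n 0 * (of_nat (n choose j) * fact j * pochhammer (of_nat n + (f - 1)) j)"
    unfolding b[symmetric] w[of 0, simplified] by simp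
  finally show ?thesis .
qed

text \<open>
  Up to a power of its argument the series is the square of a Bessel function of index \<open>u - 1\<close>.
  The Cauchy product is evaluated by Vandermonde after reflecting the Pochhammer symbols.
\<close>

lemma bessel_square:
  fixes u x :: real
  assumes u: "u > 0"
  shows "(\<lambda>k. (-1) ^ k * (pochhammer (2 * u - 1 + of_nat k) k / (fact k * (Gamma (u + of_nat k))\<^sup>2)) * x ^ k)
          sums ((\<Sum>i. (-1) ^ i * x ^ i / (fact i * Gamma (u + of_nat i)))\<^sup>2)"
proof -
  define s where "s = (\<lambda>i. (-1) ^ i * x ^ i / (fact i * Gamma (u + of_nat i)))"
  have Gp: "Gamma (u + of_nat i) > 0" for i using u by (intro Gamma_real_pos) (auto intro: add_pos_nonneg)
  have bd: "1 / Gamma (u + of_nat i) \<le> (1 + 1 / u) / Gamma u" for i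
  proof (cases i)
    case 0
    then show ?thesis using u Gp[of 0] by (simp add: field_simps)
  next
    case (Suc l)
    have "pochhammer u i = u * pochhammer (u + 1) l" by (simp add: Suc pochhammer_rec)
    moreover have "pochhammer (u + 1) l \<ge> 1"
    proof (induction l)
      case (Suc l)
      have "1 * 1 \<le> pochhammer (u + 1) l * (u + 1 + of_nat l)"
        using u by (intro mult_mono Suc) (auto intro!: pochhammer_nonneg')
      then show ?case by (simp add: pochhammer_Suc)
    qed simp
    ultimately have "pochhammer u i \<ge> u" using u by simp
    moreover have "u \<notin> \<int>\<^sub>\<le>\<^sub>0" using u by (auto elim!: nonpos_Ints_cases)
    then have "Gamma (u + of_nat i) = pochhammer u i * Gamma u"
      using Gp[of 0] by (simp add: pochhammer_Gamma)
    ultimately have "Gamma (u + of_nat i) \<ge> u * Gamma u" using Gp[of 0] by simp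
    then have "1 / Gamma (u + of_nat i) \<le> 1 / (u * Gamma u)"
      using u Gp[of 0] Gp[of i] by (intro divide_left_mono) auto
    also have "\<dots> \<le> (1 + 1 / u) / Gamma u" using u Gp[of 0] by (simp add: field_simps)
    finally show ?thesis .
  qed
  have sm: "summable (\<lambda>i. norm (s i))"
  proof (rule summable_comparison_test'[where N = 0])
    show "summable (\<lambda>i. (1 + 1 / u) / Gamma u * (\<bar>x\<bar> ^ i / fact i))"
      using summable_exp_generic[of "\<bar>x\<bar>"] by (intro summable_mult) (simp add: field_simps scaleR_conv_of_real)
    fix i
    have "norm (s i) = (1 / Gamma (u + of_nat i)) * (\<bar>x\<bar> ^ i / fact i)"
      using Gp[of i] by (simp add: s_def abs_mult power_abs)
    also have "\<dots> \<le> (1 + 1 / u) / Gamma u * (\<bar>x\<bar> ^ i / fact i)"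
      using bd[of i] by (intro mult_right_mono) auto
    finally show "norm (norm (s i)) \<le> (1 + 1 / u) / Gamma u * (\<bar>x\<bar> ^ i / fact i)" by simp
  qed
  have "(\<lambda>k. \<Sum>i\<le>k. s i * s (k - i)) sums ((\<Sum>i. s i) * (\<Sum>i. s i))"
    by (rule Cauchy_product_sums[OF sm sm])
  moreover have "(\<Sum>i\<le>k. s i * s (k - i)) = (-1) ^ k * (pochhammer (2 * u - 1 + of_nat k) k / (fact k * (Gamma (u + of_nat k))\<^sup>2)) * x ^ k" for k
  proof -
    let ?w = "1 - u - of_nat k"
    have "(\<Sum>i\<le>k. s i * s (k - i)) = (\<Sum>i\<le>k. x ^ k / (fact k * (Gamma (u + of_nat k))\<^sup>2)
        * (of_nat (k choose i) * pochhammer ?w i * pochhammer ?w (k - i)))"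
    proof (intro sum.cong refl)
      fix i assume "i \<in> {..k}"
      then obtain l where k: "k = i + l" using le_Suc_ex by auto
      have G: "1 / Gamma (u + of_nat i) = (-1) ^ l * pochhammer ?w l / Gamma (u + of_nat k)" if "k = i + l" for i l
      proof -
        have "u + of_nat i \<notin> \<int>\<^sub>\<le>\<^sub>0" using u by (auto elim!: nonpos_Ints_cases)
        then have "pochhammer (u + of_nat i) l = Gamma (u + of_nat k) / Gamma (u + of_nat i)"
          using that by (simp add: pochhammer_Gamma add.assoc)
        moreover have "pochhammer ?w l = (-1) ^ l * pochhammer (u + of_nat i) l"
          using pochhammer_reflect[of "u + of_nat i" l] that by (simp add: algebra_simps)
        ultimately show ?thesis using Gp[of i] Gp[of k] by (simp add: field_simps)
      qed
      have ki: "k - i = l" using k by simp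
      have "(k choose i) * (fact i * fact l) = fact k"
        using binomial_fact_lemma[of i k] k by (simp add: mult_ac)
      then have "of_nat (k choose i) * (fact i * fact l) = (fact k :: real)"
        by (metis of_nat_fact of_nat_mult)
      then have bin: "1 / (fact i * fact l) = (of_nat (k choose i) / fact k :: real)"
        by (simp add: field_simps)
      have "s i * s l = (-1) ^ k * x ^ k * (1 / (fact i * fact l)) * (1 / Gamma (u + of_nat i)) * (1 / Gamma (u + of_nat l))"
        by (simp add: s_def k power_add mult_ac)
      also have "\<dots> = (-1) ^ k * x ^ k * (of_nat (k choose i) / fact k) * ((-1) ^ l * pochhammer ?w l / Gamma (u + of_nat k))
          * ((-1) ^ i * pochhammer ?w i / Gamma (u + of_nat k))"
        unfolding bin G[OF k] using G[of l i] k by simp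
      also have "\<dots> = ((-1) ^ k * (-1) ^ (i + l)) * (x ^ k / (fact k * (Gamma (u + of_nat k))\<^sup>2)
        * (of_nat (k choose i) * pochhammer ?w i * pochhammer ?w l))"
        by (simp add: power_add power2_eq_square mult_ac)
      finally show "s i * s (k - i) = x ^ k / (fact k * (Gamma (u + of_nat k))\<^sup>2)
        * (of_nat (k choose i) * pochhammer ?w i * pochhammer ?w (k - i))"
        unfolding ki by (simp add: k[symmetric])
    qed
    also have "\<dots> = x ^ k / (fact k * (Gamma (u + of_nat k))\<^sup>2) * pochhammer (?w + ?w) k"
      unfolding sum_distrib_left[symmetric] pochhammer_binomial_sum ..
    also have "pochhammer (?w + ?w) k = (-1) ^ k * pochhammer (2 * u - 1 + of_nat k) k"
      using pochhammer_reflect[of "2 * u - 1 + of_nat k" k] by (simp add: algebra_simps)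
    finally show ?thesis by simp
  qed
  ultimately show ?thesis by (simp add: s_def power2_eq_square)
qed

section \<open>Nonnegativity for order two\<close>

lemma pochhammer_ge_1:
  fixes f :: real
  assumes "f \<ge> 1"
  shows "pochhammer f l \<ge> 1"
proof (induction l)
  case (Suc l)
  have "1 * 1 \<le> pochhammer f l * (f + of_nat l)"
    using assms by (intro mult_mono Suc) (auto intro!: pochhammer_nonneg')
  then show ?case by (simp add: pochhammer_Suc)
qed simp

lemma pochhammer_le_longer:
  fixes f :: real
  assumes f: "f > 0" and r: "r \<le> R"
  shows "pochhammer f r \<le> (1 + 1 / f) * pochhammer f R"
proof (cases r)
  case 0
  show ?thesis
  proof (cases R)
    case (Suc l)
    have "f * 1 \<le> f * pochhammer (f + 1) l" using f by (intro mult_left_mono pochhammer_ge_1) auto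
    then have "f \<le> pochhammer f R" by (simp add: Suc pochhammer_rec)
    then have "(1 + 1 / f) * f \<le> (1 + 1 / f) * pochhammer f R"
      using f by (intro mult_left_mono) auto
    then show ?thesis using f 0 by (simp add: distrib_right)
  qed (use 0 f in simp)
next
  case (Suc l)
  have pos: "pochhammer f r > 0" using f by (intro pochhammer_pos)
  have "pochhammer f r * 1 \<le> pochhammer f r * pochhammer (f + of_nat r) (R - r)"
    using f pos Suc by (intro mult_left_mono pochhammer_ge_1) auto
  also have "\<dots> = pochhammer f R" using r by (simp add: pochhammer_product)
  also have "\<dots> \<le> (1 + 1 / f) * pochhammer f R"
    using f pochhammer_pos[OF f, of R] by (simp add: distrib_right)
  finally show ?thesis by simp
qed

lemma bailey_weight_0_bounds:
  fixes f :: real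
  assumes f: "f > 0"
  shows "0 \<le> bailey_weight f n 0"
    and "bailey_weight f n 0 / pochhammer f (2 * n + k) \<le> (1 + 1 / f) * 2 ^ n / fact n"
proof -
  show "0 \<le> bailey_weight f n 0"
    using f by (auto simp: bailey_weight_def intro!: pochhammer_nonneg' add_nonneg_nonneg divide_nonneg_nonneg)
  have P: "pochhammer f (2 * n + k) > 0" using f by (intro pochhammer_pos)
  have "(if 0 < n then pochhammer f (n - 1) / fact (n - 1) else 0)
     \<le> (1 + 1 / f) * pochhammer f (2 * n + k) * (real n / fact n)"
  proof (cases n)
    case (Suc l)
    have "pochhammer f l / fact l \<le> (1 + 1 / f) * pochhammer f (2 * n + k) / fact l"
      using f by (intro divide_right_mono pochhammer_le_longer) (auto simp: Suc)
    also have "(1 / fact l :: real) = real n / fact n" by (simp add: Suc del: of_nat_Suc)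
    then have "(1 + 1 / f) * pochhammer f (2 * n + k) / fact l = (1 + 1 / f) * pochhammer f (2 * n + k) * (real n / fact n)"
      by (metis mult.right_neutral times_divide_eq_right)
    finally show ?thesis by (simp add: Suc)
  qed simp
  moreover have "pochhammer f n / fact n \<le> (1 + 1 / f) * pochhammer f (2 * n + k) * (1 / fact n)"
    using f pochhammer_le_longer[OF f, of n "2 * n + k"] by (simp add: divide_right_mono)
  ultimately have "(if 0 < n then pochhammer f (n - 1) / fact (n - 1) else 0) + pochhammer f n / fact n
      \<le> (1 + 1 / f) * pochhammer f (2 * n + k) * (real n / fact n) + (1 + 1 / f) * pochhammer f (2 * n + k) * (1 / fact n)"
    by (rule add_mono)
  also have "\<dots> = (1 + 1 / f) * pochhammer f (2 * n + k) * ((1 + real n) / fact n)"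
    by (simp only: distrib_left[symmetric] add_divide_distrib[symmetric] add.commute)
  finally have "bailey_weight f n 0 \<le> (1 + 1 / f) * pochhammer f (2 * n + k) * ((1 + real n) / fact n)"
    unfolding bailey_weight_def diff_zero add_0_right by (subst add.commute)
  also have "\<dots> \<le> (1 + 1 / f) * pochhammer f (2 * n + k) * (2 ^ n / fact n)"
  proof -
    have "real (Suc n) \<le> real (2 ^ n)" using less_exp[of n] by (metis Suc_leI of_nat_le_iff)
    then show ?thesis using f P by (intro mult_left_mono divide_right_mono) auto
  qed
  finally show "bailey_weight f n 0 / pochhammer f (2 * n + k) \<le> (1 + 1 / f) * 2 ^ n / fact n"
    using P by (simp add: field_simps)
qed

text \<open>
  With \<open>x = t / 16\<close>, the series is a positive multiple of \<open>\<Sum>n. al n x\<^sup>n J\<^sub>n(x)\<^sup>2\<close>, where \<open>J\<^sub>n\<close> is the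
  Bessel series of parameter \<open>h + n\<close>.  Comparing coefficients, the \<open>al n\<close> must solve the triangular
  system inverted above; the choice \<open>h = g/2 + m + 1/2\<close> of the Bessel parameter makes the resulting
  \<open>\<^sub>4F\<^sub>3\<close> sums balanced, so that \<open>al n\<close> is a positive factor times a nonnegative \<open>whipple_sum\<close>.
\<close>

theorem prabhakar_2_nonneg:
  fixes g m t :: real
  assumes g: "g > 0" and gm1: "g \<le> 2 * m" and gm2: "g \<le> m * (2 * m + 1)" and t: "t \<ge> 0"
  shows "prabhakar g 2 (2 * m + 2 * g) t \<ge> 0"
proof -
  have m: "m > 0" using g gm1 by simp
  define f where "f = g + 2 * m"
  define h where "h = g / 2 + m + 1 / 2"
  define v where "v = g / 2 + m"
  define b where "b = g + m"
  define x where "x = t / 16"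
  have pos: "f > 0" "h > 0" "v > 0" "b > 0" "x \<ge> 0" using g m t by (auto simp: f_def h_def v_def b_def x_def)
  have nz: "pochhammer f j \<noteq> 0" "pochhammer h j \<noteq> 0" "pochhammer v j \<noteq> 0" "pochhammer b j \<noteq> 0" "pochhammer (b + 1/2) j \<noteq> 0"
    "pochhammer (2 * b) j \<noteq> 0" for j
    using pochhammer_pos[of f j] pochhammer_pos[of h j] pochhammer_pos[of v j] pochhammer_pos[of b j]
      pochhammer_pos[of "b + 1/2" j] pochhammer_pos[of "2 * b" j] pos by auto
  define G where "G = (\<lambda>j. pochhammer h j * pochhammer g j / (fact j * (pochhammer (b + 1/2) j * pochhammer v j * pochhammer b j)))"
  \<comment> \<open>Coefficients of the expansion in squares, obtained by inverting the triangular system.\<close>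
  define al where "al = (\<lambda>n. \<Sum>j\<le>n. (-1) ^ j * bailey_weight f n j * G j)"
  have al_eq: "al n = bailey_weight f n 0 * (whipple_sum g m n / (pochhammer v n * pochhammer b n))" for n
  proof -
    have "al n = (\<Sum>j\<le>n. bailey_weight f n 0 * ((-1) ^ j * of_nat (n choose j) * pochhammer (of_nat n + (g + 2 * m - 1)) j
             * pochhammer h j * pochhammer g j
            / (pochhammer (b + 1/2) j * pochhammer v j * pochhammer b j)))"
      unfolding al_def
    proof (intro sum.cong refl)
      fix j assume "j \<in> {..n}"
      then have j: "j \<le> n" by simp
      show "(-1) ^ j * bailey_weight f n j * G j = bailey_weight f n 0 * ((-1) ^ j * of_nat (n choose j) * pochhammer (of_nat n + (g + 2 * m - 1)) j
             * pochhammer h j * pochhammer g j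
            / (pochhammer (b + 1/2) j * pochhammer v j * pochhammer b j))"
        unfolding bailey_weight_eq[OF j] G_def by (simp add: f_def mult_ac)
    qed
    also have "\<dots> = bailey_weight f n 0 * (whipple_sum g m n / (pochhammer v n * pochhammer b n))"
      unfolding sum_distrib_left[symmetric] h_def v_def b_def hypergeometric_4F3_eq_whipple_sum[OF g m] ..
    finally show ?thesis .
  qed
  have W01: "0 \<le> whipple_sum g m n / (pochhammer v n * pochhammer b n)" "whipple_sum g m n / (pochhammer v n * pochhammer b n) \<le> 1" for n
  proof -
    have "pochhammer v n * pochhammer b n > 0" using pos by (intro mult_pos_pos pochhammer_pos)
    then show "0 \<le> whipple_sum g m n / (pochhammer v n * pochhammer b n)" "whipple_sum g m n / (pochhammer v n * pochhammer b n) \<le> 1"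
      using whipple_sum_nonneg[OF g gm1 gm2, of n] whipple_sum_le[OF g gm1, of n] by (auto simp: v_def b_def)
  qed
  have al0: "al n \<ge> 0" for n unfolding al_eq using W01(1)[of n] bailey_weight_0_bounds(1)[OF pos(1), of n] by (rule mult_nonneg_nonneg[rotated])
  have al_le: "al n \<le> bailey_weight f n 0" for n unfolding al_eq using W01[of n] bailey_weight_0_bounds[OF pos(1), of n]
    by (intro mult_left_le) auto
  define Gh where "Gh = (\<lambda>N. Gamma (h + real N))"
  have Gh: "Gh N = pochhammer h N * Gamma h" "Gh N > 0" for N
  proof -
    have "h \<notin> \<int>\<^sub>\<le>\<^sub>0" using pos by (auto elim!: nonpos_Ints_cases)
    then show "Gh N = pochhammer h N * Gamma h" using Gamma_real_pos[OF pos(2)] by (simp add: pochhammer_Gamma Gh_def)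
    then show "Gh N > 0" using Gamma_real_pos[OF pos(2)] pochhammer_pos[OF pos(2), of N] by simp
  qed
  have dbl: "pochhammer f (2 * N) = 4 ^ N * pochhammer v N * pochhammer h N" for N
  proof -
    have p4: "real (2 ^ (2 * N)) = 4 ^ N" by (simp add: power_mult)
    have "2 * v = f" "v + 1/2 = h" by (simp_all add: f_def v_def h_def)
    then show ?thesis using pochhammer_double[of v N] unfolding p4 by simp
  qed
  define D where "D = (\<lambda>n k. al n * x ^ n * ((-1) ^ k * (pochhammer f (2 * (n + k)) / (pochhammer f (2 * n + k) * fact k * (Gh (n + k))\<^sup>2)) * x ^ k))"
  have Dbound: "\<bar>D n k\<bar> \<le> ((1 + 1 / f) * ((8 * x) ^ n / fact n)) * ((1 / (Gamma h)\<^sup>2) * ((4 * x) ^ k / fact k))" for n k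
  proof -
    have "pochhammer f (2 * (n + k)) / (Gh (n + k))\<^sup>2 = 4 ^ (n + k) * (pochhammer v (n + k) / pochhammer h (n + k)) / (Gamma h)\<^sup>2"
      unfolding dbl Gh using nz by (simp add: power2_eq_square)
    also have "\<dots> \<le> 4 ^ (n + k) * 1 / (Gamma h)\<^sup>2"
    proof (intro divide_right_mono mult_left_mono)
      have "pochhammer v (n + k) \<le> pochhammer h (n + k)" using pos by (intro pochhammer_mono) (auto simp: v_def h_def)
      then show "pochhammer v (n + k) / pochhammer h (n + k) \<le> 1" using pochhammer_pos[OF pos(2), of "n + k"] by simp
    qed auto
    finally have A: "pochhammer f (2 * (n + k)) / (Gh (n + k))\<^sup>2 \<le> 4 ^ (n + k) / (Gamma h)\<^sup>2" by simp
    have A0: "0 \<le> pochhammer f (2 * (n + k)) / (Gh (n + k))\<^sup>2" using pos by (intro divide_nonneg_nonneg pochhammer_nonneg') auto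
    have B: "al n / pochhammer f (2 * n + k) \<le> (1 + 1 / f) * 2 ^ n / fact n"
      using divide_right_mono[OF al_le[of n], of "pochhammer f (2 * n + k)"] bailey_weight_0_bounds(2)[OF pos(1), of n k]
        pochhammer_pos[OF pos(1), of "2 * n + k"] by simp
    have B0: "0 \<le> al n / pochhammer f (2 * n + k)" using al0[of n] pos by (intro divide_nonneg_nonneg pochhammer_nonneg') auto
    have "\<bar>D n k\<bar> = (al n / pochhammer f (2 * n + k)) * (pochhammer f (2 * (n + k)) / (Gh (n + k))\<^sup>2) * (x ^ n * x ^ k / fact k)"
      using al0[of n] pos pochhammer_pos[OF pos(1), of "2 * n + k"] pochhammer_pos[OF pos(1), of "2 * (n + k)"]
      by (simp add: D_def abs_mult power_abs mult_ac)
    also have "\<dots> \<le> ((1 + 1 / f) * 2 ^ n / fact n) * (4 ^ (n + k) / (Gamma h)\<^sup>2) * (x ^ n * x ^ k / fact k)"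
      using A A0 B B0 pos by (intro mult_mono) auto
    also have "\<dots> = ((1 + 1 / f) * ((8 * x) ^ n / fact n)) * ((1 / (Gamma h)\<^sup>2) * ((4 * x) ^ k / fact k))"
    proof -
      have "(8 :: real) ^ n = 2 ^ n * 4 ^ n" by (simp flip: power_mult_distrib)
      then show ?thesis by (simp add: power_add power_mult_distrib mult_ac)
    qed
    finally show ?thesis .
  qed
  have sumexp: "summable (\<lambda>n. y ^ n / fact n)" for y :: real
    using summable_exp_generic[of y] by (simp add: field_simps scaleR_conv_of_real)
  have row: "summable (\<lambda>k. \<bar>D n k\<bar>)" for n
  proof (rule summable_comparison_test'[where N = 0])
    show "summable (\<lambda>k. ((1 + 1 / f) * ((8 * x) ^ n / fact n)) * ((1 / (Gamma h)\<^sup>2) * ((4 * x) ^ k / fact k)))"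
      by (intro summable_mult sumexp)
    show "norm \<bar>D n k\<bar> \<le> ((1 + 1 / f) * ((8 * x) ^ n / fact n)) * ((1 / (Gamma h)\<^sup>2) * ((4 * x) ^ k / fact k))" for k
      using Dbound[of n k] by simp
  qed
  define S where "S = (\<Sum>k. (1 / (Gamma h)\<^sup>2) * ((4 * x) ^ k / fact k))"
  have tot: "summable (\<lambda>n. \<Sum>k. \<bar>D n k\<bar>)"
  proof (rule summable_comparison_test'[where N = 0])
    show "summable (\<lambda>n. ((1 + 1 / f) * ((8 * x) ^ n / fact n)) * S)"
      by (intro summable_mult summable_mult2 sumexp)
    fix n
    have "(\<Sum>k. \<bar>D n k\<bar>) \<le> (\<Sum>k. ((1 + 1 / f) * ((8 * x) ^ n / fact n)) * ((1 / (Gamma h)\<^sup>2) * ((4 * x) ^ k / fact k)))"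
      by (intro suminf_le row Dbound summable_mult sumexp)
    also have "\<dots> = ((1 + 1 / f) * ((8 * x) ^ n / fact n)) * S"
      unfolding S_def by (intro suminf_mult summable_mult sumexp)
    finally show "norm (\<Sum>k. \<bar>D n k\<bar>) \<le> ((1 + 1 / f) * ((8 * x) ^ n / fact n)) * S"
      using suminf_nonneg[OF row[of n]] by simp
  qed
  have rows: "(\<Sum>k. D n k) \<ge> 0" for n
  proof -
    have "(\<lambda>k. D n k) sums (al n * x ^ n * (\<Sum>i. (-1) ^ i * x ^ i / (fact i * Gamma (h + real n + of_nat i)))\<^sup>2)"
    proof -
      have coef: "pochhammer f (2 * (n + k)) / (pochhammer f (2 * n + k) * fact k * (Gh (n + k))\<^sup>2)
         = pochhammer (2 * (h + real n) - 1 + of_nat k) k / (fact k * (Gamma (h + real n + of_nat k))\<^sup>2)" for k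
      proof -
        have "pochhammer f (2 * (n + k)) = pochhammer f (2 * n + k) * pochhammer (f + of_nat (2 * n + k)) k"
          using pochhammer_product'[of f "2 * n + k" k] by (simp add: algebra_simps mult_2)
        also have "f + of_nat (2 * n + k) = 2 * (h + real n) - 1 + of_nat k" by (simp add: f_def h_def)
        finally show ?thesis using nz(1)[of "2 * n + k"] by (simp add: Gh_def add.assoc)
      qed
      show ?thesis unfolding D_def coef
        by (intro sums_mult bessel_square) (use pos in auto)
    qed
    then show ?thesis using al0[of n] pos by (auto simp: sums_iff)
  qed
  have nonneg: "(\<Sum>n. \<Sum>k. D n k) \<ge> 0"
  proof (rule suminf_nonneg)
    show "summable (\<lambda>n. \<Sum>k. D n k)"
      by (rule summable_comparison_test'[OF tot, of 0]) (use summable_rabs[OF row] in simp)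
  qed (rule rows)
  have diag: "(\<lambda>N. \<Sum>n\<le>N. D n (N - n)) sums (\<Sum>n. \<Sum>k. D n k)"
    by (rule abs_summable_double_series_diagonal[OF row tot])
  have Gb: "Gamma (2 * b) > 0" using pos by (intro Gamma_real_pos) simp
  have summand: "(- 1) ^ N * (pochhammer g N / fact N) * rGamma (2 * m + 2 * g + 2 * real N) * t ^ N
      = (Gamma h)\<^sup>2 / Gamma (2 * b) * (\<Sum>n\<le>N. D n (N - n))" for N
  proof -
    have "(\<Sum>n\<le>N. D n (N - n)) = (\<Sum>n\<le>N. ((-1) ^ N * x ^ N * pochhammer f (2 * N) / (Gh N)\<^sup>2) *
        ((-1) ^ n * al n / (fact (N - n) * pochhammer f (N + n))))"
    proof (intro sum.cong refl)
      fix n assume "n \<in> {..N}"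
      then obtain k where N: "N = n + k" using le_Suc_ex by auto
      have e: "N - n = k" "2 * n + k = N + n" "n + k = N" using N by auto
      have sg: "(-1) ^ k = ((-1) ^ N * (-1) ^ n :: real)" by (simp add: N power_add)
      have xx: "x ^ n * x ^ k = x ^ N" by (simp add: N power_add)
      have "D n (N - n) = (x ^ n * x ^ k) * (-1) ^ k * al n * (pochhammer f (2 * N) / (pochhammer f (N + n) * fact k * (Gh N)\<^sup>2))"
        unfolding D_def e by simp
      also have "\<dots> = ((-1) ^ N * x ^ N * pochhammer f (2 * N) / (Gh N)\<^sup>2) *
        ((-1) ^ n * al n / (fact k * pochhammer f (N + n)))" unfolding xx sg by (simp add: mult_ac)
      finally show "D n (N - n) = ((-1) ^ N * x ^ N * pochhammer f (2 * N) / (Gh N)\<^sup>2) *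
        ((-1) ^ n * al n / (fact (N - n) * pochhammer f (N + n)))" unfolding e .
    qed
    also have "\<dots> = ((-1) ^ N * x ^ N * pochhammer f (2 * N) / (Gh N)\<^sup>2) * G N"
      unfolding sum_distrib_left[symmetric] al_def bailey_inversion[OF pos(1)] ..
    finally have d: "(\<Sum>n\<le>N. D n (N - n)) = ((-1) ^ N * x ^ N * pochhammer f (2 * N) / (Gh N)\<^sup>2) * G N" .
    have "2 * b \<notin> \<int>\<^sub>\<le>\<^sub>0" using pos by (auto elim!: nonpos_Ints_cases)
    then have "Gamma (2 * b + real (2 * N)) = pochhammer (2 * b) (2 * N) * Gamma (2 * b)"
      using Gb by (simp add: pochhammer_Gamma)
    also have "pochhammer (2 * b) (2 * N) = 4 ^ N * pochhammer b N * pochhammer (b + 1/2) N"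
    proof -
      have p4: "real (2 ^ (2 * N)) = 4 ^ N" by (simp add: power_mult)
      show ?thesis using pochhammer_double[of b N] unfolding p4 by simp
    qed
    also have "2 * b + real (2 * N) = 2 * m + 2 * g + 2 * real N" by (simp add: b_def)
    finally have "rGamma (2 * m + 2 * g + 2 * real N) = 1 / (4 ^ N * pochhammer b N * pochhammer (b + 1/2) N * Gamma (2 * b))"
      by (simp add: rGamma_inverse_Gamma inverse_eq_divide)
    moreover have "t ^ N = 4 ^ N * 4 ^ N * x ^ N"
    proof -
      have "t = 4 * 4 * x" by (simp add: x_def)
      then show ?thesis by (simp only: power_mult_distrib)
    qed
    ultimately show ?thesis unfolding d G_def dbl Gh
      using nz Gb Gamma_real_pos[OF pos(2)] by (simp add: divide_simps power2_eq_square mult_ac)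
  qed
  have "prabhakar g 2 (2 * m + 2 * g) t = (Gamma h)\<^sup>2 / Gamma (2 * b) * (\<Sum>n. \<Sum>k. D n k)"
    unfolding prabhakar_def summand by (rule sums_unique[OF sums_mult[OF diag], symmetric])
  then show ?thesis using nonneg Gb by simp
qed

section \<open>The existence theorem\<close>

lemma mittag_leffler_eq_prabhakar: "mittag_leffler r \<mu> (- t :: real) = prabhakar 1 r \<mu> t"
proof -
  have "(- t) ^ n / of_real (Gamma (\<mu> + r * real n))
      = (- 1) ^ n * (pochhammer 1 n / fact n) * rGamma (\<mu> + r * real n) * t ^ n" for n
    by (simp add: pochhammer_fact[symmetric] rGamma_inverse_Gamma power_minus[of t] divide_inverse mult_ac)
  then show ?thesis unfolding mittag_leffler_def prabhakar_def by simp
qed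

lemma mem_nonneg_set_mittag_leffler_iff:
  assumes "d > 0" "\<mu> > 0"
  shows "(d, \<mu>) \<in> nonneg_set_mittag_leffler \<longleftrightarrow> (\<forall>t>0. prabhakar_kernel 1 d \<mu> t \<ge> 0)"
  using assms prabhakar_kernel_nonneg_iff[of d 1 \<mu>]
  by (simp add: nonneg_set_mittag_leffler_def mittag_leffler_eq_prabhakar)

lemma prabhakar_kernel_nonneg_same_order:
  fixes g d lam t :: real
  assumes "g > 0" "d > 0" "lam + d * g > 0" "t > 0"
    and "laplace_represents M \<tau> (prabhakar_transform g d lam)"
  shows "prabhakar_kernel g d (lam + d * g) t \<ge> 0"
  using prabhakar_kernel_nonneg_of_represents[of g d lam 1 t M \<tau>] assms by simp

text \<open>
  Through Laplace representations: nonnegative kernel, representation, mixture of scalings, and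
  back by inversion.
\<close>

lemma prabhakar_kernel_nonneg_decrease_index:
  fixes g g' d lam t :: real
  assumes g: "0 < g'" "g' \<le> g" and d: "0 < d" "d \<le> 2" and mu: "lam + d * g' > 0"
    and nn: "\<And>t. t > 0 \<Longrightarrow> prabhakar_kernel g d (lam + d * g) t \<ge> 0" and t: "t > 0"
  shows "prabhakar_kernel g' d (lam + d * g') t \<ge> 0"
proof (cases "g' = g")
  case False
  have g0: "g > 0" using g by simp
  have "d * g' \<le> d * g" using d g by (intro mult_left_mono) auto
  then have mug: "lam + d * g > 0" using mu by linarith
  obtain M :: "(real \<times> real) measure" and \<tau> where "laplace_represents M \<tau> (prabhakar_transform g' d lam)"
    using laplace_represents_decrease_index[OF g(1) _ d(1) borel_measurable_prabhakar_kernel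
        laplace_represents_prabhakar_kernel[OF g0 d mug nn]] False g by auto
  then show ?thesis using prabhakar_kernel_nonneg_same_order g d mu t by blast
qed (use nn t in simp)

text \<open>
  A Laplace transform of a measure decreases, but \<open>H\<close> would tend to \<open>0\<close> at \<open>0\<close> if \<open>lam < 0\<close>.
\<close>

lemma prabhakar_kernel_nonneg_imp_lam_nonneg:
  fixes g d lam :: real
  assumes g: "g > 0" and d: "0 < d" "d \<le> 2" and mu: "lam + d * g > 0"
    and nn: "\<And>t. t > 0 \<Longrightarrow> prabhakar_kernel g d (lam + d * g) t \<ge> 0"
  shows "lam \<ge> 0"
proof (rule ccontr)
  assume "\<not> lam \<ge> 0"
  then have lam: "lam < 0" by simp
  define h where "h = prabhakar_kernel g d (lam + d * g)"
  have L: "(\<integral>\<^sup>+t. ennreal (exp (- (z * t))) \<partial>kernel_measure h) = ennreal (prabhakar_transform g d lam z)" if "z > 0" for z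
    using laplace_represents_prabhakar_kernel[OF g d mu nn] that by (simp add: laplace_represents_def h_def)
  have le: "prabhakar_transform g d lam 1 \<le> prabhakar_transform g d lam z" if z: "0 < z" "z \<le> 1" for z
  proof -
    have "ennreal (prabhakar_transform g d lam 1) \<le> ennreal (prabhakar_transform g d lam z)"
      unfolding L[OF z(1), symmetric] L[OF zero_less_one, symmetric]
    proof (rule nn_integral_mono_AE)
      have "AE t in kernel_measure h. 0 < t" unfolding h_def by (rule AE_kernel_measure_pos) measurable
      then show "AE t in kernel_measure h. ennreal (exp (- (1 * t))) \<le> ennreal (exp (- (z * t)))"
      proof eventually_elim
        case (elim t)
        then have "z * t \<le> 1 * t" using z by (intro mult_right_mono) auto
        then show ?case by (intro ennreal_leI) simp
      qed
    qed
    then show ?thesis by (simp add: prabhakar_transform_nonneg)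
  qed
  have "prabhakar_transform g d lam 1 > 0" by (simp add: prabhakar_transform_def)
  moreover have "((\<lambda>z::real. z powr (- lam)) \<longlongrightarrow> 0) (at_right 0)" using lam by real_asymp
  ultimately have "eventually (\<lambda>z. z powr (- lam) < prabhakar_transform g d lam 1) (at_right 0)"
    by (intro order_tendstoD(2))
  then have "eventually (\<lambda>z::real. False) (at_right 0)"
    using eventually_at_right_real[OF zero_less_one]
  proof eventually_elim
    case (elim z)
    then have z: "0 < z" "z \<le> 1" by auto
    have "prabhakar_transform g d lam z \<le> z powr (- lam) * 1"
      unfolding prabhakar_transform_def using g by (intro mult_left_mono) (auto simp: powr_minus inverse_le_1_iff ge_one_powr_ge_zero)
    then show ?case using le[OF z] elim by simp
  qed
  then show False by (simp add: trivial_limit_at_right_real)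
qed

theorem not_X_exists:
  fixes a b c d :: real and f :: "real \<Rightarrow> real"
  assumes pos: "a > 0" "b > 0" "c > 0" "d > 0" and f: "threshold_mittag_leffler f"
    and cases: "d > 2 \<or> c < a * d \<or> (3 * a + b > c \<and> d = 2)
       \<or> (1 < d \<and> d \<le> 2 \<and> a + b \<ge> 1 \<and> c < a * d - d + f d)"
  shows "\<not> X_exists a b c d"
proof
  assume ex: "X_exists a b c d"
  have le: "a * d \<le> c" by (rule X_exists_imp_le[OF pos ex])
  have ab: "a + b > 0" using pos by simp
  obtain M :: "real measure" and \<tau> where rep: "laplace_represents M \<tau> (prabhakar_transform (a + b) d (c - a * d))"
    using laplace_represents_of_X_exists[OF pos ex] by blast
  consider "d > 2" | "3 * a + b > c" "d = 2" | "1 < d" "d \<le> 2" "a + b \<ge> 1" "c < a * d - d + f d"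
    using cases le by linarith
  then show False
  proof cases
    case 1
    then show False using not_laplace_represents_gt_2[OF 1 ab] rep by blast
  next
    case 2
    have "laplace_represents M \<tau> (prabhakar_transform (a + b) 2 (c - a * 2))" using rep 2 by simp
    then have "a + b \<le> c - a * 2" by (rule laplace_represents_2_index_le[OF ab])
    then show False using 2 by linarith
  next
    case 3
    define lam where "lam = c - a * d"
    have lam: "lam \<ge> 0" using le by (simp add: lam_def)
    have mu: "lam + d * 1 > 0" using lam 3 by simp
    have "d * (a + b) > 0" using ab 3 by simp
    then have "lam + d * (a + b) > 0" using lam by linarith
    then have "prabhakar_kernel (a + b) d (lam + d * (a + b)) t \<ge> 0" if "t > 0" for t
      using that rep ab pos by (intro prabhakar_kernel_nonneg_same_order[of _ _ _ _ M \<tau>]) (auto simp: lam_def)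
    then have "prabhakar_kernel 1 d (lam + d * 1) t \<ge> 0" if "t > 0" for t
      using that 3 mu by (intro prabhakar_kernel_nonneg_decrease_index[of 1 "a + b"]) auto
    then have "(d, lam + d * 1) \<in> nonneg_set_mittag_leffler"
      using mem_nonneg_set_mittag_leffler_iff[of d "lam + d * 1"] mu pos by blast
    then have "f d \<le> lam + d * 1" using f 3 mu unfolding threshold_mittag_leffler_def by blast
    then show False using 3 by (simp add: lam_def)
  qed
qed

theorem X_exists_order_le_1:
  fixes a b c d :: real
  assumes pos: "a > 0" "b > 0" "c > 0" "d > 0" and "d \<le> 1" "c \<ge> a * d"
  shows "X_exists a b c d"
proof (rule X_exists_of_prabhakar_kernel_nonneg[OF pos])
  show "prabhakar_kernel (a + b) d (c - a * d + d * (a + b)) t \<ge> 0" if "t > 0" for t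
    using that assms by (intro prabhakar_kernel_nonneg_le_1) auto
qed (use assms in auto)

text \<open>
  At index \<open>1\<close> the condition on \<open>c\<close> is the defining property of the threshold; it also forces
  \<open>a d \<le> c\<close>.
\<close>

theorem X_exists_threshold:
  fixes a b c d :: real and f :: "real \<Rightarrow> real"
  assumes pos: "a > 0" "b > 0" "c > 0" "d > 0" and f: "threshold_mittag_leffler f"
    and d: "1 < d" "d \<le> 2" and ab: "a + b \<le> 1" and c: "c \<ge> a * d - d + f d"
  shows "X_exists a b c d"
proof -
  define lam where "lam = c - a * d"
  have "a * d < 1 * d" using pos ab by (intro mult_strict_right_mono) auto
  then have mu: "lam + d * 1 > 0" unfolding lam_def using pos(3) by linarith
  have "(d, lam + d * 1) \<in> nonneg_set_mittag_leffler"
    using f d mu c unfolding threshold_mittag_leffler_def lam_def by auto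
  then have nn: "prabhakar_kernel 1 d (lam + d * 1) t \<ge> 0" if "t > 0" for t
    using mem_nonneg_set_mittag_leffler_iff[of d "lam + d * 1"] mu pos that by blast
  have lam: "lam \<ge> 0"
    by (rule prabhakar_kernel_nonneg_imp_lam_nonneg[OF zero_less_one pos(4) d(2) mu nn])
  have "d * (a + b) > 0" using pos by simp
  then have "lam + d * (a + b) > 0" using lam by linarith
  with nn have "prabhakar_kernel (a + b) d (lam + d * (a + b)) t \<ge> 0" if "t > 0" for t
    using that pos d ab by - (rule prabhakar_kernel_nonneg_decrease_index[of "a + b" 1 d lam t], auto)
  then show ?thesis using pos d lam
    by (intro X_exists_of_prabhakar_kernel_nonneg) (auto simp: lam_def)
qed

text \<open>
  With \<open>m = c / d - a\<close> the two conditions are \<open>a + b \<le> 2 m\<close> and \<open>a + b \<le> m (2 m + 1)\<close>, the hypotheses for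
  order \<open>2\<close>.  Replacing \<open>z\<close> by \<open>z\<^bsup>d/2\<^esup>\<close> changes \<open>z\<^bsup>-2m\<^esup> (1 + z\<^sup>2)\<^bsup>-(a + b)\<^esup>\<close> into the transform for order \<open>d\<close>.
\<close>

theorem X_exists_rational_region:
  fixes a b c d :: real
  assumes pos: "a > 0" "b > 0" "c > 0" "d > 0" and d: "1 < d" "d \<le> 2"
    and 1: "2 * c / d \<ge> 3 * a + b" and 2: "2 * (c / d - a) * (c / d + 1 / 2 - a) \<ge> a + b"
  shows "X_exists a b c d"
proof -
  define m where "m = c / d - a"
  have ab: "a + b > 0" using pos by simp
  have m1: "a + b \<le> 2 * m" using 1 by (simp add: m_def)
  then have m: "m > 0" using ab by simp
  have "c / d - a = m" "c / d + 1 / 2 - a = m + 1 / 2" by (simp_all add: m_def)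
  then have "2 * m * (m + 1 / 2) \<ge> a + b" using 2 by (simp only:)
  then have m2: "a + b \<le> m * (2 * m + 1)" by (simp add: algebra_simps)
  have "prabhakar (a + b) 2 (2 * m + 2 * (a + b)) t \<ge> 0" if "t > 0" for t
    using that by (intro prabhakar_2_nonneg ab m1 m2) auto
  then have nn2: "prabhakar_kernel (a + b) 2 (2 * m + 2 * (a + b)) t \<ge> 0" if "t > 0" for t
    using prabhakar_kernel_nonneg_iff[of 2 "a + b" "2 * m + 2 * (a + b)"] that by auto
  have mu: "2 * m + 2 * (a + b) > 0" using m ab by simp
  have rep: "laplace_represents (kernel_measure (prabhakar_kernel (a + b) 2 (2 * m + 2 * (a + b)))) (\<lambda>t. t) (prabhakar_transform (a + b) 2 (2 * m))"
    by (rule laplace_represents_prabhakar_kernel[OF ab _ _ mu nn2]) auto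
  have lam: "d / 2 * (2 * m) = c - a * d" using d by (simp add: m_def field_simps)
  have k: "prabhakar_kernel (a + b) (d / 2 * 2) (d / 2 * (2 * m + 2 * (a + b))) t \<ge> 0" if "t > 0" for t
    using d by (intro prabhakar_kernel_nonneg_of_represents[OF ab _ mu _ _ that rep]) auto
  have e1: "d / 2 * (2 * m + 2 * (a + b)) = c - a * d + d * (a + b)"
    unfolding lam[symmetric] by (simp add: algebra_simps)
  have e2: "d / 2 * 2 = d" by simp
  have nn: "prabhakar_kernel (a + b) d (c - a * d + d * (a + b)) t \<ge> 0" if "t > 0" for t
    using k[OF that] unfolding e1 e2 .
  have "d * m > 0" using d m by simp
  then have "c \<ge> a * d" using lam by (simp add: algebra_simps)
  then show ?thesis using pos d nn by (intro X_exists_of_prabhakar_kernel_nonneg) auto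
qed

theorem theorem1p2:
  fixes a b c d :: real and f :: "real \<Rightarrow> real"
  assumes "a > 0" and "b > 0" and "c > 0" and "d > 0"
    and "threshold_mittag_leffler f"
  shows "((d > 2
           \<or> c < a * d
           \<or> (3 * a + b > c \<and> d = 2)
           \<or> (1 < d \<and> d \<le> 2 \<and> a + b \<ge> 1 \<and> c < a * d - d + f d))
          \<longrightarrow> \<not> X_exists a b c d)
       \<and> (((d \<le> 1 \<and> c \<ge> a * d)
           \<or> (1 < d \<and> d \<le> 2 \<and> a + b \<le> 1 \<and> c \<ge> a * d - d + f d)
           \<or> (1 < d \<and> d \<le> 2 \<and> 2 * c / d \<ge> 3 * a + b
               \<and> 2 * (c / d - a) * (c / d + 1 / 2 - a) \<ge> a + b))
          \<longrightarrow> X_exists a b c d)"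
  using not_X_exists[OF assms] X_exists_order_le_1[OF assms(1-4)] X_exists_threshold[OF assms]
    X_exists_rational_region[OF assms(1-4)]
  by blast

end
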